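(* Let $\lambda(z)\,|dz|$ be a regular conformal metric of constant curvature $-1$ on a domain $G\subseteq\mathbb{C}$. Then the following are equivalent. (a) $\lambda(z)\,|dz|$ is complete. (b) Every branch of the inverse of the developing map $f:G\to\mathbb{D}$ can be analytically continued along any path $\gamma\subset\mathbb{D}$. (c) $\lambda(z)\,|dz|$ is the hyperbolic metric of $G$.
   Context: $\mathbb{D}$ is the open unit disk. A regular conformal metric $\lambda(z)\,|dz|$ on $G$ is given by a $C^2$ function $\lambda:G\to(0,+\infty)$; its curvature is $\kappa_\lambda=-\Delta(\log\lambda)/\lambda^2$. Paths are continuous and piecewise continuously differentiable. Developing map: a regular conformal metric of constant curvature $-1$ can be written locally as $\lambda(z)=\frac{2|f'(z)|}{1-|f(z)|^2}$ with $f$ analytic, locally univalent and $\mathbb{D}$-valued; such an $f$ can be analytically continued along every path in $G$, and the representation holds along the path. The resulting, in general multivalued, locally univalent analytic function $f:G\to\mathbb{D}$ is called the developing map of $\lambda(z)\,|dz|$; it is uniquely determined by the metric up to postcomposition with a conformal self-map of $\mathbb{D}$. A branch of the inverse of $f$ is an analytic local inverse of a germ of $f$ at a point $z_0\in G$, defined near $w_0=f(z_0)$; the paths along which it is continued start at $w_0$. Complete: let $\mathrm{d}_\lambda(z_0,z_1)=\inf_\gamma\int_\gamma\lambda(z)\,|dz|$, the infimum being taken over all paths $\gamma$ in $G$ joining $z_0$ and $z_1$. The metric is called complete (for $G$) if $\mathrm{d}_\lambda(z_n,z_0)\to+\infty$ for every sequence $(z_n)\subset G$ which leaves every compact subset of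 $G$ and for some (and therefore every) point $z_0\in G$. Hyperbolic metric: an SK-metric $\mu(z)\,|dz|$ on $G$ is given by a continuous function $\mu:G\to[0,+\infty)$, $\mu\not\equiv0$, whose curvature is bounded above by $-1$, i.e. $\Delta(\log\mu)(z)\ge\mu(z)^2$ at each point with $\mu(z)>0$, where $\Delta u(z)=\liminf_{r\to 0}\frac{4}{r^2}\left(\frac{1}{2\pi}\int_0^{2\pi}u(z+re^{it})\,dt-u(z)\right)$. The hyperbolic metric of $G$ (which exists whenever $G$ carries an SK-metric) is the unique maximal SK-metric $\lambda_G(z)\,|dz|$ on $G$, where $\lambda_G(z)=\sup\{\mu(z) : \mu(z)\,|dz| \text{ an SK-metric on } G\}$; it is a regular conformal metric of constant curvature $-1$.
   Formalization: In (b) the analytic continuation of a branch of the inverse is required to take values in G; with merely complex-valued continuation the claim fails for the punctured disk with the metric restricted from the disk. *)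

theory Defs
  imports "HOL-Complex_Analysis.Complex_Analysis"
begin

section \<open>Regular conformal metrics and curvature\<close>

definition C2_on :: "complex set \<Rightarrow> (complex \<Rightarrow> real) \<Rightarrow> bool" where
  "C2_on G u \<longleftrightarrow>
     (\<exists>(Du :: complex \<Rightarrow> complex \<Rightarrow>\<^sub>L real) (D2u :: complex \<Rightarrow> complex \<Rightarrow>\<^sub>L complex \<Rightarrow>\<^sub>L real).
        (\<forall>z\<in>G. (u has_derivative blinfun_apply (Du z)) (at z)) \<and>
        (\<forall>z\<in>G. (Du has_derivative blinfun_apply (D2u z)) (at z)) \<and>
        continuous_on G D2u)"

definition dir_deriv :: "complex \<Rightarrow> (complex \<Rightarrow> real) \<Rightarrow> complex \<Rightarrow> real" where
  "dir_deriv v u z = deriv (\<lambda>t::real. u (z + of_real t * v)) 0"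

definition laplacian :: "(complex \<Rightarrow> real) \<Rightarrow> complex \<Rightarrow> real" where
  "laplacian u z = dir_deriv 1 (dir_deriv 1 u) z + dir_deriv \<i> (dir_deriv \<i> u) z"

definition regular_conformal_metric :: "complex set \<Rightarrow> (complex \<Rightarrow> real) \<Rightarrow> bool" where
  "regular_conformal_metric G lam \<longleftrightarrow> C2_on G lam \<and> (\<forall>z\<in>G. 0 < lam z)"

definition curvature :: "(complex \<Rightarrow> real) \<Rightarrow> complex \<Rightarrow> real" where
  "curvature lam z = - laplacian (\<lambda>w. ln (lam w)) z / (lam z)\<^sup>2"


section \<open>Completeness\<close>

text \<open>
  The library notion \<^const>\<open>valid_path\<close> puts no condition on the derivative near the finitely many
  exceptional parameters, so a valid path may be non-rectifiable. A Henstock-Kurzweil or Bochner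
  integral would assign such a path the default value 0; the nonnegative integral gives it infinite
  length, and it then does not affect the infimum.
\<close>

definition metric_length :: "(complex \<Rightarrow> real) \<Rightarrow> (real \<Rightarrow> complex) \<Rightarrow> ennreal" where
  "metric_length lam \<gamma> =
     (\<integral>\<^sup>+ t\<in>{0..1}. ennreal (lam (\<gamma> t) * norm (vector_derivative \<gamma> (at t within {0..1}))) \<partial>lborel)"

definition metric_dist :: "complex set \<Rightarrow> (complex \<Rightarrow> real) \<Rightarrow> complex \<Rightarrow> complex \<Rightarrow> ennreal" where
  "metric_dist G lam z0 z1 =
     (INF \<gamma> \<in> {\<gamma>. valid_path \<gamma> \<and> path_image \<gamma> \<subseteq> G \<and> pathstart \<gamma> = z0 \<and> pathfinish \<gamma> = z1}.
        metric_length lam \<gamma>)"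

definition complete_conformal_metric :: "complex set \<Rightarrow> (complex \<Rightarrow> real) \<Rightarrow> bool" where
  "complete_conformal_metric G lam \<longleftrightarrow>
     (\<exists>z0\<in>G. \<forall>zs :: nat \<Rightarrow> complex.
        (\<forall>n. zs n \<in> G) \<and>
        (\<forall>K. compact K \<and> K \<subseteq> G \<longrightarrow> (\<forall>\<^sub>F n in sequentially. zs n \<notin> K)) \<longrightarrow>
        (\<lambda>n. metric_dist G lam (zs n) z0) \<longlonglongrightarrow> top)"


section \<open>Analytic continuation and the developing map\<close>

text \<open>
  \<open>continuation_along S \<gamma> F\<close>: the germs of \<open>F t\<close> at \<open>\<gamma> t\<close>, for \<open>t\<close> in the unit interval, form an
  analytic continuation along \<open>\<gamma>\<close> of the germ of \<open>F 0\<close> at \<open>\<gamma> 0\<close>, all of them with values in \<open>S\<close>.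
  For open \<open>S\<close> a germ has values in \<open>S\<close> as soon as its value at the base point lies in \<open>S\<close>.
  The values matter for inverse branches of a developing map, which are to be continued with values
  in \<open>G\<close>: if \<open>G\<close> is the punctured unit disk with the metric restricted from the disk, then \<open>f\<close> is
  the identity, whose inverse has a \<open>\<complex>\<close>-valued continuation along every path in the disk although
  the metric is not complete.
\<close>

definition continuation_along ::
    "complex set \<Rightarrow> (real \<Rightarrow> complex) \<Rightarrow> (real \<Rightarrow> complex \<Rightarrow> complex) \<Rightarrow> bool" where
  "continuation_along S \<gamma> F \<longleftrightarrow>
     (\<forall>t\<in>{0..1}. F t analytic_on {\<gamma> t} \<and> F t (\<gamma> t) \<in> S) \<and>
     (\<forall>t\<in>{0..1}. \<exists>\<delta>>0. \<forall>s\<in>{0..1}. \<bar>s - t\<bar> < \<delta> \<longrightarrow> (\<forall>\<^sub>F z in nhds (\<gamma> s). F s z = F t z))"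

definition continuable_along ::
    "complex set \<Rightarrow> (real \<Rightarrow> complex) \<Rightarrow> (complex \<Rightarrow> complex) \<Rightarrow> bool" where
  "continuable_along S \<gamma> g \<longleftrightarrow>
     (\<exists>F. continuation_along S \<gamma> F \<and> (\<forall>\<^sub>F z in nhds (pathstart \<gamma>). F 0 z = g z))"

definition represents_metric_at ::
    "(complex \<Rightarrow> real) \<Rightarrow> (complex \<Rightarrow> complex) \<Rightarrow> complex \<Rightarrow> bool" where
  "represents_metric_at lam \<phi> z \<longleftrightarrow>
     \<phi> analytic_on {z} \<and> (\<exists>U. open U \<and> z \<in> U \<and> inj_on \<phi> U) \<and> \<phi> z \<in> ball 0 1 \<and>
     (\<forall>\<^sub>F w in nhds z. lam w = 2 * norm (deriv \<phi> w) / (1 - (norm (\<phi> w))\<^sup>2))"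

text \<open>
  A multivalued analytic function is encoded as the set \<open>f\<close> of its germs: \<open>(z, \<phi>) \<in> f\<close> means that
  the germ of \<open>\<phi>\<close> at \<open>z\<close> is one of the germs of the function. A developing map consists of all
  germs obtained by continuing, along the paths in \<open>G\<close>, one germ that represents the metric.
\<close>

definition developing_map ::
    "complex set \<Rightarrow> (complex \<Rightarrow> real) \<Rightarrow> (complex \<times> (complex \<Rightarrow> complex)) set \<Rightarrow> bool" where
  "developing_map G lam f \<longleftrightarrow>
     (\<exists>z0\<in>G. \<exists>\<phi>0. represents_metric_at lam \<phi>0 z0 \<and>
        f = {(z, \<phi>). \<exists>\<gamma> F. valid_path \<gamma> \<and> path_image \<gamma> \<subseteq> G \<and>
               pathstart \<gamma> = z0 \<and> pathfinish \<gamma> = z \<and>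
               continuation_along (ball 0 1) \<gamma> F \<and>
               (\<forall>\<^sub>F w in nhds z0. F 0 w = \<phi>0 w) \<and> (\<forall>\<^sub>F w in nhds z. F 1 w = \<phi> w)})"

definition inverse_branch ::
    "(complex \<times> (complex \<Rightarrow> complex)) set \<Rightarrow> complex \<Rightarrow> (complex \<Rightarrow> complex) \<Rightarrow> bool" where
  "inverse_branch f w0 g \<longleftrightarrow>
     (\<exists>z0 \<phi>. (z0, \<phi>) \<in> f \<and> w0 = \<phi> z0 \<and> g analytic_on {w0} \<and>
        (\<forall>\<^sub>F z in nhds z0. g (\<phi> z) = z) \<and> (\<forall>\<^sub>F w in nhds w0. \<phi> (g w) = w))"


section \<open>SK-metrics and the hyperbolic metric\<close>

text \<open>
  Where \<open>\<mu> z > 0\<close>, continuity makes \<open>\<mu>\<close> positive near \<open>z\<close>, so that the real logarithm in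
  \<open>SK_metric\<close> is only evaluated at positive arguments for small radii.
\<close>

definition lower_laplacian :: "(complex \<Rightarrow> real) \<Rightarrow> complex \<Rightarrow> ereal" where
  "lower_laplacian u z =
     Liminf (at_right 0) (\<lambda>r::real. ereal (4 / r\<^sup>2 *
       (1 / (2 * pi) * integral {0..2 * pi} (\<lambda>t. u (z + of_real r * cis t)) - u z)))"

definition SK_metric :: "complex set \<Rightarrow> (complex \<Rightarrow> real) \<Rightarrow> bool" where
  "SK_metric G \<mu> \<longleftrightarrow>
     continuous_on G \<mu> \<and> (\<forall>z\<in>G. 0 \<le> \<mu> z) \<and> (\<exists>z\<in>G. \<mu> z \<noteq> 0) \<and>
     (\<forall>z\<in>G. 0 < \<mu> z \<longrightarrow> ereal ((\<mu> z)\<^sup>2) \<le> lower_laplacian (\<lambda>w. ln (\<mu> w)) z)"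

definition is_hyperbolic_metric :: "complex set \<Rightarrow> (complex \<Rightarrow> real) \<Rightarrow> bool" where
  "is_hyperbolic_metric G lam \<longleftrightarrow>
     SK_metric G lam \<and> (\<forall>z\<in>G. ereal (lam z) = (SUP \<mu> \<in> {\<mu>. SK_metric G \<mu>}. ereal (\<mu> z)))"

end

theory Submission
  imports Defs
begin

text \<open>
  The three conditions are linked in a circle: (a) implies (b), (b) implies (c), and (c) implies (a).

  Everything local rests on Liouville's theorem (\<open>liouville_local_representation\<close>): near each point
  a metric of curvature \<open>-1\<close> is the pullback of the hyperbolic metric of the unit disc under a
  holomorphic map. This map is unique up to an automorphism of the disc
  (\<open>developing_maps_differ_by_automorphism\<close>), hence every germ of the developing map represents the
  metric, and an inverse branch is a local isometry from the disc with its hyperbolic metric into \<open>G\<close>.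
  As the metric is only assumed to be twice continuously differentiable, the classical starting
  point, holomorphy of \<open>u\<^sub>z\<^sub>z - u\<^sub>z\<^sup>2\<close> for \<open>u = ln lam\<close> (half the Schwarzian of the developing map), cannot
  be read off by differentiating once more; it is obtained from difference quotients and Morera's theorem.

  From (a) to (b): suppose that an isometry into \<open>G\<close> has been extended to a disc of radius \<open>R < 1\<close>.
  Radii of this disc have bounded length, so by completeness the image lies in a compact subset of
  \<open>G\<close>. There the metric is bounded below, so the derivative of the isometry is bounded and the isometry has
  a boundary value in \<open>G\<close> at each point of the circle. The inverse of a local developing map at that value
  extends it across the circle (\<open>isometry_extends_over_boundary_point\<close>). Hence every inverse branch
  extends to the whole disc.

  From (b) to (c): continuation along the radii yields a holomorphic map of the disc into \<open>G\<close> that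
  inverts the developing map near a given point. Ahlfors' lemma, applied to this map, bounds every
  SK-metric at the point by \<open>lam\<close>.

  From (c) to (a): by Ahlfors' lemma \<open>G\<close> omits at least two points of the plane. For each omitted
  point \<open>a\<close> there are explicit SK-metrics on the plane without \<open>a\<close> and a second omitted point that are at
  least a multiple of \<open>1 / (\<bar>z - a\<bar> \<bar>ln \<bar>z - a\<bar>\<bar>)\<close> near \<open>a\<close>, respectively near \<open>\<infinity>\<close> (\<open>cusp_SK_metric\<close>).
  The maximal metric dominates them, and for them paths towards \<open>a\<close>, respectively \<open>\<infinity>\<close>, are infinitely
  long. So sets of bounded distance stay away from the boundary and from \<open>\<infinity>\<close>.
\<close>

section \<open>The generalised Laplacian of twice differentiable functions\<close>

text \<open>
  The function \<open>w\<close> is the Wirtinger derivative \<open>u\<^sub>z\<close>, and the coefficient of \<open>cnj k\<close> is its derivative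
  with respect to the conjugate variable, a quarter of the Laplacian. Differentiability of \<open>w\<close> at the
  single point \<open>z\<close> is what a second order expansion of \<open>u\<close> at \<open>z\<close> takes.
\<close>
definition has_laplacian :: "(complex \<Rightarrow> real) \<Rightarrow> complex \<Rightarrow> real \<Rightarrow> bool" where
  "has_laplacian u z L \<longleftrightarrow>
     (\<exists>w P. (\<forall>\<^sub>F x in nhds z. (u has_derivative (\<lambda>k. 2 * Re (w x * k))) (at x)) \<and>
        (w has_derivative (\<lambda>k. P * k + of_real (L / 4) * cnj k)) (at z))"

lemma has_laplacianI:
  assumes "\<forall>\<^sub>F x in nhds z. (u has_derivative (\<lambda>k. 2 * Re (w x * k))) (at x)"
    and "(w has_derivative (\<lambda>k. P * k + of_real (L / 4) * cnj k)) (at z)"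
  shows "has_laplacian u z L"
  using assms unfolding has_laplacian_def by (intro exI[of _ w] exI[of _ P]) simp

lemma has_laplacian_continuous:
  assumes "has_laplacian u z L"
  shows "\<exists>\<delta>>0. continuous_on (ball z \<delta>) u"
proof -
  obtain w where "\<forall>\<^sub>F x in nhds z. (u has_derivative (\<lambda>k. 2 * Re (w x * k))) (at x)"
    using assms unfolding has_laplacian_def by blast
  then obtain \<delta> where "\<delta> > 0" and d: "\<And>x. x \<in> ball z \<delta> \<Longrightarrow> (u has_derivative (\<lambda>k. 2 * Re (w x * k))) (at x)"
    unfolding eventually_nhds_metric by (auto simp: dist_commute)
  then show ?thesis
    by (meson has_derivative_continuous continuous_at_imp_continuous_on)
qed

lemma has_laplacian_add:
  assumes "has_laplacian u z L" "has_laplacian v z M"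
  shows "has_laplacian (\<lambda>x. u x + v x) z (L + M)"
proof -
  obtain w P where 
    1: "\<forall>\<^sub>F x in nhds z. (u has_derivative (\<lambda>k. 2 * Re (w x * k))) (at x)"
       "(w has_derivative (\<lambda>k. P * k + of_real (L / 4) * cnj k)) (at z)"
    using assms(1) unfolding has_laplacian_def by blast
  obtain w' P' where
    2: "\<forall>\<^sub>F x in nhds z. (v has_derivative (\<lambda>k. 2 * Re (w' x * k))) (at x)"
       "(w' has_derivative (\<lambda>k. P' * k + of_real (M / 4) * cnj k)) (at z)"
    using assms(2) unfolding has_laplacian_def by blast
  have "\<forall>\<^sub>F x in nhds z. ((\<lambda>x. u x + v x) has_derivative (\<lambda>k. 2 * Re ((w x + w' x) * k))) (at x)"
    using 1(1) 2(1)
  proof eventually_elim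
    case (elim x)
    then show ?case
      by (auto intro!: derivative_eq_intros simp: algebra_simps)
  qed
  moreover have "((\<lambda>x. w x + w' x) has_derivative (\<lambda>k. (P + P') * k + of_real ((L + M) / 4) * cnj k)) (at z)"
    using 1(2) 2(2) by (auto intro!: derivative_eq_intros simp: algebra_simps add_divide_distrib)
  ultimately show ?thesis by (rule has_laplacianI)
qed

lemma has_laplacian_const: "has_laplacian (\<lambda>x. c) z 0"
proof -
  show ?thesis
    by (rule has_laplacianI[where w = "\<lambda>_. 0" and P = 0]) simp_all
qed

lemma has_laplacian_cong:
  assumes "has_laplacian u z L" "\<forall>\<^sub>F x in nhds z. u x = v x"
  shows "has_laplacian v z L"
proof -
  obtain w P where 
    1: "\<forall>\<^sub>F x in nhds z. (u has_derivative (\<lambda>k. 2 * Re (w x * k))) (at x)"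
       "(w has_derivative (\<lambda>k. P * k + of_real (L / 4) * cnj k)) (at z)"
    using assms(1) unfolding has_laplacian_def by blast
  have "\<forall>\<^sub>F x in nhds z. \<forall>\<^sub>F y in nhds x. u y = v y"
    using assms(2) by (simp add: eventually_eventually)
  with 1(1) have "\<forall>\<^sub>F x in nhds z. (v has_derivative (\<lambda>k. 2 * Re (w x * k))) (at x)"
  proof eventually_elim
    case (elim x)
    then show ?case
      using has_derivative_transform_eventually[of u "\<lambda>k. 2 * Re (w x * k)" x UNIV v] eventually_nhds_x_imp_x[OF elim(2)]
      by (simp add: eventually_at_filter eventually_mono)
  qed
  from this 1(2) show ?thesis by (rule has_laplacianI)
qed

text \<open>
  The difference between \<open>u\<close> and its quadratic polynomial has a derivative that is small compared
  with \<open>norm h\<close>, because \<open>w\<close> is differentiable at \<open>z\<close>. The mean value inequality integrates this.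
\<close>
lemma has_laplacian_expansion:
  assumes "has_laplacian u z L"
  obtains w P where "\<And>\<epsilon>. \<epsilon> > 0 \<Longrightarrow> \<exists>\<delta>>0. \<forall>h. norm h < \<delta> \<longrightarrow>
     \<bar>u (z + h) - u z - 2 * Re (w * h) - Re (P * h\<^sup>2) - L / 4 * (norm h)\<^sup>2\<bar> \<le> \<epsilon> * (norm h)\<^sup>2"
proof -
  obtain w P where ev: "\<forall>\<^sub>F x in nhds z. (u has_derivative (\<lambda>k. 2 * Re (w x * k))) (at x)"
    and w: "(w has_derivative (\<lambda>k. P * k + of_real (L / 4) * cnj k)) (at z)"
    using assms unfolding has_laplacian_def by blast
  have "\<exists>\<delta>>0. \<forall>h. norm h < \<delta> \<longrightarrow>
     \<bar>u (z + h) - u z - 2 * Re (w z * h) - Re (P * h\<^sup>2) - L / 4 * (norm h)\<^sup>2\<bar> \<le> \<epsilon> * (norm h)\<^sup>2"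
    if "\<epsilon> > 0" for \<epsilon>
  proof -
    obtain d1 where d1: "d1 > 0" "\<And>x. dist x z < d1 \<Longrightarrow> (u has_derivative (\<lambda>k. 2 * Re (w x * k))) (at x)"
      using ev unfolding eventually_nhds_metric by blast
    obtain d2 where d2: "d2 > 0" "\<And>y. norm (y - z) < d2 \<Longrightarrow>
        norm (w y - w z - (P * (y - z) + of_real (L / 4) * cnj (y - z))) \<le> \<epsilon> / 2 * norm (y - z)"
      using w \<open>\<epsilon> > 0\<close> unfolding has_derivative_at_alt by (meson half_gt_zero)
    define \<delta> where "\<delta> = min d1 d2"
    define r where "r h = u (z + h) - u z - 2 * Re (w z * h) - Re (P * h\<^sup>2) - L / 4 * (Re h * Re h + Im h * Im h)" for h
    define e where "e h = w (z + h) - w z - (P * h + of_real (L / 4) * cnj h)" for h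
    have dr: "(r has_derivative (\<lambda>k. 2 * Re (e h * k))) (at h)" if "norm h < \<delta>" for h
    proof -
      have "(u has_derivative (\<lambda>k. 2 * Re (w (z + h) * k))) (at (z + h))"
        using d1(2)[of "z + h"] that by (simp add: \<delta>_def dist_norm)
      then have "((\<lambda>h. u (z + h)) has_derivative (\<lambda>k. 2 * Re (w (z + h) * k))) (at h)"
        using has_derivative_compose[OF has_derivative_add[OF has_derivative_const has_derivative_ident],
            of u "\<lambda>k. 2 * Re (w (z + h) * k)" z h UNIV] by simp
      note * = this
      show ?thesis unfolding r_def e_def power2_eq_square
        by (rule derivative_eq_intros * has_derivative_Re has_derivative_Im refl)+
           (auto simp: algebra_simps)
    qed
    have "\<bar>r h\<bar> \<le> \<epsilon> * (norm h)\<^sup>2" if h: "norm h < \<delta>" for h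
    proof -
      have "norm (r h - r 0) \<le> (\<epsilon> * norm h) * norm (h - 0)"
      proof (rule differentiable_bound[where S = "cball 0 (norm h)" and f' = "\<lambda>x k. 2 * Re (e x * k)"])
        fix x :: complex assume x: "x \<in> cball 0 (norm h)"
        then have xd: "norm x < \<delta>" using h by auto
        show "(r has_derivative (\<lambda>k. 2 * Re (e x * k))) (at x within cball 0 (norm h))"
          using dr[OF xd] has_derivative_at_withinI by blast
        have "norm (e x) \<le> \<epsilon> / 2 * norm x"
          using d2(2)[of "z + x"] xd unfolding e_def by (simp add: \<delta>_def)
        also have "\<dots> \<le> \<epsilon> / 2 * norm h" using x \<open>\<epsilon> > 0\<close> by simp
        finally have ex: "2 * norm (e x) \<le> \<epsilon> * norm h" by simp
        show "onorm (\<lambda>k. 2 * Re (e x * k)) \<le> \<epsilon> * norm h"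
        proof (rule onorm_bound)
          show "0 \<le> \<epsilon> * norm h" using \<open>\<epsilon> > 0\<close> by simp
          fix k
          have "norm (2 * Re (e x * k)) \<le> 2 * norm (e x * k)" using abs_Re_le_cmod[of "e x * k"] by (simp add: abs_mult del: times_complex.sel)
          also have "\<dots> \<le> \<epsilon> * norm h * norm k"
            using mult_right_mono[OF ex, of "norm k"] by (simp add: norm_mult mult.assoc)
          finally show "norm (2 * Re (e x * k)) \<le> \<epsilon> * norm h * norm k" .
        qed
      qed auto
      moreover have "r 0 = 0" by (simp add: r_def)
      ultimately show ?thesis by (simp add: power2_eq_square mult.assoc)
    qed
    moreover have "\<delta> > 0" using d1 d2 by (simp add: \<delta>_def)
    moreover have "(norm h)\<^sup>2 = Re h * Re h + Im h * Im h" for h :: complex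
      by (simp only: cmod_power2) (simp only: power2_eq_square)
    ultimately show ?thesis unfolding r_def by auto
  qed
  then show thesis using that by blast
qed

text \<open>
  Averages over circles do not see the harmonic terms of a second order expansion.
\<close>
lemma integral_cis_circle:
  assumes "n > 0"
  shows "((\<lambda>t. Re (c * cis (real n * t))) has_integral 0) {0..2 * pi}"
proof -
  have "((\<lambda>t. Re (c * cis (real n * t))) has_integral
     (Re (c * cis (real n * (2 * pi)) / (\<i> * real n)) - Re (c * cis (real n * 0) / (\<i> * real n)))) {0..2 * pi}"
  proof (rule fundamental_theorem_of_calculus)
    fix t :: real
    have "((\<lambda>t. cis (real n * t)) has_vector_derivative (real n *\<^sub>R (\<i> * cis (real n * t)))) (at t within {0..2 * pi})"
      unfolding has_vector_derivative_def
      by (auto intro!: derivative_eq_intros simp: scaleR_conv_of_real)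
    then have "((\<lambda>t. c / (\<i> * real n) * cis (real n * t)) has_vector_derivative (c * cis (real n * t))) (at t within {0..2 * pi})"
      using has_vector_derivative_mult_right[of _ _ _ "c / (\<i> * real n)"] assms
      by (fastforce simp: scaleR_conv_of_real field_simps)
    from bounded_linear.has_vector_derivative[OF bounded_linear_Re this]
    show "((\<lambda>t. Re (c * cis (real n * t) / (\<i> * real n))) has_vector_derivative Re (c * cis (real n * t))) (at t within {0..2 * pi})"
      by simp
  qed simp
  moreover have "cis (real n * (2 * pi)) = 1"
    using cis_multiple_2pi[of "real n"] by (simp add: mult.commute mult.left_commute)
  ultimately show ?thesis by simp
qed

lemma circle_integrable:
  fixes u :: "complex \<Rightarrow> real"
  assumes "continuous_on (ball z \<delta>) u" "0 < r" "r < \<delta>"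
  shows "(\<lambda>t. u (z + of_real r * cis t)) integrable_on {0..2 * pi}"
proof (rule integrable_continuous_real)
  have "continuous_on {0..2 * pi} (\<lambda>t. z + of_real r * cis t)" by (intro continuous_intros)
  then show "continuous_on {0..2 * pi} (\<lambda>t. u (z + of_real r * cis t))"
    by (rule continuous_on_compose2[OF assms(1)]) (use assms in \<open>auto simp: dist_norm norm_mult\<close>)
qed

text \<open>
  In the average of the expansion over a circle only the term \<open>L / 4 * (norm h)\<^sup>2\<close> survives, so the
  lower limit is a limit.
\<close>
lemma lower_laplacian_eq:
  assumes "has_laplacian u z L"
  shows "lower_laplacian u z = ereal L"
proof -
  obtain w P where ex: "\<And>\<epsilon>. \<epsilon> > 0 \<Longrightarrow> \<exists>\<delta>>0. \<forall>h. norm h < \<delta> \<longrightarrow>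
     \<bar>u (z + h) - u z - 2 * Re (w * h) - Re (P * h\<^sup>2) - L / 4 * (norm h)\<^sup>2\<bar> \<le> \<epsilon> * (norm h)\<^sup>2"
    using has_laplacian_expansion[OF assms] by blast
  obtain \<delta>0 where "\<delta>0 > 0" and cont: "continuous_on (ball z \<delta>0) u"
    using has_laplacian_continuous[OF assms] by blast
  define A where "A r = 4 / r\<^sup>2 * (1 / (2 * pi) * integral {0..2 * pi} (\<lambda>t. u (z + of_real r * cis t)) - u z)" for r
  have "(A \<longlongrightarrow> L) (at_right 0)"
  proof (rule tendstoI)
    fix e :: real assume "e > 0"
    then obtain \<delta>1 where "\<delta>1 > 0" and d1: "\<And>h. norm h < \<delta>1 \<Longrightarrow>
       \<bar>u (z + h) - u z - 2 * Re (w * h) - Re (P * h\<^sup>2) - L / 4 * (norm h)\<^sup>2\<bar> \<le> e / 8 * (norm h)\<^sup>2"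
      using ex[of "e / 8"] by auto
    have "dist (A r) L < e" if r: "0 < r" "r < min \<delta>0 \<delta>1" for r
    proof -
      define I where "I = integral {0..2 * pi} (\<lambda>t. u (z + of_real r * cis t))"
      have iu: "((\<lambda>t. u (z + of_real r * cis t)) has_integral I) {0..2 * pi}"
        unfolding I_def using circle_integrable[OF cont] r by auto
      have i1: "((\<lambda>t. 2 * Re (w * (of_real r * cis t))) has_integral 0) {0..2 * pi}"
        using has_integral_mult_right[OF integral_cis_circle[of 1 "w * of_real r"], of 2] by (simp add: mult.assoc)
      have i2: "((\<lambda>t. Re (P * (of_real r * cis t)\<^sup>2)) has_integral 0) {0..2 * pi}"
        using integral_cis_circle[of 2 "P * of_real (r\<^sup>2)"]
        by (simp add: power_mult_distrib Complex.DeMoivre mult.assoc)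
      have i3: "((\<lambda>t. u z + L / 4 * r\<^sup>2) has_integral (2 * pi * (u z + L / 4 * r\<^sup>2))) {0..2 * pi}"
        using has_integral_const_real[of "u z + L / 4 * r\<^sup>2" 0 "2 * pi"] by simp
      have i4: "((\<lambda>t. u (z + of_real r * cis t) - 2 * Re (w * (of_real r * cis t)) - Re (P * (of_real r * cis t)\<^sup>2)
                  - (u z + L / 4 * r\<^sup>2)) has_integral (I - 0 - 0 - 2 * pi * (u z + L / 4 * r\<^sup>2))) {0..2 * pi}"
        by (intro has_integral_diff iu i1 i2 i3)
      have "norm (I - 0 - 0 - 2 * pi * (u z + L / 4 * r\<^sup>2)) \<le> (e / 8 * r\<^sup>2) * measure lborel {0..2 * pi}"
      proof (rule has_integral_bound_real[OF _ finite.emptyI i4], use \<open>e > 0\<close> in simp)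
        fix t assume "t \<in> {0..2 * pi} - {}"
        show "norm (u (z + of_real r * cis t) - 2 * Re (w * (of_real r * cis t)) - Re (P * (of_real r * cis t)\<^sup>2)
                  - (u z + L / 4 * r\<^sup>2)) \<le> e / 8 * r\<^sup>2"
          using d1[of "of_real r * cis t"] r by (simp add: norm_mult algebra_simps)
      qed
      then have "\<bar>I - 2 * pi * (u z + L / 4 * r\<^sup>2)\<bar> \<le> (e / 8 * r\<^sup>2) * (2 * pi)" by simp
      moreover have "I - 2 * pi * (u z + L / 4 * r\<^sup>2) = (A r - L) * (r\<^sup>2 / 4 * (2 * pi))"
        unfolding A_def I_def[symmetric] using r by (simp add: field_simps)
      ultimately have "\<bar>(A r - L) * (r\<^sup>2 / 4 * (2 * pi))\<bar> \<le> (e / 8 * r\<^sup>2) * (2 * pi)"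
        by (simp only:)
      then have "\<bar>A r - L\<bar> * (r\<^sup>2 / 4 * (2 * pi)) \<le> (e / 2) * (r\<^sup>2 / 4 * (2 * pi))"
        unfolding abs_mult by simp
      then have "\<bar>A r - L\<bar> \<le> e / 2"
        using r by (subst (asm) mult_le_cancel_right) simp
      then show ?thesis using \<open>e > 0\<close> by (simp add: dist_real_def)
    qed
    then show "\<forall>\<^sub>F r in at_right 0. dist (A r) L < e"
      unfolding eventually_at_right_field using \<open>\<delta>0 > 0\<close> \<open>\<delta>1 > 0\<close>
      by (intro exI[of _ "min \<delta>0 \<delta>1"]) auto
  qed
  then have "((\<lambda>r. ereal (A r)) \<longlongrightarrow> ereal L) (at_right 0)" by simp
  then show ?thesis
    unfolding lower_laplacian_def A_def[symmetric] by (intro lim_imp_Liminf) auto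
qed

text \<open>
  This is how a merely continuous function is compared with a smooth one that touches it at one point.
\<close>
lemma lower_laplacian_mono:
  assumes "\<delta> > 0" "continuous_on (ball z \<delta>) u" "continuous_on (ball z \<delta>) v"
    and le: "\<And>x. x \<in> ball z \<delta> \<Longrightarrow> u x \<le> v x" and eq: "u z = v z"
  shows "lower_laplacian u z \<le> lower_laplacian v z"
  unfolding lower_laplacian_def
proof (rule Liminf_mono)
  have "ereal (4 / r\<^sup>2 * (1 / (2 * pi) * integral {0..2 * pi} (\<lambda>t. u (z + of_real r * cis t)) - u z))
      \<le> ereal (4 / r\<^sup>2 * (1 / (2 * pi) * integral {0..2 * pi} (\<lambda>t. v (z + of_real r * cis t)) - v z))"
    if r: "0 < r" "r < \<delta>" for r
  proof -
    have "integral {0..2 * pi} (\<lambda>t. u (z + of_real r * cis t)) \<le> integral {0..2 * pi} (\<lambda>t. v (z + of_real r * cis t))"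
      using r assms by (intro integral_le circle_integrable) (auto simp: dist_norm norm_mult)
    then show ?thesis unfolding eq ereal_less_eq
      by (intro mult_left_mono diff_right_mono) auto
  qed
  then show "\<forall>\<^sub>F r in at_right 0. ereal (4 / r\<^sup>2 * (1 / (2 * pi) * integral {0..2 * pi} (\<lambda>t. u (z + of_real r * cis t)) - u z))
      \<le> ereal (4 / r\<^sup>2 * (1 / (2 * pi) * integral {0..2 * pi} (\<lambda>t. v (z + of_real r * cis t)) - v z))"
    unfolding eventually_at_right_field using assms(1) by (intro exI[of _ \<delta>]) auto
qed

section \<open>The curvature equation in Wirtinger derivatives\<close>

text \<open>
  Up to a factor, the imaginary part of \<open>R\<close> is the difference of the two mixed second derivatives
  of \<open>u\<close>. Both are compared with the same second difference of \<open>u\<close> over a small square, once by the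
  mean value theorem in the horizontal and once in the vertical direction.
\<close>
lemma wirtinger_cross_derivative_real:
  assumes ev: "\<forall>\<^sub>F x in nhds z. (u has_derivative (\<lambda>k. 2 * Re (w x * k))) (at x)"
    and w: "(w has_derivative (\<lambda>k. P * k + R * cnj k)) (at z)"
  shows "Im R = 0"
proof (rule ccontr)
  assume nz: "Im R \<noteq> 0"
  define \<epsilon> where "\<epsilon> = \<bar>Im R\<bar> / 8"
  have "\<epsilon> > 0" using nz by (simp add: \<epsilon>_def)
  obtain d1 where d1: "d1 > 0" "\<And>x. dist x z < d1 \<Longrightarrow> (u has_derivative (\<lambda>k. 2 * Re (w x * k))) (at x)"
    using ev unfolding eventually_nhds_metric by blast
  obtain d2 where d2: "d2 > 0" "\<And>y. norm (y - z) < d2 \<Longrightarrow>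
      norm (w y - w z - (P * (y - z) + R * cnj (y - z))) \<le> \<epsilon> * norm (y - z)"
    using w \<open>\<epsilon> > 0\<close> unfolding has_derivative_at_alt by meson
  define t where "t = min d1 d2 / 4"
  have t: "t > 0" "2 * t < d1" "2 * t < d2" using d1 d2 by (auto simp: t_def)
  define e where "e h = w (z + h) - w z - (P * h + R * cnj h)" for h
  have sq: "norm (Complex x y) \<le> 2 * t" if "x \<in> {0..t}" "y \<in> {0..t}" for x y
    using norm_triangle_le[of "complex_of_real x" "\<i> * of_real y" "2 * t"] that
    by (simp add: Complex_eq norm_mult)
  have eb: "norm (e (Complex x y)) \<le> \<epsilon> * (2 * t)" if "x \<in> {0..t}" "y \<in> {0..t}" for x y
  proof -
    have "norm (e (Complex x y)) \<le> \<epsilon> * norm (Complex x y)"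
      using d2(2)[of "z + Complex x y"] sq[OF that] t unfolding e_def by simp
    also have "\<dots> \<le> \<epsilon> * (2 * t)" using sq[OF that] \<open>\<epsilon> > 0\<close> by (intro mult_left_mono) auto
    finally show ?thesis .
  qed
  have du: "(u has_derivative (\<lambda>k. 2 * Re (w (z + Complex x y) * k))) (at (z + Complex x y))"
    if "x \<in> {0..t}" "y \<in> {0..t}" for x y
    using d1(2)[of "z + Complex x y"] sq[OF that] t by (simp add: dist_norm)
  have dx: "((\<lambda>x. u (z + Complex x y)) has_real_derivative 2 * Re (w (z + Complex x y))) (at x)"
    if "x \<in> {0..t}" "y \<in> {0..t}" for x y
  proof -
    have "((\<lambda>x. z + Complex x y) has_derivative (\<lambda>k. of_real k)) (at x)"
      unfolding Complex_eq by (auto intro!: derivative_eq_intros)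
    from has_derivative_compose[OF this du[OF that]] show ?thesis
      unfolding has_field_derivative_def by (rule has_derivative_eq_rhs) (auto simp: fun_eq_iff)
  qed
  have dy: "((\<lambda>y. u (z + Complex x y)) has_real_derivative - 2 * Im (w (z + Complex x y))) (at y)"
    if "x \<in> {0..t}" "y \<in> {0..t}" for x y
  proof -
    have "((\<lambda>y. z + Complex x y) has_derivative (\<lambda>k. \<i> * of_real k)) (at y)"
      unfolding Complex_eq by (auto intro!: derivative_eq_intros)
    from has_derivative_compose[OF this du[OF that]] show ?thesis
      unfolding has_field_derivative_def by (rule has_derivative_eq_rhs) (auto simp: fun_eq_iff)
  qed
  define S where "S = u (z + Complex t t) - u (z + Complex t 0) - u (z + Complex 0 t) + u (z + Complex 0 0)"
  have "\<exists>x. 0 < x \<and> x < t \<and> (u (z + Complex t t) - u (z + Complex t 0)) - (u (z + Complex 0 t) - u (z + Complex 0 0))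
      = (t - 0) * (2 * Re (w (z + Complex x t)) - 2 * Re (w (z + Complex x 0)))"
    by (rule MVT2[OF t(1)], intro DERIV_diff dx) (use t in auto)
  then obtain x where x: "0 < x" "x < t" and
    S1: "S = t * (2 * Re (w (z + Complex x t)) - 2 * Re (w (z + Complex x 0)))"
    unfolding S_def by (auto simp: algebra_simps)
  have "\<exists>y. 0 < y \<and> y < t \<and> (u (z + Complex t t) - u (z + Complex 0 t)) - (u (z + Complex t 0) - u (z + Complex 0 0))
      = (t - 0) * (- 2 * Im (w (z + Complex t y)) - - 2 * Im (w (z + Complex 0 y)))"
    by (rule MVT2[OF t(1)], intro DERIV_diff dy) (use t in auto)
  then obtain y where y: "0 < y" "y < t" and
    S2: "S = t * (- 2 * Im (w (z + Complex t y)) - - 2 * Im (w (z + Complex 0 y)))"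
    unfolding S_def by (auto simp: algebra_simps)
  have weq: "w (z + h) = w z + P * h + R * cnj h + e h" for h unfolding e_def by simp
  have "2 * Re (w (z + Complex x t)) - 2 * Re (w (z + Complex x 0)) 
      = - 2 * t * (Im P - Im R) + 2 * Re (e (Complex x t)) - 2 * Re (e (Complex x 0))"
    unfolding weq by (simp add: algebra_simps)
  moreover have "- 2 * Im (w (z + Complex t y)) - - 2 * Im (w (z + Complex 0 y)) 
      = - 2 * t * (Im P + Im R) - 2 * Im (e (Complex t y)) + 2 * Im (e (Complex 0 y))"
    unfolding weq by (simp add: algebra_simps)
  moreover have "2 * Re (w (z + Complex x t)) - 2 * Re (w (z + Complex x 0)) = 
     - 2 * Im (w (z + Complex t y)) - - 2 * Im (w (z + Complex 0 y))"
    using S1 S2 t by simp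
  ultimately have "4 * t * Im R = - 2 * Re (e (Complex x t)) + 2 * Re (e (Complex x 0))
      - 2 * Im (e (Complex t y)) + 2 * Im (e (Complex 0 y))"
    by (simp add: algebra_simps)
  moreover have "\<bar>Re (e (Complex x t))\<bar> \<le> \<epsilon> * (2 * t)" "\<bar>Re (e (Complex x 0))\<bar> \<le> \<epsilon> * (2 * t)"
     "\<bar>Im (e (Complex t y))\<bar> \<le> \<epsilon> * (2 * t)" "\<bar>Im (e (Complex 0 y))\<bar> \<le> \<epsilon> * (2 * t)"
    using eb x y t by (meson abs_Re_le_cmod abs_Im_le_cmod order_trans atLeastAtMost_iff less_imp_le order_refl)+
  ultimately have "\<bar>4 * t * Im R\<bar> \<le> 16 * (\<epsilon> * t)" by linarith
  then have "4 * t * \<bar>Im R\<bar> \<le> 2 * t * \<bar>Im R\<bar>" using t by (simp add: abs_mult \<epsilon>_def)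
  then show False using t nz by simp
qed

lemma laplacian_eq_wirtinger:
  assumes ev: "\<forall>\<^sub>F x in nhds z. (u has_derivative (\<lambda>k. 2 * Re (w x * k))) (at x)"
    and w: "(w has_derivative (\<lambda>k. P * k + R * cnj k)) (at z)"
  shows "laplacian u z = 4 * Re R"
proof -
  have d: "\<forall>\<^sub>F x in nhds z. dir_deriv v u x = 2 * Re (w x * v)" for v
    using ev
  proof eventually_elim
    case (elim x)
    have "((\<lambda>t. x + of_real t * v) has_derivative (\<lambda>k. of_real k * v)) (at 0)"
      by (auto intro!: derivative_eq_intros)
    from has_derivative_compose[OF this, of u "\<lambda>k. 2 * Re (w x * k)"] elim
    have "((\<lambda>t. u (x + of_real t * v)) has_derivative (\<lambda>k. 2 * Re (w x * (of_real k * v)))) (at 0)"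
      by simp
    then have "((\<lambda>t. u (x + of_real t * v)) has_real_derivative 2 * Re (w x * v)) (at 0)"
      unfolding has_field_derivative_def by (rule has_derivative_eq_rhs) (auto simp: fun_eq_iff algebra_simps)
    then show ?case unfolding dir_deriv_def by (rule DERIV_imp_deriv)
  qed
  have "dir_deriv v (dir_deriv v u) z = 2 * Re ((P * v + R * cnj v) * v)" for v
  proof -
    have lin: "((\<lambda>t::real. z + of_real t * v) has_derivative (\<lambda>k. of_real k * v)) (at 0)"
      by (auto intro!: derivative_eq_intros)
    have "((\<lambda>t. w (z + of_real t * v)) has_derivative (\<lambda>k. P * (of_real k * v) + R * cnj (of_real k * v))) (at 0)"
      using has_derivative_compose[OF lin, of w "\<lambda>k. P * k + R * cnj k"] w by simp
    then have "((\<lambda>t. 2 * Re (w (z + of_real t * v) * v)) has_derivative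
        (\<lambda>k. 2 * Re ((P * (of_real k * v) + R * cnj (of_real k * v)) * v))) (at 0)"
      by (auto intro!: derivative_eq_intros)
    then have D: "((\<lambda>t. 2 * Re (w (z + of_real t * v) * v)) has_real_derivative 2 * Re ((P * v + R * cnj v) * v)) (at 0)"
      unfolding has_field_derivative_def by (rule has_derivative_eq_rhs) (auto simp: fun_eq_iff algebra_simps)
    have "filterlim (\<lambda>t::real. z + of_real t * v) (nhds z) (nhds 0)"
      using tendsto_add[OF tendsto_const[of z] tendsto_mult[OF tendsto_of_real[OF filterlim_ident, of 0] tendsto_const[of v]]]
      by simp
    then have "\<forall>\<^sub>F t in nhds 0. dir_deriv v u (z + of_real t * v) = 2 * Re (w (z + of_real t * v) * v)"
      using d eventually_compose_filterlim by blast
    then have "deriv (\<lambda>t. dir_deriv v u (z + of_real t * v)) 0 = deriv (\<lambda>t. 2 * Re (w (z + of_real t * v) * v)) 0"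
      by (intro deriv_cong_ev) auto
    also have "\<dots> = 2 * Re ((P * v + R * cnj v) * v)" by (rule DERIV_imp_deriv[OF D])
    finally show ?thesis by (subst dir_deriv_def)
  qed
  from this[of 1] this[of \<i>] show ?thesis unfolding laplacian_def by (simp add: algebra_simps)
qed

lemma real_linear_wirtinger:
  fixes T :: "complex \<Rightarrow> complex"
  assumes "linear T"
  shows "T k = (T 1 - \<i> * T \<i>) / 2 * k + (T 1 + \<i> * T \<i>) / 2 * cnj k"
proof -
  have "k = Re k *\<^sub>R 1 + Im k *\<^sub>R \<i>" by (simp add: complex_eq_iff)
  then have "T k = T (Re k *\<^sub>R 1 + Im k *\<^sub>R \<i>)" by (rule arg_cong)
  also have "\<dots> = Re k *\<^sub>R T 1 + Im k *\<^sub>R T \<i>"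
    by (simp only: linear_add[OF assms] linear_scale[OF assms])
  finally have 1: "T k = of_real (Re k) * T 1 + of_real (Im k) * T \<i>" by (simp add: scaleR_conv_of_real)
  have 2: "k + cnj k = 2 * of_real (Re k)" "k - cnj k = 2 * \<i> * of_real (Im k)"
    by (simp_all add: complex_eq_iff)
  have "(T 1 - \<i> * T \<i>) / 2 * k + (T 1 + \<i> * T \<i>) / 2 * cnj k = (k + cnj k) / 2 * T 1 - \<i> * (k - cnj k) / 2 * T \<i>"
    by (simp add: field_simps)
  also have "\<dots> = T k" unfolding 1 2 by simp
  finally show ?thesis by simp
qed

text \<open>
  The curvature equation for \<open>u = ln lam\<close>, written as a first order equation for \<open>w = u\<^sub>z\<close>: the derivative
  of \<open>w\<close> with respect to the conjugate variable is \<open>lam\<^sup>2 / 4\<close>.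
\<close>
lemma log_conformal_metric_wirtinger:
  assumes G: "open G" and reg: "regular_conformal_metric G lam"
    and curv: "\<forall>z\<in>G. curvature lam z = -1"
  shows "\<exists>w P. (\<forall>z\<in>G. ((\<lambda>z. ln (lam z)) has_derivative (\<lambda>k. 2 * Re (w z * k))) (at z)) \<and>
    (\<forall>z\<in>G. (w has_derivative (\<lambda>k. P z * k + of_real ((lam z)\<^sup>2 / 4) * cnj k)) (at z)) \<and>
    continuous_on G P"
proof -
  obtain Du :: "complex \<Rightarrow> complex \<Rightarrow>\<^sub>L real" and D2u :: "complex \<Rightarrow> complex \<Rightarrow>\<^sub>L complex \<Rightarrow>\<^sub>L real"
    where D1: "\<And>z. z \<in> G \<Longrightarrow> (lam has_derivative blinfun_apply (Du z)) (at z)"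
      and D2: "\<And>z. z \<in> G \<Longrightarrow> (Du has_derivative blinfun_apply (D2u z)) (at z)"
      and D2c: "continuous_on G D2u"
    using reg unfolding regular_conformal_metric_def C2_on_def by blast
  have pos: "lam z > 0" if "z \<in> G" for z using reg that by (simp add: regular_conformal_metric_def)
  define N where "N z = Complex (Du z 1) (- Du z \<i>)" for z
  define w where "w z = N z / of_real (2 * lam z)" for z
  have Dk: "Du z k = Du z 1 * Re k + Du z \<i> * Im k" for z k
  proof -
    have "k = Re k *\<^sub>R 1 + Im k *\<^sub>R \<i>" by (simp add: complex_eq_iff)
    then have "Du z k = Du z (Re k *\<^sub>R 1 + Im k *\<^sub>R \<i>)" by (rule arg_cong)
    then show ?thesis by (simp add: blinfun.add_right blinfun.scaleR_right)
  qed
  have du: "((\<lambda>z. ln (lam z)) has_derivative (\<lambda>k. 2 * Re (w z * k))) (at z)" if "z \<in> G" for z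
  proof -
    have "((\<lambda>z. ln (lam z)) has_derivative (\<lambda>k. Du z k / lam z)) (at z)"
      using D1[OF that] pos[OF that] by (auto intro!: derivative_eq_intros simp: field_simps)
    moreover have "Du z k / lam z = 2 * Re (w z * k)" for k
    proof -
      have "w z * k = (1 / (2 * lam z)) *\<^sub>R (N z * k)"
        using pos[OF that] by (simp add: w_def scaleR_conv_of_real)
      then have "Re (w z * k) = 1 / (2 * lam z) * Re (N z * k)" by (simp only: scaleR_complex.sel)
      also have "Re (N z * k) = Du z k" by (simp add: N_def Dk[of z k])
      finally show ?thesis using pos[OF that] by simp
    qed
    ultimately show ?thesis by simp
  qed
  define T where "T z k = Complex (D2u z k 1) (- (D2u z k \<i>)) / of_real (2 * lam z) - N z * of_real (2 * Du z k) / (of_real (2 * lam z))\<^sup>2" for z k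
  have dw: "(w has_derivative T z) (at z)" if "z \<in> G" for z
  proof -
    have "((\<lambda>z. blinfun_apply (Du z) v) has_derivative (\<lambda>k. D2u z k v)) (at z)" for v
      using bounded_linear.has_derivative[OF blinfun.bounded_linear_left D2[OF that]] .
    then have dN: "(N has_derivative (\<lambda>k. Complex (D2u z k 1) (- (D2u z k \<i>)))) (at z)"
      unfolding N_def Complex_eq
      by (intro has_derivative_add has_derivative_of_real has_derivative_mult_right has_derivative_minus)
    have "((\<lambda>z. complex_of_real (2 * lam z)) has_derivative (\<lambda>k. of_real (2 * Du z k))) (at z)"
      using D1[OF that] by (auto intro!: derivative_eq_intros)
    from has_derivative_divide[OF dN this] pos[OF that]
    have "(w has_derivative (\<lambda>k. - N z * (inverse (of_real (2 * lam z)) * of_real (2 * Du z k) * inverse (of_real (2 * lam z))) +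
        Complex (D2u z k 1) (- (D2u z k \<i>)) / of_real (2 * lam z))) (at z)"
      unfolding w_def by simp
    then show ?thesis
      unfolding T_def by (rule has_derivative_eq_rhs) (use pos[OF that] in \<open>auto simp: field_simps power2_eq_square\<close>)
  qed
  define P where "P z = (T z 1 - \<i> * T z \<i>) / 2" for z
  define R where "R z = (T z 1 + \<i> * T z \<i>) / 2" for z
  have dw': "(w has_derivative (\<lambda>k. P z * k + R z * cnj k)) (at z)" if "z \<in> G" for z
  proof -
    have "T z = (\<lambda>k. P z * k + R z * cnj k)"
      unfolding P_def R_def using real_linear_wirtinger[OF has_derivative_linear[OF dw[OF that]]] by blast
    then show ?thesis using dw[OF that] by simp
  qed
  have R: "R z = of_real ((lam z)\<^sup>2 / 4)" if "z \<in> G" for z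
  proof -
    have ev: "\<forall>\<^sub>F x in nhds z. ((\<lambda>z. ln (lam z)) has_derivative (\<lambda>k. 2 * Re (w x * k))) (at x)"
      using eventually_nhds_in_open[OF G that] by eventually_elim (rule du)
    have "laplacian (\<lambda>z. ln (lam z)) z = (lam z)\<^sup>2"
      using curv that pos[OF that] unfolding curvature_def by (auto simp: field_simps)
    then have "4 * Re (R z) = (lam z)\<^sup>2" using laplacian_eq_wirtinger[OF ev dw'[OF that]] by simp
    moreover have "Im (R z) = 0" by (rule wirtinger_cross_derivative_real[OF ev dw'[OF that]])
    ultimately show ?thesis by (simp add: complex_eq_iff)
  qed
  have lc: "continuous_on G lam" "continuous_on G Du"
    using D1 D2 by (meson has_derivative_continuous continuous_at_imp_continuous_on)+
  have Tc: "continuous_on G (\<lambda>z. T z k)" for k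
    unfolding T_def N_def Complex_eq
    by (intro continuous_intros lc D2c blinfun.continuous_on) (use pos in \<open>auto simp: less_imp_neq[THEN not_sym]\<close>)
  have "continuous_on G P" unfolding P_def by (intro continuous_intros Tc) auto
  moreover have "(w has_derivative (\<lambda>k. P z * k + of_real ((lam z)\<^sup>2 / 4) * cnj k)) (at z)" if "z \<in> G" for z
    using dw'[OF that] unfolding R[OF that] .
  ultimately show ?thesis using du by (intro exI[of _ w] exI[of _ P]) simp
qed

lemma log_conformal_metric_has_laplacian:
  assumes "open G" "regular_conformal_metric G lam" "\<forall>z\<in>G. curvature lam z = -1" "z \<in> G"
  shows "has_laplacian (\<lambda>z. ln (lam z)) z ((lam z)\<^sup>2)"
proof -
  obtain w P where
    1: "\<forall>z\<in>G. ((\<lambda>z. ln (lam z)) has_derivative (\<lambda>k. 2 * Re (w z * k))) (at z)"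
    and 2: "\<forall>z\<in>G. (w has_derivative (\<lambda>k. P z * k + of_real ((lam z)\<^sup>2 / 4) * cnj k)) (at z)"
    using log_conformal_metric_wirtinger[OF assms(1,2,3)] by blast
  have "\<forall>\<^sub>F x in nhds z. ((\<lambda>z. ln (lam z)) has_derivative (\<lambda>k. 2 * Re (w x * k))) (at x)"
    using eventually_nhds_in_open[OF assms(1,4)] by eventually_elim (rule 1[rule_format])
  from this 2[rule_format, OF assms(4)] show ?thesis by (rule has_laplacianI)
qed

lemma regular_conformal_metric_continuous:
  assumes "regular_conformal_metric G lam"
  shows "continuous_on G lam"
  using assms unfolding regular_conformal_metric_def C2_on_def
  by (meson has_derivative_continuous continuous_at_imp_continuous_on)

section \<open>Holomorphy of the Schwarzian\<close>

text \<open>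
  A quantitative form of Goursat's argument. Repeated quadrisection leads to small triangles around
  one point on which the integral, divided by the square of the size, has not become smaller; there the holomorphic part
  of the linearisation of \<open>F\<close> integrates to zero and the antiholomorphic part is of size \<open>\<epsilon>\<close>.
\<close>
lemma contour_integral_small_antiholomorphic_derivative:
  fixes F :: "complex \<Rightarrow> complex"
  assumes der: "\<And>x. x \<in> convex hull {a,b,c} \<Longrightarrow>
      \<exists>P R. (F has_derivative (\<lambda>k. P * k + R * cnj k)) (at x) \<and> norm R \<le> \<epsilon>"
    and "\<epsilon> > 0" and K: "K > 0" "dist a b \<le> K" "dist b c \<le> K" "dist c a \<le> K"
  shows "norm (contour_integral (linepath a b) F + contour_integral (linepath b c) F
      + contour_integral (linepath c a) F) \<le> 5 * \<epsilon> * K\<^sup>2"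
proof (rule ccontr)
  let ?I = "\<lambda>x y. contour_integral (linepath x y) F"
  assume "\<not> ?thesis"
  then have big: "5 * \<epsilon> * K\<^sup>2 < norm (?I a b + ?I b c + ?I c a)" by simp
  have contF: "continuous_on (convex hull {a,b,c}) F"
    using der by (meson has_derivative_continuous continuous_at_imp_continuous_on)
  define e where "e = 5 * \<epsilon>"
  define tri where "tri T = (case T of (x, y, z) \<Rightarrow> convex hull {x, y, z})" for T :: "complex \<times> complex \<times> complex"
  define large where "large n T \<longleftrightarrow> (case T of (x, y, z) \<Rightarrow> dist x y \<le> K / 2 ^ n \<and> dist y z \<le> K / 2 ^ n \<and> dist z x \<le> K / 2 ^ n \<and>
      e * (K / 2 ^ n)\<^sup>2 \<le> norm (?I x y + ?I y z + ?I z x))" for n :: nat and T :: "complex \<times> complex \<times> complex"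
  have "\<exists>T. \<forall>n. (tri (T n) \<subseteq> tri (a, b, c) \<and> large n (T n)) \<and> tri (T (Suc n)) \<subseteq> tri (T n)"
  proof (rule dependent_nat_choice)
    have "large 0 (a, b, c)" using big K by (simp add: large_def e_def)
    then show "\<exists>T. tri T \<subseteq> tri (a, b, c) \<and> large 0 T" by blast
  next
    fix T :: "complex \<times> complex \<times> complex" and n :: nat
    assume T: "tri T \<subseteq> tri (a, b, c) \<and> large n T"
    obtain x y z where xyz: "T = (x, y, z)" by (cases T)
    have "continuous_on (convex hull {x, y, z}) F"
      using T continuous_on_subset[OF contF] by (simp add: tri_def xyz)
    from Cauchy_theorem_quadrisection[OF this, of "K / 2 ^ n" e] T
    obtain x' y' z' where "{x', y', z'} \<subseteq> convex hull {x, y, z}" and l: "large (Suc n) (x', y', z')"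
      by (auto simp: large_def xyz mult.commute)
    then have "tri (x', y', z') \<subseteq> tri T" unfolding tri_def xyz by (simp add: hull_minimal)
    with l T show "\<exists>T'. (tri T' \<subseteq> tri (a, b, c) \<and> large (Suc n) T') \<and> tri T' \<subseteq> tri T" by blast
  qed
  then obtain T where T: "\<And>n. tri (T n) \<subseteq> tri (a, b, c)" "\<And>n. large n (T n)" "\<And>n. tri (T (Suc n)) \<subseteq> tri (T n)"
    by blast
  obtain x where x: "\<And>n. x \<in> tri (T n)"
  proof (rule bounded_closed_nest)
    have "compact (tri (T n))" for n by (cases "T n") (simp add: tri_def finite_imp_compact_convex_hull)
    then show "closed (tri (T n))" and "bounded (tri (T 0))" for n by (auto intro: compact_imp_closed compact_imp_bounded)
    show "tri (T n) \<noteq> {}" for n by (cases "T n") (simp add: tri_def)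
    show "tri (T n) \<subseteq> tri (T m)" if "m \<le> n" for m n
      using that by (rule lift_Suc_antimono_le[of "\<lambda>n. tri (T n)", OF T(3)])
  qed (rule that)
  have "x \<in> convex hull {a,b,c}" using x[of 0] T(1)[of 0] by (auto simp: tri_def)
  then obtain P R where PR: "(F has_derivative (\<lambda>k. P * k + R * cnj k)) (at x)" "norm R \<le> \<epsilon>"
    using der by blast
  obtain d where "d > 0" and d: "\<And>y. norm (y - x) < d \<Longrightarrow>
      norm (F y - F x - (P * (y - x) + R * cnj (y - x))) \<le> \<epsilon> / 2 * norm (y - x)"
    using PR(1) \<open>\<epsilon> > 0\<close> unfolding has_derivative_at_alt by (meson half_gt_zero)
  obtain n where "K / d < 2 ^ n" using real_arch_pow[of 2 "K / d"] by auto
  define k where "k = K / 2 ^ n"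
  have k: "k > 0" "k < d" using K \<open>K / d < 2 ^ n\<close> \<open>d > 0\<close> by (auto simp: k_def field_simps)
  obtain fa fb fc where Tn: "T n = (fa, fb, fc)" by (cases "T n")
  have dist: "dist fa fb \<le> k" "dist fb fc \<le> k" "dist fc fa \<le> k"
    and no: "e * k\<^sup>2 \<le> norm (?I fa fb + ?I fb fc + ?I fc fa)"
    using T(2)[of n] by (auto simp: large_def Tn k_def)
  define \<Delta> where "\<Delta> = convex hull {fa, fb, fc}"
  have \<Delta>: "x \<in> \<Delta>" "\<Delta> \<subseteq> convex hull {a, b, c}" using x[of n] T(1)[of n] by (auto simp: \<Delta>_def tri_def Tn)
  have near: "norm (y - x) \<le> k" if "y \<in> \<Delta>" for y
    using triangle_points_closer[of y fa fb fc x] \<Delta>(1) that dist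
    unfolding \<Delta>_def dist_norm by linarith
  define H where "H y = F y - (P * y + (F x - P * x))" for y
  have Hb: "norm (H y) \<le> 3 / 2 * \<epsilon> * k" if "y \<in> \<Delta>" for y
  proof -
    have "H y = (F y - F x - (P * (y - x) + R * cnj (y - x))) + R * cnj (y - x)"
      by (simp add: H_def algebra_simps)
    then have "norm (H y) \<le> norm (F y - F x - (P * (y - x) + R * cnj (y - x))) + norm (R * cnj (y - x))"
      by (metis norm_triangle_ineq)
    also have "\<dots> \<le> \<epsilon> / 2 * norm (y - x) + \<epsilon> * norm (y - x)"
      using d[of y] near[OF that] k PR(2) 
      by (intro add_mono) (auto simp: norm_mult simp del: complex_cnj_diff intro!: mult_right_mono)
    also have "\<dots> = 3 / 2 * \<epsilon> * norm (y - x)" by simp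
    also have "\<dots> \<le> 3 / 2 * \<epsilon> * k" using near[OF that] \<open>\<epsilon> > 0\<close> by (intro mult_left_mono) auto
    finally show ?thesis .
  qed
  have FT: "continuous_on \<Delta> F" using contF \<Delta>(2) by (rule continuous_on_subset)
  have HT: "continuous_on \<Delta> H" unfolding H_def by (intro continuous_intros FT)
  have LT: "continuous_on \<Delta> (\<lambda>y. P * y + (F x - P * x))" by (intro continuous_intros)
  have seg: "closed_segment (fa) (fb) \<subseteq> \<Delta>" "closed_segment (fb) (fc) \<subseteq> \<Delta>" "closed_segment (fc) (fa) \<subseteq> \<Delta>"
    unfolding \<Delta>_def by (rule segments_subset_convex_hull)+
  have split: "?I p q = contour_integral (linepath p q) H + contour_integral (linepath p q) (\<lambda>y. P * y + (F x - P * x))"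
    and bound: "norm (contour_integral (linepath p q) H) \<le> 3 / 2 * \<epsilon> * k * norm (q - p)"
    if "closed_segment p q \<subseteq> \<Delta>" for p q
  proof -
    have i1: "H contour_integrable_on (linepath p q)" 
      using contour_integrable_continuous_linepath continuous_on_subset[OF HT that] by blast
    have i2: "(\<lambda>y. P * y + (F x - P * x)) contour_integrable_on (linepath p q)" 
      using contour_integrable_continuous_linepath continuous_on_subset[OF LT that] by blast
    show "?I p q = contour_integral (linepath p q) H + contour_integral (linepath p q) (\<lambda>y. P * y + (F x - P * x))"
      using contour_integral_add[OF i1 i2] by (simp add: H_def)
    show "norm (contour_integral (linepath p q) H) \<le> 3 / 2 * \<epsilon> * k * norm (q - p)"
      using has_contour_integral_bound_linepath[OF has_contour_integral_integral[OF i1], of "3 / 2 * \<epsilon> * k"]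
        Hb that \<open>\<epsilon> > 0\<close> k by force
  qed
  have lin0: "contour_integral (linepath (fa) (fb)) (\<lambda>y. P * y + (F x - P * x)) +
     contour_integral (linepath (fb) (fc)) (\<lambda>y. P * y + (F x - P * x)) +
     contour_integral (linepath (fc) (fa)) (\<lambda>y. P * y + (F x - P * x)) = 0"
    using has_chain_integral_chain_integral3[OF triangle_linear_has_chain_integral[of P "F x - P * x" fa fb fc]]
    by simp
  have "e * k\<^sup>2 \<le> norm (?I (fa) (fb) + ?I (fb) (fc) + ?I (fc) (fa))"
    by (rule no)
  also have "?I (fa) (fb) + ?I (fb) (fc) + ?I (fc) (fa) =
     contour_integral (linepath (fa) (fb)) H + contour_integral (linepath (fb) (fc)) H
     + contour_integral (linepath (fc) (fa)) H"
    using lin0 unfolding split[OF seg(1)] split[OF seg(2)] split[OF seg(3)] by algebra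
  also have "norm \<dots> \<le> 3 / 2 * \<epsilon> * k * norm (fb - fa) + 3 / 2 * \<epsilon> * k * norm (fc - fb)
     + 3 / 2 * \<epsilon> * k * norm (fa - fc)"
    by (intro norm_triangle_le add_mono bound seg)
  also have "\<dots> \<le> 3 / 2 * \<epsilon> * k * k + 3 / 2 * \<epsilon> * k * k + 3 / 2 * \<epsilon> * k * k"
    using dist k \<open>\<epsilon> > 0\<close> unfolding dist_norm
    by (intro add_mono mult_left_mono) (auto simp: norm_minus_commute)
  also have "\<dots> = 9 / 2 * \<epsilon> * k\<^sup>2" by (simp add: power2_eq_square)
  finally have "5 * \<epsilon> * k\<^sup>2 \<le> 9 / 2 * \<epsilon> * k\<^sup>2" by (simp add: e_def)
  then show False using k \<open>\<epsilon> > 0\<close> by simp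
qed

text \<open>
  The derivative of \<open>f\<close> in the real direction is \<open>A + B\<close>.
\<close>
lemma difference_quotient_uniform:
  fixes f :: "complex \<Rightarrow> complex"
  assumes "open S" "compact T" "T \<subseteq> S"
    and der: "\<And>z. z \<in> S \<Longrightarrow> (f has_derivative (\<lambda>k. A z * k + B z * cnj k)) (at z)"
    and cont: "continuous_on S A" "continuous_on S B" and "\<eta> > 0"
  shows "\<exists>h0>0. \<forall>h. 0 < h \<and> h < h0 \<longrightarrow> (\<forall>z\<in>T. z + of_real h \<in> S \<and>
     norm ((f (z + of_real h) - f z) / of_real h - (A z + B z)) \<le> \<eta>)"
proof -
  obtain \<rho> where "\<rho> > 0" and \<rho>: "{x + y |x y. x \<in> T \<and> y \<in> cball 0 \<rho>} \<subseteq> S"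
  proof -
    obtain e where "e > 0" "(\<Union>x\<in>T. cball x e) \<subseteq> S"
      using compact_subset_open_imp_cball_epsilon_subset[OF assms(2,1,3)] by blast
    moreover have "x + y \<in> cball x e" if "y \<in> cball 0 e" for x y :: complex using that by (simp add: dist_norm)
    ultimately show thesis using that[of e] by blast
  qed
  define T' where "T' = {x + y |x y. x \<in> T \<and> y \<in> cball 0 \<rho>}"
  have "compact T'" unfolding T'_def by (intro compact_sums assms compact_cball)
  moreover have "continuous_on T' (\<lambda>z. A z + B z)"
    using cont \<rho> unfolding T'_def[symmetric] by (auto intro!: continuous_intros elim: continuous_on_subset)
  ultimately have "uniformly_continuous_on T' (\<lambda>z. A z + B z)"
    by (intro compact_uniformly_continuous)
  then obtain d where "d > 0" and d: "\<And>x x'. \<lbrakk>x \<in> T'; x' \<in> T'; dist x' x < d\<rbrakk> \<Longrightarrow> dist (A x' + B x') (A x + B x) < \<eta>"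
    unfolding uniformly_continuous_on_def using \<open>\<eta> > 0\<close> by meson
  have "z + of_real h \<in> S \<and> norm ((f (z + of_real h) - f z) / of_real h - (A z + B z)) \<le> \<eta>"
    if h: "0 < h" "h < min \<rho> d" and z: "z \<in> T" for h z
  proof
    have T': "z + of_real t \<in> T'" if "t \<in> {0..h}" for t
      unfolding T'_def using z that h by force
    then have "z + of_real h \<in> T'" using h by simp
    then show "z + of_real h \<in> S" using \<rho> unfolding T'_def by blast
    define g where "g t = f (z + of_real t) - of_real t * (A z + B z)" for t :: real
    have "norm (g h - g 0) \<le> \<eta> * norm (h - 0)"
    proof (rule differentiable_bound[where S = "{0..h}" and
          f' = "\<lambda>t k. of_real k * (A (z + of_real t) + B (z + of_real t) - (A z + B z))"])
      fix t assume t: "t \<in> {0..h}"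
      have lin: "((\<lambda>t::real. z + of_real t) has_derivative (\<lambda>k. of_real k)) (at t)"
        by (auto intro!: derivative_eq_intros)
      have "z + of_real t \<in> S" using T'[OF t] \<rho> unfolding T'_def by blast
      from has_derivative_compose[OF lin der[OF this]]
      have "((\<lambda>t. f (z + of_real t)) has_derivative (\<lambda>k. A (z + of_real t) * of_real k + B (z + of_real t) * cnj (of_real k))) (at t)" .
      then have "(g has_derivative (\<lambda>k. A (z + of_real t) * of_real k + B (z + of_real t) * cnj (of_real k) - of_real k * (A z + B z))) (at t)"
        unfolding g_def by (auto intro!: derivative_eq_intros)
      then show "(g has_derivative (\<lambda>k. of_real k * (A (z + of_real t) + B (z + of_real t) - (A z + B z)))) (at t within {0..h})"
        by (rule has_derivative_at_withinI[OF has_derivative_eq_rhs]) (auto simp: algebra_simps)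
      have "z \<in> T'" using T'[of 0] h by simp
      then have "norm (A (z + of_real t) + B (z + of_real t) - (A z + B z)) \<le> \<eta>"
        using d[OF _ T'[OF t], of z] t h by (simp add: dist_norm)
      then show "onorm (\<lambda>k. complex_of_real k * (A (z + of_real t) + B (z + of_real t) - (A z + B z))) \<le> \<eta>"
        using \<open>\<eta> > 0\<close> by (intro onorm_bound) (auto simp: norm_mult mult.commute[of \<eta>] intro!: mult_left_mono)
    qed (use h in auto)
    then have "norm (f (z + of_real h) - f z - of_real h * (A z + B z)) \<le> \<eta> * h"
      using h by (simp add: g_def algebra_simps)
    moreover have "f (z + of_real h) - f z - of_real h * (A z + B z)
       = of_real h * ((f (z + of_real h) - f z) / of_real h - (A z + B z))"
      using h by (simp add: field_simps)
    ultimately have "h * norm ((f (z + of_real h) - f z) / of_real h - (A z + B z)) \<le> h * \<eta>"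
      using h by (simp add: norm_mult mult.commute)
    then show "norm ((f (z + of_real h) - f z) / of_real h - (A z + B z)) \<le> \<eta>" using h by simp
  qed
  then show ?thesis using \<open>\<rho> > 0\<close> \<open>d > 0\<close> by (intro exI[of _ "min \<rho> d"]) auto
qed

text \<open>
  If \<open>w\<close> could be differentiated twice, the derivative of \<open>P - w\<^sup>2\<close> with respect to the conjugate variable
  would be the holomorphic derivative of \<open>E\<close> minus \<open>2 * w * E\<close>, which vanishes by hypothesis. To make this work
  for once differentiable \<open>w\<close>, note that the derivative of \<open>w\<close> in the real direction is \<open>P + E\<close>, and replace
  \<open>P\<close> by a real difference quotient of \<open>w\<close> minus \<open>E\<close>. The resulting functions converge uniformly to
  \<open>P - w\<^sup>2\<close> and their conjugate derivatives converge uniformly to zero.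
\<close>
lemma schwarzian_analytic:
  fixes w :: "complex \<Rightarrow> complex"
  assumes "open S"
    and w: "\<And>z. z \<in> S \<Longrightarrow> (w has_derivative (\<lambda>k. P z * k + E z * cnj k)) (at z)"
    and E: "\<And>z. z \<in> S \<Longrightarrow> (E has_derivative (\<lambda>k. 2 * w z * E z * k + E' z * cnj k)) (at z)"
    and cont: "continuous_on S P" "continuous_on S E'"
  shows "(\<lambda>z. P z - (w z)\<^sup>2) analytic_on S"
proof (rule Morera_triangle)
  have wc: "continuous_on S w" "continuous_on S E"
    using w E by (meson has_derivative_continuous continuous_at_imp_continuous_on)+
  show Qc: "continuous_on S (\<lambda>z. P z - (w z)\<^sup>2)" by (intro continuous_intros cont wc)
  show "open S" by fact
  fix a b c
  let ?Q = "\<lambda>z. P z - (w z)\<^sup>2"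
  let ?C = "\<lambda>f. contour_integral (linepath a b) f + contour_integral (linepath b c) f + contour_integral (linepath c a) f"
  show "convex hull {a, b, c} \<subseteq> S \<longrightarrow> ?C ?Q = 0"
  proof
    assume TS: "convex hull {a, b, c} \<subseteq> S"
    let ?T = "convex hull {a, b, c}"
    have "compact ?T" by (simp add: finite_imp_compact_convex_hull)
    define K where "K = 1 + dist a b + dist b c + dist c a"
    have K: "K > 0" "dist a b \<le> K" "dist b c \<le> K" "dist c a \<le> K"
      unfolding K_def by (smt (verit) zero_le_dist)+
    have "norm (?C ?Q) \<le> \<eta> * (5 * K\<^sup>2 + 3 * K)" if "\<eta> > 0" for \<eta>
    proof -
      obtain h1 where "h1 > 0" and h1: "\<And>h z. \<lbrakk>0 < h; h < h1; z \<in> ?T\<rbrakk> \<Longrightarrow> z + of_real h \<in> S \<and>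
         norm ((w (z + of_real h) - w z) / of_real h - (P z + E z)) \<le> \<eta>"
        using difference_quotient_uniform[OF \<open>open S\<close> \<open>compact ?T\<close> TS w cont(1) wc(2) \<open>\<eta> > 0\<close>] by blast
      have "continuous_on S (\<lambda>z. 2 * w z * E z)" by (intro continuous_intros wc)
      then obtain h2 where "h2 > 0" and h2: "\<And>h z. \<lbrakk>0 < h; h < h2; z \<in> ?T\<rbrakk> \<Longrightarrow> z + of_real h \<in> S \<and>
         norm ((E (z + of_real h) - E z) / of_real h - (2 * w z * E z + E' z)) \<le> \<eta>"
        using difference_quotient_uniform[OF \<open>open S\<close> \<open>compact ?T\<close> TS E _ cont(2) \<open>\<eta> > 0\<close>] by blast
      define h where "h = min h1 h2 / 2"
      have h: "0 < h" "h < h1" "h < h2" using \<open>h1 > 0\<close> \<open>h2 > 0\<close> by (auto simp: h_def)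
      define F where "F z = (w (z + of_real h) - w z) / of_real h - E z - (w z)\<^sup>2" for z
      have Fder: "(F has_derivative (\<lambda>k. ((P (z + of_real h) - P z) / of_real h - 2 * w z * E z - 2 * w z * P z) * k
           + ((E (z + of_real h) - E z) / of_real h - E' z - 2 * w z * E z) * cnj k)) (at z)" if "z \<in> ?T" for z
      proof -
        have zS: "z + of_real h \<in> S" "z \<in> S" using h1[OF h(1,2) that] that TS by auto
        have wh: "((\<lambda>z. w (z + of_real h)) has_derivative (\<lambda>k. P (z + of_real h) * k + E (z + of_real h) * cnj k)) (at z)"
          using has_derivative_compose[OF has_derivative_add[OF has_derivative_ident has_derivative_const],
              of w "\<lambda>k. P (z + of_real h) * k + E (z + of_real h) * cnj k" z "of_real h" UNIV] w[OF zS(1)] by simp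
        have sq: "((\<lambda>z. (w z)\<^sup>2) has_derivative (\<lambda>k. 2 * w z * (P z * k + E z * cnj k))) (at z)"
          using has_derivative_power[OF w[OF zS(2)], of 2] by (rule has_derivative_eq_rhs) (auto simp: mult.assoc)
        have "(F has_derivative (\<lambda>k. ((P (z + of_real h) * k + E (z + of_real h) * cnj k) - (P z * k + E z * cnj k)) / of_real h
           - (2 * w z * E z * k + E' z * cnj k) - 2 * w z * (P z * k + E z * cnj k))) (at z)"
          unfolding F_def
          by (intro has_derivative_diff bounded_linear.has_derivative[OF bounded_linear_divide] wh w[OF zS(2)] E[OF zS(2)] sq)
        then show ?thesis by (rule has_derivative_eq_rhs) (auto simp: fun_eq_iff algebra_simps add_divide_distrib diff_divide_distrib)
      qed
      have 1: "norm (?C F) \<le> 5 * \<eta> * K\<^sup>2"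
      proof (rule contour_integral_small_antiholomorphic_derivative[OF _ \<open>\<eta> > 0\<close> K])
        fix z assume z: "z \<in> ?T"
        have "norm ((E (z + of_real h) - E z) / of_real h - E' z - 2 * w z * E z) \<le> \<eta>"
          using h2[OF h(1,3) z] by (simp add: algebra_simps)
        then show "\<exists>P R. (F has_derivative (\<lambda>k. P * k + R * cnj k)) (at z) \<and> norm R \<le> \<eta>"
          using Fder[OF z] by blast
      qed
      have Fc: "continuous_on ?T F"
        using Fder by (meson has_derivative_continuous continuous_at_imp_continuous_on)
      have seg: "norm (contour_integral (linepath p q) ?Q - contour_integral (linepath p q) F) \<le> \<eta> * norm (q - p)"
        if "closed_segment p q \<subseteq> ?T" for p q
      proof -
        have i1: "?Q contour_integrable_on (linepath p q)" 
          using contour_integrable_continuous_linepath continuous_on_subset[OF Qc] that TS by blast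
        have i2: "F contour_integrable_on (linepath p q)" 
          using contour_integrable_continuous_linepath continuous_on_subset[OF Fc that] by blast
        have "((\<lambda>z. ?Q z - F z) has_contour_integral (contour_integral (linepath p q) ?Q - contour_integral (linepath p q) F)) (linepath p q)"
          by (intro has_contour_integral_diff has_contour_integral_integral i1 i2)
        then show ?thesis
        proof (rule has_contour_integral_bound_linepath)
          fix z assume "z \<in> closed_segment p q"
          then have "z \<in> ?T" using that by blast
          from h1[OF h(1,2) this] show "norm (?Q z - F z) \<le> \<eta>"
            by (simp add: F_def norm_minus_commute algebra_simps)
        qed (use \<open>\<eta> > 0\<close> in auto)
      qed
      have "norm (?C ?Q - ?C F) \<le> \<eta> * norm (b - a) + \<eta> * norm (c - b) + \<eta> * norm (a - c)"
      proof -
        have "?C ?Q - ?C F = (contour_integral (linepath a b) ?Q - contour_integral (linepath a b) F)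
          + (contour_integral (linepath b c) ?Q - contour_integral (linepath b c) F)
          + (contour_integral (linepath c a) ?Q - contour_integral (linepath c a) F)" by simp
        then show ?thesis
          by (simp only:) (intro norm_triangle_le add_mono seg segments_subset_convex_hull)
      qed
      also have "\<dots> \<le> \<eta> * K + \<eta> * K + \<eta> * K"
        using K \<open>\<eta> > 0\<close> unfolding dist_norm by (intro add_mono mult_left_mono) (auto simp: norm_minus_commute)
      finally have "norm (?C ?Q) \<le> 5 * \<eta> * K\<^sup>2 + (\<eta> * K + \<eta> * K + \<eta> * K)"
        using norm_triangle_sub[of "?C ?Q" "?C F"] 1 by linarith
      then show ?thesis by (simp add: algebra_simps)
    qed
    note bound = this
    have K': "5 * K\<^sup>2 + 3 * K > 0" using K by (simp add: add_nonneg_pos)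
    have "norm (?C ?Q) \<le> e" if "e > 0" for e
      using bound[of "e / (5 * K\<^sup>2 + 3 * K)"] that K' by simp
    then have "norm (?C ?Q) \<le> 0" by (rule field_le_epsilon[of _ 0, simplified])
    then show "?C ?Q = 0" by simp
  qed
qed

section \<open>Liouville's theorem\<close>

lemma holomorphic_primitive_ball:
  assumes "f holomorphic_on ball z0 r" and "r > 0"
    and b: "\<And>z. z \<in> ball z0 r \<Longrightarrow> norm (f z) \<le> M"
  shows "\<exists>g. g z0 = 0 \<and> (\<forall>z\<in>ball z0 r. (g has_field_derivative f z) (at z) \<and> norm (g z) \<le> M * r)"
proof -
  obtain g where g: "\<And>x. x \<in> ball z0 r \<Longrightarrow> (g has_field_derivative f x) (at x within ball z0 r)"
    using holomorphic_convex_primitive'[OF convex_ball open_ball assms(1)] by blast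
  have g': "(g has_field_derivative f x) (at x)" if "x \<in> ball z0 r" for x
    using g[OF that] that by (simp add: at_within_open[OF that open_ball])
  have M: "M \<ge> 0" using b[of z0] \<open>r > 0\<close> norm_ge_zero order_trans centre_in_ball by blast
  have "norm (g z - g z0) \<le> M * r" if "z \<in> ball z0 r" for z
  proof -
    have "norm (g z - g z0) \<le> M * norm (z - z0)"
      using \<open>r > 0\<close> that by (intro field_differentiable_bound[OF convex_ball g b]) auto
    also have "\<dots> \<le> M * r" using that M by (intro mult_left_mono) (auto simp: dist_norm norm_minus_commute)
    finally show ?thesis .
  qed
  then show ?thesis
    by (intro exI[of _ "\<lambda>z. g z - g z0"]) (auto intro!: derivative_eq_intros g')
qed

text \<open>
  Picard iteration for \<open>y'' + Q y = 0\<close>: the solution is a series in which each term arises from the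
  preceding one by multiplication with \<open>- Q\<close> and two integrations. By the bound on \<open>M * r\<close> the terms
  decrease at least like a geometric series with ratio \<open>1 / 2\<close>.
\<close>
lemma linear_ode_solution:
  assumes Q: "Q holomorphic_on ball z0 r" and r: "0 < r" "r \<le> 1"
    and M: "\<And>z. z \<in> ball z0 r \<Longrightarrow> norm (Q z) \<le> M" "M * r \<le> 1 / 2"
  shows "\<exists>y y'. y z0 = \<alpha> \<and> y' z0 = \<beta> \<and>
    (\<forall>z\<in>ball z0 r. (y has_field_derivative y' z) (at z) \<and> (y' has_field_derivative - Q z * y z) (at z))"
proof -
  let ?B = "ball z0 r"
  define C where "C = norm \<alpha> + norm \<beta>"
  have C: "C \<ge> 0" by (simp add: C_def)
  \<comment> \<open>The pairs consist of the \<open>n\<close>-th term of the series and its derivative.\<close>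
  define ok where "ok n p \<longleftrightarrow> (\<forall>z\<in>?B. (fst p has_field_derivative snd p z) (at z) \<and>
      norm (fst p z) \<le> C / 2 ^ n \<and> norm (snd p z) \<le> C / 2 ^ n) \<and> (n > 0 \<longrightarrow> fst p z0 = 0 \<and> snd p z0 = 0)
      \<and> (n = 0 \<longrightarrow> p = (\<lambda>z. \<alpha> + \<beta> * (z - z0), \<lambda>_. \<beta>))"
    for n :: nat and p :: "(complex \<Rightarrow> complex) \<times> (complex \<Rightarrow> complex)"
  define next_to where "next_to n p q \<longleftrightarrow> (\<forall>z\<in>?B. (snd q has_field_derivative - Q z * fst p z) (at z))"
    for n :: nat and p q :: "(complex \<Rightarrow> complex) \<times> (complex \<Rightarrow> complex)"
  have "\<exists>f. \<forall>n. ok n (f n) \<and> next_to n (f n) (f (Suc n))"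
  proof (rule dependent_nat_choice)
    have "norm (\<alpha> + \<beta> * (z - z0)) \<le> C" if "z \<in> ?B" for z
    proof -
      have "norm (z - z0) \<le> 1" using that r by (auto simp: dist_norm norm_minus_commute)
      then have "norm (\<beta> * (z - z0)) \<le> norm \<beta>" by (simp add: norm_mult mult_left_le)
      then show ?thesis unfolding C_def by (meson norm_triangle_mono order_refl)
    qed
    then have "ok 0 (\<lambda>z. \<alpha> + \<beta> * (z - z0), \<lambda>_. \<beta>)"
      unfolding ok_def by (auto intro!: derivative_eq_intros simp: C_def)
    then show "\<exists>p. ok 0 p" by blast
  next
    fix p n assume p: "ok n p"
    have hp: "fst p holomorphic_on ?B"
      using p unfolding ok_def by (meson holomorphic_on_open open_ball)
    have "(\<lambda>z. - Q z * fst p z) holomorphic_on ?B" by (intro holomorphic_intros Q hp)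
    moreover have "norm (- Q z * fst p z) \<le> M * (C / 2 ^ n)" if "z \<in> ?B" for z
    proof -
      have "norm (fst p z) \<le> C / 2 ^ n" using p that unfolding ok_def by blast
      then show ?thesis unfolding norm_mult norm_minus_cancel
        using M(1)[OF that] by (intro mult_mono) (auto intro: order_trans[OF norm_ge_zero])
    qed
    ultimately obtain d where d: "d z0 = 0" 
      "\<forall>z\<in>?B. (d has_field_derivative - Q z * fst p z) (at z) \<and> norm (d z) \<le> M * (C / 2 ^ n) * r"
      using holomorphic_primitive_ball[OF _ r(1)] by blast
    have db: "norm (d z) \<le> C / 2 ^ Suc n" if "z \<in> ?B" for z
    proof -
      have "norm (d z) \<le> (M * r) * (C / 2 ^ n)" using d(2) that by (auto simp: mult_ac)
      also have "\<dots> \<le> 1 / 2 * (C / 2 ^ n)" using M(2) C by (intro mult_right_mono) auto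
      finally show ?thesis by simp
    qed
    have hd: "d holomorphic_on ?B" using d(2) by (meson holomorphic_on_open open_ball)
    obtain s where s: "s z0 = 0"
      "\<forall>z\<in>?B. (s has_field_derivative d z) (at z) \<and> norm (s z) \<le> C / 2 ^ Suc n * r"
      using holomorphic_primitive_ball[OF hd r(1) db] by blast
    have "norm (s z) \<le> C / 2 ^ Suc n" if "z \<in> ?B" for z
    proof -
      have "norm (s z) \<le> C / 2 ^ Suc n * r" using s(2) that by blast
      also have "\<dots> \<le> C / 2 ^ Suc n" using r C by (intro mult_left_le) auto
      finally show ?thesis .
    qed
    with s d db have "ok (Suc n) (s, d) \<and> next_to n p (s, d)" unfolding ok_def next_to_def by auto
    then show "\<exists>q. ok (Suc n) q \<and> next_to n p q" by blast
  qed
  then obtain f where f: "\<And>n. ok n (f n)" "\<And>n. next_to n (f n) (f (Suc n))" by blast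
  have bound: "norm (fst (f n) z) \<le> C * (1 / 2) ^ n" "norm (snd (f n) z) \<le> C * (1 / 2) ^ n"
    and der: "(fst (f n) has_field_derivative snd (f n) z) (at z)" if "z \<in> ?B" for n z
    using f(1)[of n] that unfolding ok_def by (auto simp: power_divide)
  have der2: "(snd (f (Suc n)) has_field_derivative - Q z * fst (f n) z) (at z)" if "z \<in> ?B" for n z
    using f(2)[of n] that unfolding next_to_def by auto
  have f0: "f 0 = (\<lambda>z. \<alpha> + \<beta> * (z - z0), \<lambda>_. \<beta>)" using f(1)[of 0] unfolding ok_def by simp
  have at0: "fst (f (Suc n)) z0 = 0" "snd (f (Suc n)) z0 = 0" for n
    using f(1)[of "Suc n"] unfolding ok_def by auto
  have sC: "summable (\<lambda>n. C * (1 / 2) ^ n)" by (intro summable_mult summable_geometric) simp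
  obtain y y' where y: "\<forall>z\<in>?B. (\<lambda>n. fst (f n) z) sums y z \<and> (\<lambda>n. snd (f n) z) sums y' z \<and>
      (y has_field_derivative y' z) (at z)"
    by (rule series_and_derivative_comparison[OF open_ball sC, where f = "\<lambda>n. fst (f n)" and f' = "\<lambda>n. snd (f n)"])
      (use bound der in auto)
  define d2 where "d2 n z = (case n of 0 \<Rightarrow> 0 | Suc m \<Rightarrow> - Q z * fst (f m) z)" for n z
  have d2: "(snd (f n) has_field_derivative d2 n z) (at z)" if "z \<in> ?B" for n z
    using der2[OF that] f0 by (cases n) (auto simp: d2_def)
  obtain k k' where k: "\<forall>z\<in>?B. (\<lambda>n. snd (f n) z) sums k z \<and> (\<lambda>n. d2 n z) sums k' z \<and>
      (k has_field_derivative k' z) (at z)"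
    by (rule series_and_derivative_comparison[OF open_ball sC, where f = "\<lambda>n. snd (f n)" and f' = d2])
      (use bound d2 in auto)
  have ky: "k z = y' z" if "z \<in> ?B" for z using k y that sums_unique2 by blast
  have k': "k' z = - Q z * y z" if "z \<in> ?B" for z
  proof -
    have "(\<lambda>n. - Q z * fst (f n) z) sums (- Q z * y z)" using y that by (intro sums_mult) auto
    then have "(\<lambda>n. d2 (Suc n) z) sums (- Q z * y z)" by (simp add: d2_def)
    then have "(\<lambda>n. d2 n z) sums (- Q z * y z + d2 0 z)" by (subst (asm) sums_Suc_iff) simp
    then have "(\<lambda>n. d2 n z) sums (- Q z * y z)" by (simp add: d2_def)
    then show ?thesis using k that sums_unique2 by blast
  qed
  have "(y' has_field_derivative - Q z * y z) (at z)" if "z \<in> ?B" for z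
  proof (rule has_field_derivative_transform_within_open[OF _ open_ball that ky])
    show "(k has_field_derivative - Q z * y z) (at z)" using k that unfolding k'[OF that, symmetric] by blast
  qed
  moreover have "y z0 = \<alpha>"
  proof -
    have "(\<lambda>n. fst (f n) z0) sums \<alpha>"
      using sums_finite[of "{0}" "\<lambda>n. fst (f n) z0"] at0 f0 by (auto simp: gr0_conv_Suc)
    then show ?thesis using y r sums_unique2 by (metis centre_in_ball)
  qed
  moreover have "y' z0 = \<beta>"
  proof -
    have "(\<lambda>n. snd (f n) z0) sums \<beta>"
      using sums_finite[of "{0}" "\<lambda>n. snd (f n) z0"] at0 f0 by (auto simp: gr0_conv_Suc)
    then show ?thesis using y r sums_unique2 by (metis centre_in_ball)
  qed
  ultimately show ?thesis using y by blast
qed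

lemma wirtinger_derivatives_unique:
  assumes "(F has_derivative (\<lambda>k. a * k + b * cnj k)) (at z)" "(F has_derivative (\<lambda>k. a' * k + b' * cnj k)) (at z)"
  shows "a = a'" "b = b'"
proof -
  have eq: "(\<lambda>k. a * k + b * cnj k) = (\<lambda>k. a' * k + b' * cnj k)"
    using has_derivative_unique assms by blast
  have "a + b = a' + b'" "a - b = a' - b'"
    using fun_cong[OF eq, of 1] fun_cong[OF eq, of \<i>] by (auto simp: complex_eq_iff)
  then show "a = a'" "b = b'" by (auto simp: complex_eq_iff)
qed

text \<open>
  Here \<open>D\<close> is a real solution of \<open>D\<^sub>z\<^sub>z + Q D = 0\<close>. Variation of constants gives
  \<open>D = y2 * cnj \<alpha>1 - y1 * cnj \<alpha>2\<close> with \<open>\<alpha>1\<close> and \<open>\<alpha>2\<close> holomorphic. As \<open>D\<close> is real, the conjugate of this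
  expression satisfies the equation as well, and since \<open>y1\<close> and \<open>y2\<close> are independent, this forces
  \<open>\<alpha>1\<close> and \<open>\<alpha>2\<close> to solve \<open>\<alpha>'' + Q \<alpha> = 0\<close>. The three initial conditions say that their
  initial data vanish.
\<close>
lemma real_solution_unique:
  fixes D :: "complex \<Rightarrow> real"
  assumes r: "r > 0" and Q: "Q holomorphic_on ball z0 r"
    and y1: "\<And>z. z \<in> ball z0 r \<Longrightarrow> (y1 has_field_derivative y1' z) (at z)"
            "\<And>z. z \<in> ball z0 r \<Longrightarrow> (y1' has_field_derivative - Q z * y1 z) (at z)"
    and y2: "\<And>z. z \<in> ball z0 r \<Longrightarrow> (y2 has_field_derivative y2' z) (at z)"
            "\<And>z. z \<in> ball z0 r \<Longrightarrow> (y2' has_field_derivative - Q z * y2 z) (at z)"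
    and W: "\<And>z. z \<in> ball z0 r \<Longrightarrow> y1' z * y2 z - y1 z * y2' z = 1"
    and D: "\<And>z. z \<in> ball z0 r \<Longrightarrow> (D has_derivative (\<lambda>k. 2 * Re (\<delta> z * k))) (at z)"
    and \<delta>: "\<And>z. z \<in> ball z0 r \<Longrightarrow> (\<delta> has_derivative (\<lambda>k. - Q z * of_real (D z) * k + m z * cnj k)) (at z)"
    and 0: "D z0 = 0" "\<delta> z0 = 0" "m z0 = 0" and z: "z \<in> ball z0 r"
  shows "D z = 0"
proof -
  let ?B = "ball z0 r"
  have z0: "z0 \<in> ?B" using r by simp
  have Dc: "((\<lambda>z. complex_of_real (D z)) has_derivative (\<lambda>k. \<delta> z * k + cnj (\<delta> z) * cnj k)) (at z)" if "z \<in> ?B" for z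
  proof -
    have "((\<lambda>z. complex_of_real (D z)) has_derivative (\<lambda>k. of_real (2 * Re (\<delta> z * k)))) (at z)"
      by (intro has_derivative_of_real D that)
    then show ?thesis by (rule has_derivative_eq_rhs) (auto simp: complex_eq_iff)
  qed
  have main: "(\<alpha> has_field_derivative (\<delta> z * cnj (y' z) - cnj (m z) * cnj (y z))) (at z)"
    if y: "\<And>z. z \<in> ?B \<Longrightarrow> (y has_field_derivative y' z) (at z)"
      "\<And>z. z \<in> ball z0 r \<Longrightarrow> (y' has_field_derivative - Q z * y z) (at z)"
      and \<alpha>: "\<alpha> = (\<lambda>z. cnj (of_real (D z) * y' z - \<delta> z * y z))" and z: "z \<in> ?B" for y y' \<alpha> z
  proof -
    have yd: "(y has_derivative (\<lambda>k. y' z * k)) (at z)" "(y' has_derivative (\<lambda>k. - Q z * y z * k)) (at z)"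
      using y(1)[OF z] y(2)[OF z] unfolding has_field_derivative_def .
    have "((\<lambda>z. of_real (D z) * y' z - \<delta> z * y z) has_derivative (\<lambda>k. of_real (D z) * (- Q z * y z * k) + (\<delta> z * k + cnj (\<delta> z) * cnj k) * y' z
       - (\<delta> z * (y' z * k) + (- Q z * of_real (D z) * k + m z * cnj k) * y z))) (at z)"
      by (intro has_derivative_diff has_derivative_mult Dc \<delta> z yd)
    then have "((\<lambda>z. of_real (D z) * y' z - \<delta> z * y z) has_derivative (\<lambda>k. (cnj (\<delta> z) * y' z - m z * y z) * cnj k)) (at z)"
      by (rule has_derivative_eq_rhs) (auto simp: algebra_simps)
    from bounded_linear.has_derivative[OF bounded_linear_cnj this]
    show ?thesis unfolding \<alpha> has_field_derivative_def
      by (rule has_derivative_eq_rhs) (auto simp: algebra_simps)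
  qed
  define \<alpha>1 where "\<alpha>1 = (\<lambda>z. cnj (of_real (D z) * y1' z - \<delta> z * y1 z))"
  define \<alpha>2 where "\<alpha>2 = (\<lambda>z. cnj (of_real (D z) * y2' z - \<delta> z * y2 z))"
  define \<alpha>1' where "\<alpha>1' z = \<delta> z * cnj (y1' z) - cnj (m z) * cnj (y1 z)" for z
  define \<alpha>2' where "\<alpha>2' z = \<delta> z * cnj (y2' z) - cnj (m z) * cnj (y2 z)" for z
  have a1: "(\<alpha>1 has_field_derivative \<alpha>1' z) (at z)" and a2: "(\<alpha>2 has_field_derivative \<alpha>2' z) (at z)" if "z \<in> ?B" for z
    unfolding \<alpha>1'_def \<alpha>2'_def using main[OF y1 \<alpha>1_def that] main[OF y2 \<alpha>2_def that] by auto
  have W': "cnj (y1' z) * cnj (y2 z) - cnj (y1 z) * cnj (y2' z) = 1" if "z \<in> ?B" for z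
    using arg_cong[OF W[OF that], of cnj] by simp
  have Deq: "of_real (D z) = cnj (y2 z) * \<alpha>1 z - cnj (y1 z) * \<alpha>2 z" if "z \<in> ?B" for z
  proof -
    have "cnj (y2 z) * \<alpha>1 z - cnj (y1 z) * \<alpha>2 z = of_real (D z) * (cnj (y1' z) * cnj (y2 z) - cnj (y1 z) * cnj (y2' z))"
      unfolding \<alpha>1_def \<alpha>2_def by (simp add: algebra_simps)
    then show ?thesis using W'[OF that] by simp
  qed
  have deq: "\<delta> z = cnj (y2 z) * \<alpha>1' z - cnj (y1 z) * \<alpha>2' z" if "z \<in> ?B" for z
  proof -
    have "cnj (y2 z) * \<alpha>1' z - cnj (y1 z) * \<alpha>2' z = \<delta> z * (cnj (y1' z) * cnj (y2 z) - cnj (y1 z) * cnj (y2' z))"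
      unfolding \<alpha>1'_def \<alpha>2'_def by (simp add: algebra_simps)
    then show ?thesis using W'[OF that] by simp
  qed
  have hol: "\<alpha>1' holomorphic_on ?B" "\<alpha>2' holomorphic_on ?B"
  proof -
    have "\<alpha>1 holomorphic_on ?B" "\<alpha>2 holomorphic_on ?B" using a1 a2 by (meson holomorphic_on_open open_ball)+
    then have "deriv \<alpha>1 holomorphic_on ?B" "deriv \<alpha>2 holomorphic_on ?B" by (auto intro: holomorphic_deriv)
    moreover have "deriv \<alpha>1 z = \<alpha>1' z" "deriv \<alpha>2 z = \<alpha>2' z" if "z \<in> ?B" for z
      using a1 a2 that DERIV_imp_deriv by blast+
    ultimately show "\<alpha>1' holomorphic_on ?B" "\<alpha>2' holomorphic_on ?B"
      using holomorphic_transform by blast+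
  qed
  define a where "a z = deriv \<alpha>1' z + Q z * \<alpha>1 z" for z
  define b where "b z = deriv \<alpha>2' z + Q z * \<alpha>2 z" for z
  have d1: "(\<alpha>1' has_field_derivative (a z - Q z * \<alpha>1 z)) (at z)" 
    and d2: "(\<alpha>2' has_field_derivative (b z - Q z * \<alpha>2 z)) (at z)" if "z \<in> ?B" for z
    unfolding a_def b_def using hol that by (auto simp: holomorphic_derivI)
  have cd: "((\<lambda>z. cnj (y z)) has_derivative (\<lambda>k. cnj y' * cnj k)) (at z)" if "(y has_field_derivative y') (at z)" for y y' z
    using bounded_linear.has_derivative[OF bounded_linear_cnj that[unfolded has_field_derivative_def]] by simp
  \<comment> \<open>Differentiate \<open>\<delta> = cnj y2 * \<alpha>1' - cnj y1 * \<alpha>2'\<close> and compare with \<open>\<delta>\<^sub>z = - Q * D\<close>.\<close>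
  have ab: "cnj (y2 z) * a z = cnj (y1 z) * b z" if z: "z \<in> ?B" for z
  proof -
    have "((\<lambda>z. cnj (y2 z) * \<alpha>1' z - cnj (y1 z) * \<alpha>2' z) has_derivative
       (\<lambda>k. cnj (y2 z) * ((a z - Q z * \<alpha>1 z) * k) + cnj (y2' z) * cnj k * \<alpha>1' z
          - (cnj (y1 z) * ((b z - Q z * \<alpha>2 z) * k) + cnj (y1' z) * cnj k * \<alpha>2' z))) (at z)"
      by (intro has_derivative_diff has_derivative_mult cd y1 y2 z d1[OF z, unfolded has_field_derivative_def]
          d2[OF z, unfolded has_field_derivative_def])
    then have "((\<lambda>z. cnj (y2 z) * \<alpha>1' z - cnj (y1 z) * \<alpha>2' z) has_derivative
       (\<lambda>k. (cnj (y2 z) * (a z - Q z * \<alpha>1 z) - cnj (y1 z) * (b z - Q z * \<alpha>2 z)) * k +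
          (cnj (y2' z) * \<alpha>1' z - cnj (y1' z) * \<alpha>2' z) * cnj k)) (at z)"
      by (rule has_derivative_eq_rhs) (auto simp: algebra_simps)
    then have "(\<delta> has_derivative
       (\<lambda>k. (cnj (y2 z) * (a z - Q z * \<alpha>1 z) - cnj (y1 z) * (b z - Q z * \<alpha>2 z)) * k +
          (cnj (y2' z) * \<alpha>1' z - cnj (y1' z) * \<alpha>2' z) * cnj k)) (at z)"
      by (rule has_derivative_transform_within_open[OF _ open_ball z]) (simp add: deq)
    from wirtinger_derivatives_unique(1)[OF this \<delta>[OF z]]
    have "cnj (y2 z) * (a z - Q z * \<alpha>1 z) - cnj (y1 z) * (b z - Q z * \<alpha>2 z) = - Q z * of_real (D z)" .
    then show ?thesis unfolding Deq[OF z] by (simp add: algebra_simps)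
  qed
  have ha: "a holomorphic_on ?B" "b holomorphic_on ?B"
  proof -
    have "\<alpha>1 holomorphic_on ?B" "\<alpha>2 holomorphic_on ?B" using a1 a2 by (meson holomorphic_on_open open_ball)+
    then show "a holomorphic_on ?B" "b holomorphic_on ?B"
      unfolding a_def[abs_def] b_def[abs_def]
      by (auto intro!: holomorphic_on_add holomorphic_on_mult holomorphic_deriv hol Q)
  qed
  have prod: "((\<lambda>z. cnj (y z) * c z) has_derivative (\<lambda>k. cnj (y z) * deriv c z * k + cnj e * c z * cnj k)) (at z)"
    if "(y has_field_derivative e) (at z)" "c holomorphic_on ?B" "z \<in> ?B" for y e c z
  proof -
    have "(c has_derivative (\<lambda>k. deriv c z * k)) (at z)"
      using holomorphic_derivI[OF that(2) open_ball that(3)] by (simp add: has_field_derivative_def)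
    from has_derivative_mult[OF cd[OF that(1)] this]
    show ?thesis by (rule has_derivative_eq_rhs) (auto simp: algebra_simps)
  qed
  have ab': "cnj (y2' z) * a z = cnj (y1' z) * b z" if z: "z \<in> ?B" for z
  proof -
    have "((\<lambda>z. cnj (y2 z) * a z) has_derivative (\<lambda>k. cnj (y1 z) * deriv b z * k + cnj (y1' z) * b z * cnj k)) (at z)"
      by (rule has_derivative_transform_within_open[OF prod[OF y1(1)[OF z] ha(2) z] open_ball z]) (simp_all add: ab z)
    from wirtinger_derivatives_unique(2)[OF prod[OF y2(1)[OF z] ha(1) z] this] show ?thesis .
  qed
  have zero: "a z = 0" "b z = 0" if z: "z \<in> ?B" for z
  proof -
    have "a z = a z * (cnj (y1' z) * cnj (y2 z) - cnj (y1 z) * cnj (y2' z))" using W'[OF z] by simp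
    also have "\<dots> = cnj (y1' z) * (cnj (y2 z) * a z) - cnj (y1 z) * (cnj (y2' z) * a z)" by (simp add: algebra_simps)
    also have "\<dots> = 0" unfolding ab[OF z] ab'[OF z] by (simp add: algebra_simps)
    finally show "a z = 0" .
    have "b z = b z * (cnj (y1' z) * cnj (y2 z) - cnj (y1 z) * cnj (y2' z))" using W'[OF z] by simp
    also have "\<dots> = cnj (y2 z) * (cnj (y1' z) * b z) - cnj (y2' z) * (cnj (y1 z) * b z)" by (simp add: algebra_simps)
    also have "\<dots> = 0" unfolding ab[OF z, symmetric] ab'[OF z, symmetric] by (simp add: algebra_simps)
    finally show "b z = 0" .
  qed
  have vanish: "\<alpha> z = 0"
    if \<alpha>: "\<And>z. z \<in> ?B \<Longrightarrow> (\<alpha> has_field_derivative \<alpha>' z) (at z)"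
      "\<And>z. z \<in> ?B \<Longrightarrow> (\<alpha>' has_field_derivative - Q z * \<alpha> z) (at z)"
      "\<alpha> z0 = 0" "\<alpha>' z0 = 0" and z: "z \<in> ?B" for \<alpha> \<alpha>' z
  proof -
    have wr: "\<alpha> z * y' z - \<alpha>' z * y z = 0"
      if y: "\<And>z. z \<in> ?B \<Longrightarrow> (y has_field_derivative y' z) (at z)"
      "\<And>z. z \<in> ?B \<Longrightarrow> (y' has_field_derivative - Q z * y z) (at z)" for y y'
    proof -
      have "((\<lambda>z. \<alpha> z * y' z - \<alpha>' z * y z) has_field_derivative 0) (at x within ?B)" if "x \<in> ?B" for x
      proof -
        have "((\<lambda>z. \<alpha> z * y' z - \<alpha>' z * y z) has_field_derivative 0) (at x)"
          by (auto intro!: derivative_eq_intros \<alpha> y that)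
        then show ?thesis by (rule has_field_derivative_at_within)
      qed
      from has_field_derivative_zero_constant[OF convex_ball this]
      obtain c where "\<And>x. x \<in> ?B \<Longrightarrow> \<alpha> x * y' x - \<alpha>' x * y x = c" by blast
      from this[OF z] this[OF z0] \<alpha>(3,4) show ?thesis by simp
    qed
    have "\<alpha> z = \<alpha> z * (y1' z * y2 z - y1 z * y2' z)" using W[OF z] by simp
    also have "\<dots> = (\<alpha> z * y1' z - \<alpha>' z * y1 z) * y2 z - (\<alpha> z * y2' z - \<alpha>' z * y2 z) * y1 z" by (simp add: algebra_simps)
    also have "\<dots> = 0" using wr[OF y1] wr[OF y2] by simp
    finally show ?thesis .
  qed
  have e1: "(\<alpha>1' has_field_derivative - Q x * \<alpha>1 x) (at x)" and e2: "(\<alpha>2' has_field_derivative - Q x * \<alpha>2 x) (at x)"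
    if "x \<in> ?B" for x
    using d1[OF that] d2[OF that] zero[OF that] by simp_all
  have "\<alpha>1 z0 = 0" "\<alpha>1' z0 = 0" "\<alpha>2 z0 = 0" "\<alpha>2' z0 = 0"
    using 0 by (simp_all add: \<alpha>1_def \<alpha>1'_def \<alpha>2_def \<alpha>2'_def)
  then have "\<alpha>1 z = 0" "\<alpha>2 z = 0"
    using vanish[OF a1 e1 _ _ z] vanish[OF a2 e2 _ _ z] by simp_all
  then show ?thesis using Deq[OF z] by simp
qed

text \<open>
  For holomorphic \<open>y\<close> with derivative \<open>y'\<close> these are the Wirtinger derivatives of \<open>\<bar>y\<bar>\<^sup>2 / 2\<close> up to order two.
\<close>
lemma hermitian_square_derivatives:
  assumes "(y has_field_derivative y' z) (at z)" "(y' has_field_derivative y'') (at z)"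
  shows "((\<lambda>z. (norm (y z))\<^sup>2 / 2) has_derivative (\<lambda>k. 2 * Re (y' z * cnj (y z) / 2 * k))) (at z)"
    "((\<lambda>z. y' z * cnj (y z) / 2) has_derivative (\<lambda>k. y'' * cnj (y z) / 2 * k + of_real ((norm (y' z))\<^sup>2 / 2) * cnj k)) (at z)"
proof -
  have yd: "(y has_derivative (\<lambda>k. y' z * k)) (at z)" "(y' has_derivative (\<lambda>k. y'' * k)) (at z)"
    using assms by (auto simp: has_field_derivative_def)
  have cd: "((\<lambda>z. cnj (y z)) has_derivative (\<lambda>k. cnj (y' z) * cnj k)) (at z)"
    using bounded_linear.has_derivative[OF bounded_linear_cnj yd(1)] by simp
  have "((\<lambda>z. Re (y z * cnj (y z)) / 2) has_derivative (\<lambda>k. Re (y z * (cnj (y' z) * cnj k) + y' z * k * cnj (y z)) / 2)) (at z)"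
    by (intro bounded_linear.has_derivative[OF bounded_linear_divide] has_derivative_Re has_derivative_mult yd cd)
  moreover have "Re (x * cnj x) = (norm x)\<^sup>2" for x by (simp add: complex_mult_cnj cmod_power2)
  ultimately have "((\<lambda>z. (norm (y z))\<^sup>2 / 2) has_derivative (\<lambda>k. Re (y z * (cnj (y' z) * cnj k) + y' z * k * cnj (y z)) / 2)) (at z)"
    by simp
  then show "((\<lambda>z. (norm (y z))\<^sup>2 / 2) has_derivative (\<lambda>k. 2 * Re (y' z * cnj (y z) / 2 * k))) (at z)"
    by (rule has_derivative_eq_rhs) (auto simp: fun_eq_iff algebra_simps)
  have "((\<lambda>z. y' z * cnj (y z) / 2) has_derivative (\<lambda>k. (y' z * (cnj (y' z) * cnj k) + y'' * k * cnj (y z)) / 2)) (at z)"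
    by (intro bounded_linear.has_derivative[OF bounded_linear_divide] has_derivative_mult yd cd)
  moreover have "complex_of_real ((norm (y' z))\<^sup>2 / 2) = y' z * cnj (y' z) / 2"
    using complex_norm_square[of "y' z"] by simp
  ultimately show "((\<lambda>z. y' z * cnj (y z) / 2) has_derivative (\<lambda>k. y'' * cnj (y z) / 2 * k + of_real ((norm (y' z))\<^sup>2 / 2) * cnj k)) (at z)"
    by (elim has_derivative_eq_rhs) (auto simp: fun_eq_iff algebra_simps add_divide_distrib)
qed

text \<open>
  The function \<open>v = 1 / lam\<close> satisfies \<open>v\<^sub>z\<^sub>z + Q v = 0\<close> where \<open>Q = u\<^sub>z\<^sub>z - u\<^sub>z\<^sup>2\<close> is holomorphic. Take holomorphic
  solutions \<open>y1\<close> and \<open>y2\<close> of the same equation with Wronskian \<open>1\<close> such that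
  \<open>(\<bar>y2\<bar>\<^sup>2 - \<bar>y1\<bar>\<^sup>2) / 2\<close> has the same value, first derivatives and mixed second derivative at \<open>z0\<close> as \<open>v\<close>.
  Then both agree near \<open>z0\<close>. The quotient \<open>f = y1 / y2\<close> has derivative \<open>1 / y2\<^sup>2\<close>, so that
  \<open>2 \<bar>f'\<bar> / (1 - \<bar>f\<bar>\<^sup>2) = 2 / (\<bar>y2\<bar>\<^sup>2 - \<bar>y1\<bar>\<^sup>2) = lam\<close>.
\<close>
theorem liouville_local_representation:
  assumes G: "open G" and reg: "regular_conformal_metric G lam"
    and curv: "\<forall>z\<in>G. curvature lam z = -1" and z0: "z0 \<in> G"
  shows "\<exists>r>0. \<exists>f. ball z0 r \<subseteq> G \<and> f holomorphic_on ball z0 r \<and> f z0 = 0 \<and>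
     (\<forall>z\<in>ball z0 r. norm (f z) < 1 \<and> lam z = 2 * norm (deriv f z) / (1 - (norm (f z))\<^sup>2))"
proof -
  have pos: "lam z > 0" if "z \<in> G" for z using reg that by (simp add: regular_conformal_metric_def)
  obtain w P where
    u: "\<forall>z\<in>G. ((\<lambda>z. ln (lam z)) has_derivative (\<lambda>k. 2 * Re (w z * k))) (at z)"
    and w: "\<forall>z\<in>G. (w has_derivative (\<lambda>k. P z * k + of_real ((lam z)\<^sup>2 / 4) * cnj k)) (at z)"
    and Pc: "continuous_on G P"
    using log_conformal_metric_wirtinger[OF G reg curv] by blast
  \<comment> \<open>With \<open>E = lam\<^sup>2 / 4\<close> the curvature equation implies the hypothesis of \<open>schwarzian_analytic\<close>.\<close>
  define U where "U z = ln (lam z)" for z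
  have dU: "(U has_derivative (\<lambda>k. 2 * Re (w z * k))) (at z)" if "z \<in> G" for z
    using u that unfolding U_def[abs_def] by blast
  define E where "E z = exp (2 * U z) / 4" for z
  have EG: "E z = (lam z)\<^sup>2 / 4" if "z \<in> G" for z
    using pos[OF that] by (simp add: E_def U_def exp_double)
  have dE: "((\<lambda>z. complex_of_real (E z)) has_derivative
      (\<lambda>k. 2 * w z * of_real (E z) * k + 2 * cnj (w z) * of_real (E z) * cnj k)) (at z)" if "z \<in> G" for z
  proof -
    have "(E has_derivative (\<lambda>k. E z * (4 * Re (w z * k)))) (at z)"
      unfolding E_def
      by (rule derivative_eq_intros dU that refl | simp add: fun_eq_iff algebra_simps diff_divide_distrib)+
    from has_derivative_of_real[OF this] show ?thesis
      by (rule has_derivative_eq_rhs) (auto simp: complex_eq_iff algebra_simps)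
  qed
  have dw: "(w has_derivative (\<lambda>k. P z * k + of_real (E z) * cnj k)) (at z)" if "z \<in> G" for z
    using w that unfolding EG[OF that] by blast
  have wc: "continuous_on G w" "continuous_on G (\<lambda>z. complex_of_real (E z))"
    using dw dE by (meson has_derivative_continuous continuous_at_imp_continuous_on)+
  define Q where "Q z = P z - (w z)\<^sup>2" for z
  have "continuous_on G (\<lambda>z. 2 * cnj (w z) * complex_of_real (E z))" by (intro continuous_intros wc)
  from schwarzian_analytic[OF G dw dE Pc this] have QG: "Q holomorphic_on G"
    unfolding Q_def by (rule analytic_imp_holomorphic)
  obtain r0 where "r0 > 0" and r0: "cball z0 r0 \<subseteq> G" using open_contains_cball_eq[OF G] z0 by auto
  have "compact (Q ` cball z0 r0)"
    by (intro compact_continuous_image holomorphic_on_imp_continuous_on[OF holomorphic_on_subset[OF QG r0]] compact_cball)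
  then obtain M where M: "M > 0" "\<And>z. z \<in> cball z0 r0 \<Longrightarrow> norm (Q z) \<le> M"
    using compact_imp_bounded[of "Q ` cball z0 r0"] by (auto simp: bounded_pos)
  define r where "r = min (min r0 1) (1 / (2 * M))"
  have r: "0 < r" "r \<le> 1" "r \<le> r0" "M * r \<le> 1 / 2"
    using \<open>r0 > 0\<close> M(1) mult_left_mono[of r "1 / (2 * M)" M] by (auto simp: r_def)
  let ?B = "ball z0 r"
  have BG: "?B \<subseteq> G" using r0 r(3) by (auto simp: subset_iff)
  have QB: "Q holomorphic_on ?B" using QG BG holomorphic_on_subset by blast
  have MB: "norm (Q z) \<le> M" if "z \<in> ?B" for z using M(2) that r(3) by auto
  note ode = linear_ode_solution[OF QB r(1,2) MB r(4)]
  define v where "v z = exp (- U z)" for z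
  have vG: "v z = 1 / lam z" if "z \<in> G" for z using pos[OF that] by (simp add: v_def U_def exp_minus field_simps)
  define p where "p z = - (w z * of_real (v z))" for z
  have dv: "(v has_derivative (\<lambda>k. 2 * Re (p z * k))) (at z)" if "z \<in> G" for z
  proof -
    have "(v has_derivative (\<lambda>k. v z * - (2 * Re (w z * k)))) (at z)"
      unfolding v_def by (rule derivative_eq_intros dU that refl | simp add: fun_eq_iff algebra_simps)+
    then show ?thesis by (rule has_derivative_eq_rhs) (auto simp: p_def algebra_simps)
  qed
  have dp: "(p has_derivative (\<lambda>k. - Q z * of_real (v z) * k + of_real (((norm (w z))\<^sup>2 - E z) * v z) * cnj k)) (at z)"
    if z: "z \<in> G" for z
  proof -
    have "(p has_derivative (\<lambda>k. - (w z * of_real (2 * Re (p z * k)) + (P z * k + of_real (E z) * cnj k) * of_real (v z)))) (at z)"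
      unfolding p_def[abs_def] by (intro has_derivative_minus has_derivative_mult has_derivative_of_real dw dv[unfolded p_def] z)
    then show ?thesis
    proof (rule has_derivative_eq_rhs)
      have re: "complex_of_real (2 * Re (p z * k)) = p z * k + cnj (p z) * cnj k" for k by (simp add: complex_eq_iff)
      have nm: "complex_of_real (((norm (w z))\<^sup>2 - E z) * v z) = (w z * cnj (w z) - of_real (E z)) * of_real (v z)"
        by (simp only: of_real_mult of_real_diff complex_norm_square)
      show "(\<lambda>k. - (w z * of_real (2 * Re (p z * k)) + (P z * k + of_real (E z) * cnj k) * of_real (v z))) =
        (\<lambda>k. - Q z * of_real (v z) * k + of_real (((norm (w z))\<^sup>2 - E z) * v z) * cnj k)"
        unfolding re nm by (simp add: fun_eq_iff p_def Q_def power2_eq_square algebra_simps)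
    qed
  qed
  \<comment> \<open>The initial values solve \<open>\<bar>y2\<bar>\<^sup>2 = 2 v\<close>, \<open>y2' * cnj y2 = 2 v\<^sub>z\<close> and \<open>y1' * y2 = 1\<close> at \<open>z0\<close>, with \<open>y1 = 0\<close> there.\<close>
  define s where "s = sqrt (2 * v z0)"
  have v0: "v z0 > 0" by (simp add: v_def)
  have s: "s > 0" "s * s = 2 * v z0" using v0 by (auto simp: s_def)
  obtain y1 y1' where y10: "y1 z0 = 0" "y1' z0 = of_real (1 / s)" and
    y1: "\<And>z. z \<in> ?B \<Longrightarrow> (y1 has_field_derivative y1' z) (at z)" "\<And>z. z \<in> ?B \<Longrightarrow> (y1' has_field_derivative - Q z * y1 z) (at z)"
    using ode[of 0 "of_real (1 / s)"] by auto
  obtain y2 y2' where y20: "y2 z0 = of_real s" "y2' z0 = 2 * p z0 / of_real s" and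
    y2: "\<And>z. z \<in> ?B \<Longrightarrow> (y2 has_field_derivative y2' z) (at z)" "\<And>z. z \<in> ?B \<Longrightarrow> (y2' has_field_derivative - Q z * y2 z) (at z)"
    using ode[of "of_real s" "2 * p z0 / of_real s"] by auto
  have z0B: "z0 \<in> ?B" using r by simp
  have W: "y1' z * y2 z - y1 z * y2' z = 1" if z: "z \<in> ?B" for z
  proof -
    have "((\<lambda>z. y1' z * y2 z - y1 z * y2' z) has_field_derivative 0) (at x within ?B)" if "x \<in> ?B" for x
    proof -
      have "((\<lambda>z. y1' z * y2 z - y1 z * y2' z) has_field_derivative 0) (at x)"
        by (auto intro!: derivative_eq_intros y1 y2 that)
      then show ?thesis by (rule has_field_derivative_at_within)
    qed
    from has_field_derivative_zero_constant[OF convex_ball this]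
    obtain c where "\<And>x. x \<in> ?B \<Longrightarrow> y1' x * y2 x - y1 x * y2' x = c" by blast
    from this[OF z] this[OF z0B] s(1) show ?thesis by (simp add: y10 y20)
  qed
  define D where "D z = v z - ((norm (y2 z))\<^sup>2 / 2 - (norm (y1 z))\<^sup>2 / 2)" for z
  define \<delta> where "\<delta> z = p z - (y2' z * cnj (y2 z) / 2 - y1' z * cnj (y1 z) / 2)" for z
  define m where "m z = complex_of_real (((norm (w z))\<^sup>2 - E z) * v z) - (of_real ((norm (y2' z))\<^sup>2 / 2) - of_real ((norm (y1' z))\<^sup>2 / 2))" for z
  have dD: "(D has_derivative (\<lambda>k. 2 * Re (\<delta> z * k))) (at z)" if "z \<in> ?B" for z
  proof -
    have "(D has_derivative (\<lambda>k. 2 * Re (p z * k) - (2 * Re (y2' z * cnj (y2 z) / 2 * k) - 2 * Re (y1' z * cnj (y1 z) / 2 * k)))) (at z)"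
      unfolding D_def using that BG
      by (intro has_derivative_diff dv hermitian_square_derivatives(1)[OF y2[OF that]] hermitian_square_derivatives(1)[OF y1[OF that]]) auto
    then show ?thesis
      by (rule has_derivative_eq_rhs) (simp add: fun_eq_iff \<delta>_def left_diff_distrib right_diff_distrib del: times_complex.sel)
  qed
  have d\<delta>: "(\<delta> has_derivative (\<lambda>k. - Q z * of_real (D z) * k + m z * cnj k)) (at z)" if "z \<in> ?B" for z
  proof -
    have "(\<delta> has_derivative (\<lambda>k. (- Q z * of_real (v z) * k + of_real (((norm (w z))\<^sup>2 - E z) * v z) * cnj k)
      - (((- Q z * y2 z) * cnj (y2 z) / 2 * k + of_real ((norm (y2' z))\<^sup>2 / 2) * cnj k)
        - ((- Q z * y1 z) * cnj (y1 z) / 2 * k + of_real ((norm (y1' z))\<^sup>2 / 2) * cnj k)))) (at z)"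
      unfolding \<delta>_def using that BG
      by (intro has_derivative_diff dp hermitian_square_derivatives(2)[OF y2[OF that]] hermitian_square_derivatives(2)[OF y1[OF that]]) auto
    moreover have Dz: "complex_of_real (D z) = of_real (v z) - (y2 z * cnj (y2 z) / 2 - y1 z * cnj (y1 z) / 2)"
      unfolding D_def by (simp add: complex_norm_square del: of_real_power)
    ultimately show ?thesis
      unfolding Dz by (elim has_derivative_eq_rhs) (simp add: fun_eq_iff m_def algebra_simps)
  qed
  have D0: "D z0 = 0"
    using s by (simp add: D_def y10 y20 power2_eq_square)
  have \<delta>0: "\<delta> z0 = 0"
    using s by (simp add: \<delta>_def y10 y20)
  have m0: "m z0 = 0"
  proof -
    have E0: "E z0 = 1 / (4 * (v z0)\<^sup>2)" using EG[OF z0] vG[OF z0] pos[OF z0] by (simp add: power2_eq_square)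
    have "(norm (y2' z0))\<^sup>2 = 4 * (norm (p z0))\<^sup>2 / (s * s)"
      using s(1) by (simp add: y20 norm_divide norm_mult power2_eq_square field_simps)
    also have "(norm (p z0))\<^sup>2 = (norm (w z0))\<^sup>2 * (v z0)\<^sup>2" using v0 by (simp add: p_def norm_mult power_mult_distrib)
    finally have 1: "(norm (y2' z0))\<^sup>2 = 2 * (norm (w z0))\<^sup>2 * v z0" using v0 unfolding s(2) by (simp add: power2_eq_square)
    have "(norm (y1' z0))\<^sup>2 = 1 / (s * s)" using s(1) unfolding y10 norm_of_real by (simp add: power2_eq_square)
    then have 2: "(norm (y1' z0))\<^sup>2 = 1 / (2 * v z0)" unfolding s(2) .
    have "((norm (w z0))\<^sup>2 - E z0) * v z0 - ((norm (y2' z0))\<^sup>2 / 2 - (norm (y1' z0))\<^sup>2 / 2) = 0"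
      unfolding 1 2 E0 using v0 by (simp add: field_simps power2_eq_square)
    then show ?thesis unfolding m_def of_real_diff[symmetric] by (simp only: of_real_0)
  qed
  have Dz: "D z = 0" if "z \<in> ?B" for z
    by (rule real_solution_unique[OF r(1) QB y1 y2 W dD d\<delta> D0 \<delta>0 m0 that])
  have veq: "2 / lam z = (norm (y2 z))\<^sup>2 - (norm (y1 z))\<^sup>2" if "z \<in> ?B" for z
  proof -
    have "z \<in> G" using that BG by blast
    then show ?thesis using Dz[OF that] vG[of z] by (simp add: D_def field_simps)
  qed
  define f where "f z = y1 z / y2 z" for z
  have y12: "norm (y1 z) < norm (y2 z)" if "z \<in> ?B" for z
  proof -
    have "z \<in> G" using that BG by blast
    then have "0 < 2 / lam z" using pos by simp
    then show ?thesis unfolding veq[OF that] using power2_less_imp_less[of "norm (y1 z)" "norm (y2 z)"] by simp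
  qed
  have y2nz: "y2 z \<noteq> 0" if "z \<in> ?B" for z using y12[OF that] by auto
  have df: "(f has_field_derivative 1 / (y2 z)\<^sup>2) (at z)" if "z \<in> ?B" for z
  proof -
    have "(f has_field_derivative (y1' z * y2 z - y1 z * y2' z) / (y2 z * y2 z)) (at z)"
      unfolding f_def by (rule DERIV_divide[OF y1(1)[OF that] y2(1)[OF that] y2nz[OF that]])
    then show ?thesis using W[OF that] by (simp add: power2_eq_square)
  qed
  have "norm (f z) < 1 \<and> lam z = 2 * norm (deriv f z) / (1 - (norm (f z))\<^sup>2)" if z: "z \<in> ?B" for z
  proof
    show "norm (f z) < 1" using y12[OF z] by (simp add: f_def norm_divide divide_less_eq_1)
    have n2: "norm (y2 z) > 0" using y2nz[OF z] by simp
    have lp: "lam z > 0" using z BG pos by blast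
    have "1 - (norm (f z))\<^sup>2 = ((norm (y2 z))\<^sup>2 - (norm (y1 z))\<^sup>2) / (norm (y2 z))\<^sup>2"
      using n2 by (simp add: f_def norm_divide power_divide diff_divide_distrib)
    also have "\<dots> = 2 / lam z / (norm (y2 z))\<^sup>2" unfolding veq[OF z] ..
    finally have "1 - (norm (f z))\<^sup>2 = 2 / lam z / (norm (y2 z))\<^sup>2" .
    moreover have "norm (deriv f z) = 1 / (norm (y2 z))\<^sup>2"
      using DERIV_imp_deriv[OF df[OF z]] by (simp add: norm_divide norm_power)
    ultimately show "lam z = 2 * norm (deriv f z) / (1 - (norm (f z))\<^sup>2)"
      using lp n2 by simp
  qed
  moreover have "f holomorphic_on ?B" using df by (meson holomorphic_on_open open_ball)
  moreover have "f z0 = 0" by (simp add: f_def y10)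
  ultimately show ?thesis using r(1) BG by blast
qed

section \<open>Local isometries of the disc\<close>

definition hyp_pullback :: "(complex \<Rightarrow> complex) \<Rightarrow> complex \<Rightarrow> real" where
  "hyp_pullback f z = 2 * norm (deriv f z) / (1 - (norm (f z))\<^sup>2)"

definition disc_isometry :: "(complex \<Rightarrow> complex) \<Rightarrow> bool" where
  "disc_isometry T \<longleftrightarrow> T holomorphic_on ball 0 1 \<and> T ` ball 0 1 \<subseteq> ball 0 1 \<and>
     (\<forall>w\<in>ball 0 1. hyp_pullback T w = 2 / (1 - (norm w)\<^sup>2))"

definition disc_automorphism :: "(complex \<Rightarrow> complex) \<Rightarrow> (complex \<Rightarrow> complex) \<Rightarrow> bool" where
  "disc_automorphism T S \<longleftrightarrow> disc_isometry T \<and> disc_isometry S \<and> (\<forall>w\<in>ball 0 1. S (T w) = w \<and> T (S w) = w)"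

lemma disc_isometry_norm_less: "disc_isometry T \<Longrightarrow> norm w < 1 \<Longrightarrow> norm (T w) < 1"
  unfolding disc_isometry_def by (force simp: image_subset_iff)

lemma norm_square_less_one: "norm (w :: complex) < 1 \<Longrightarrow> (norm w)\<^sup>2 < 1"
  by (simp add: power_less_one_iff)

lemma hyp_pullback_cong:
  assumes "\<forall>\<^sub>F x in nhds z. f x = g x"
  shows "hyp_pullback f z = hyp_pullback g z"
  unfolding hyp_pullback_def using deriv_cong_ev[OF assms refl] eventually_nhds_x_imp_x[OF assms] by simp

lemma hyp_pullback_eventually_cong:
  assumes "\<forall>\<^sub>F x in nhds z. f x = g x"
  shows "\<forall>\<^sub>F x in nhds z. hyp_pullback f x = hyp_pullback g x"
proof -
  have "\<forall>\<^sub>F x in nhds z. \<forall>\<^sub>F y in nhds x. f y = g y" using assms by (simp only: eventually_eventually)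
  then show ?thesis by eventually_elim (rule hyp_pullback_cong)
qed

lemma hyp_pullback_compose:
  assumes "disc_isometry T" "f holomorphic_on U" "open U" "z \<in> U" "norm (f z) < 1"
  shows "hyp_pullback (\<lambda>x. T (f x)) z = hyp_pullback f z"
proof -
  have f: "(f has_field_derivative deriv f z) (at z)" using assms by (intro holomorphic_derivI) auto
  have T: "(T has_field_derivative deriv T (f z)) (at (f z))"
    using assms unfolding disc_isometry_def by (intro holomorphic_derivI[of _ "ball 0 1"]) auto
  have d: "deriv (\<lambda>x. T (f x)) z = deriv T (f z) * deriv f z"
    using DERIV_chain2[OF T f] by (rule DERIV_imp_deriv)
  have "hyp_pullback T (f z) = 2 / (1 - (norm (f z))\<^sup>2)"
    using assms unfolding disc_isometry_def by auto
  then have "2 * norm (deriv T (f z)) / (1 - (norm (T (f z)))\<^sup>2) * norm (deriv f z) = 2 / (1 - (norm (f z))\<^sup>2) * norm (deriv f z)"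
    unfolding hyp_pullback_def by simp
  then show ?thesis unfolding hyp_pullback_def d norm_mult by (simp add: mult.assoc)
qed

lemma disc_isometry_compose:
  assumes "disc_isometry T" "disc_isometry S"
  shows "disc_isometry (\<lambda>w. T (S w))"
proof -
  have S: "S holomorphic_on ball 0 1" "S ` ball 0 1 \<subseteq> ball 0 1" and T: "T holomorphic_on ball 0 1" "T ` ball 0 1 \<subseteq> ball 0 1"
    using assms unfolding disc_isometry_def by auto
  have "hyp_pullback (\<lambda>x. T (S x)) w = 2 / (1 - (norm w)\<^sup>2)" if "w \<in> ball 0 1" for w
    using hyp_pullback_compose[OF assms(1) S(1) open_ball that] disc_isometry_norm_less[OF assms(2)] assms(2) that
    unfolding disc_isometry_def by auto
  moreover have "(\<lambda>w. T (S w)) holomorphic_on ball 0 1"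
    using holomorphic_on_compose_gen[OF S(1) T(1) S(2)] by (simp add: o_def)
  ultimately show ?thesis using S(2) T(2) unfolding disc_isometry_def by auto
qed

lemma disc_automorphism_compose:
  assumes "disc_automorphism T S" "disc_automorphism T' S'"
  shows "disc_automorphism (\<lambda>w. T (T' w)) (\<lambda>w. S' (S w))"
proof -
  have "disc_isometry T" "disc_isometry S" "disc_isometry T'" "disc_isometry S'"
    using assms unfolding disc_automorphism_def by auto
  note iso = this
  have "S w \<in> ball 0 1" "T' w \<in> ball 0 1" if "w \<in> ball 0 1" for w
    using that disc_isometry_norm_less[OF iso(2), of w] disc_isometry_norm_less[OF iso(3), of w] by simp_all
  then show ?thesis
    using assms disc_isometry_compose[OF iso(1,3)] disc_isometry_compose[OF iso(4,2)]
    unfolding disc_automorphism_def by simp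
qed

lemma disc_automorphism_sym: "disc_automorphism T S \<Longrightarrow> disc_automorphism S T"
  unfolding disc_automorphism_def by auto

lemma disc_automorphism_rotation:
  assumes "norm c = 1"
  shows "disc_automorphism (\<lambda>w. c * w) (\<lambda>w. cnj c * w)"
proof -
  have *: "disc_isometry (\<lambda>w. c * w)" if "norm c = 1" for c
  proof -
    have "deriv (\<lambda>w. c * w) w = c" for w by (intro DERIV_imp_deriv) (auto intro!: derivative_eq_intros)
    then show ?thesis using that unfolding disc_isometry_def hyp_pullback_def
      by (auto simp: norm_mult intro!: holomorphic_intros)
  qed
  have "c * cnj c = 1" using assms complex_norm_square[of c] by simp
  then have "cnj c * (c * w) = w" "c * (cnj c * w) = w" for w
    by (metis mult.assoc mult.commute mult_1_left)+
  then show ?thesis unfolding disc_automorphism_def using *[of c] *[of "cnj c"] assms by simp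
qed

lemma moebius_identity:
  assumes "norm a < 1" "norm w < 1"
  shows "1 - (norm ((w - a) / (1 - cnj a * w)))\<^sup>2 = (1 - (norm a)\<^sup>2) * (1 - (norm w)\<^sup>2) / (norm (1 - cnj a * w))\<^sup>2"
    and "1 - cnj a * w \<noteq> 0"
proof -
  have "norm (cnj a * w) < 1" using mult_strict_mono'[of "norm a" 1 "norm w" 1] assms by (simp add: norm_mult)
  then show nz: "1 - cnj a * w \<noteq> 0" by auto
  have "complex_of_real ((norm (1 - cnj a * w))\<^sup>2 - (norm (w - a))\<^sup>2) = of_real ((1 - (norm a)\<^sup>2) * (1 - (norm w)\<^sup>2))"
    unfolding of_real_diff of_real_mult complex_norm_square of_real_1 by (simp add: algebra_simps)
  then have "(norm (1 - cnj a * w))\<^sup>2 - (norm (w - a))\<^sup>2 = (1 - (norm a)\<^sup>2) * (1 - (norm w)\<^sup>2)"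
    by (simp only: of_real_eq_iff)
  then show "1 - (norm ((w - a) / (1 - cnj a * w)))\<^sup>2 = (1 - (norm a)\<^sup>2) * (1 - (norm w)\<^sup>2) / (norm (1 - cnj a * w))\<^sup>2"
    using nz by (simp add: norm_divide power_divide field_simps)
qed

lemma disc_automorphism_moebius:
  assumes a: "norm a < 1"
  shows "\<exists>T S. disc_automorphism T S \<and> T a = 0 \<and> S 0 = a"
proof -
  define M where "M b w = (w - b) / (1 - cnj b * w)" for b w :: complex
  have iso: "disc_isometry (M b)" if b: "norm b < 1" for b
  proof -
    have nz: "1 - cnj b * w \<noteq> 0" if "w \<in> ball 0 1" for w using moebius_identity(2)[OF b] that by simp
    have im: "norm (M b w) < 1" if "w \<in> ball 0 1" for w
    proof -
      have w: "norm w < 1" using that by simp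
      have "0 < (1 - (norm b)\<^sup>2) * (1 - (norm w)\<^sup>2) / (norm (1 - cnj b * w))\<^sup>2"
        using norm_square_less_one[OF b] norm_square_less_one[OF w] nz[OF that] by simp
      then have "(norm (M b w))\<^sup>2 < 1" using moebius_identity(1)[OF b w] unfolding M_def by linarith
      then show ?thesis by (simp add: power_less_one_iff abs_square_less_1)
    qed
    have cancel: "2 * (B / N) / (B * W / N) = 2 / W" if "B \<noteq> 0" "N \<noteq> 0" for B N W :: real
      using that by (simp add: field_simps)
    have "hyp_pullback (M b) w = 2 / (1 - (norm w)\<^sup>2)" if "w \<in> ball 0 1" for w
    proof -
      have w: "norm w < 1" using that by simp
      have "(M b has_field_derivative (1 - cnj b * b) / (1 - cnj b * w)\<^sup>2) (at w)"
        unfolding M_def[abs_def] by (rule derivative_eq_intros refl nz[OF that])+ (simp add: algebra_simps power2_eq_square)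
      then have "deriv (M b) w = (1 - cnj b * b) / (1 - cnj b * w)\<^sup>2" by (rule DERIV_imp_deriv)
      moreover have "1 - cnj b * b = of_real (1 - (norm b)\<^sup>2)"
        by (simp only: of_real_diff complex_norm_square of_real_1 mult.commute)
      moreover have "norm (of_real (1 - (norm b)\<^sup>2) :: complex) = 1 - (norm b)\<^sup>2"
        using norm_square_less_one[OF b] by (simp only: norm_of_real abs_of_pos diff_gt_0_iff_gt)
      ultimately have "norm (deriv (M b) w) = (1 - (norm b)\<^sup>2) / (norm (1 - cnj b * w))\<^sup>2"
        by (simp only: norm_divide norm_power)
      then show ?thesis
        unfolding hyp_pullback_def M_def[of b w] moebius_identity(1)[OF b w]
        using norm_square_less_one[OF b] nz[OF that] by (simp only:) (rule cancel, auto)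
    qed
    moreover have "M b holomorphic_on ball 0 1"
      unfolding M_def[abs_def] by (intro holomorphic_intros nz)
    ultimately show ?thesis unfolding disc_isometry_def using im by auto
  qed
  have inv: "M (- b) (M b w) = w" if b: "norm b < 1" and w: "norm w < 1" for b w
  proof -
    have n1: "1 - cnj b * w \<noteq> 0" by (rule moebius_identity(2)[OF b w])
    have n2: "1 - cnj b * b \<noteq> 0" by (rule moebius_identity(2)[OF b b])
    have "M b w + b = w * (1 - cnj b * b) / (1 - cnj b * w)" using n1 by (simp add: M_def field_simps)
    moreover have "1 + cnj b * M b w = (1 - cnj b * b) / (1 - cnj b * w)" using n1 by (simp add: M_def field_simps)
    ultimately show ?thesis unfolding M_def[of "- b" "M b w"] using n1 n2 by simp
  qed
  have "disc_automorphism (M a) (M (- a))"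
    unfolding disc_automorphism_def using iso[of a] iso[of "- a"] inv[of a] inv[of "- a"] a by auto
  moreover have "M a a = 0" "M (- a) 0 = a" by (auto simp: M_def)
  ultimately show ?thesis by blast
qed

lemma artanh_le_imp_le:
  fixes a b :: real
  assumes "artanh a \<le> artanh b" "0 \<le> a" "a < 1" "0 \<le> b" "b < 1"
  shows "a \<le> b"
proof (rule ccontr)
  assume "\<not> a \<le> b"
  then have "(1 + b) / (1 - b) < (1 + a) / (1 - a)" using assms by (simp add: divide_simps algebra_simps)
  moreover have "0 < (1 + b) / (1 - b)" using assms by simp
  ultimately have "ln ((1 + b) / (1 - b)) < ln ((1 + a) / (1 - a))" by simp
  then show False using assms(1) by (simp add: artanh_def)
qed

text \<open>
  Along the segment from \<open>0\<close> to \<open>w\<close>, the hyperbolic distance \<open>artanh (norm (f x))\<close> from the origin grows at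
  most as fast as \<open>artanh (norm x)\<close>, because \<open>f\<close> preserves the length of tangent vectors. Injectivity keeps
  \<open>f\<close> away from the origin, where the norm is not differentiable.
\<close>
lemma local_isometry_norm_le:
  assumes hol: "f holomorphic_on ball 0 \<rho>" and \<rho>: "0 < \<rho>" "\<rho> \<le> 1"
    and im: "\<And>w. w \<in> ball 0 \<rho> \<Longrightarrow> norm (f w) < 1" and f0: "f 0 = 0"
    and iso: "\<And>w. w \<in> ball 0 \<rho> \<Longrightarrow> hyp_pullback f w = 2 / (1 - (norm w)\<^sup>2)"
    and inj: "inj_on f (ball 0 \<rho>)" and w: "w \<in> ball 0 \<rho>"
  shows "norm (f w) \<le> norm w"
proof (cases "w = 0")
  case True then show ?thesis using f0 by simp
next
  case False
  have tw: "of_real t * w \<in> ball 0 \<rho>" "norm (of_real t * w) = t * norm w" "t * norm w < 1" if "t \<in> {0..1}" for t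
  proof -
    have "t * norm w \<le> norm w" using that by (simp add: mult_left_le_one_le)
    moreover show n: "norm (of_real t * w) = t * norm w" using that by (simp add: norm_mult)
    ultimately show "of_real t * w \<in> ball 0 \<rho>" "t * norm w < 1" using w \<rho> unfolding mem_ball_0 n by auto
  qed
  define \<phi> where "\<phi> t = artanh (norm (f (of_real t * w))) - artanh (t * norm w)" for t :: real
  have "\<phi> 1 \<le> \<phi> 0"
  proof (rule DERIV_nonpos_imp_decreasing_open[where f = \<phi> and a = 0 and b = 1])
    fix t :: real assume t: "0 < t" "t < 1"
    define x where "x = of_real t * w"
    have x: "x \<in> ball 0 \<rho>" "norm x = t * norm w" "x \<noteq> 0" using tw[of t] t False by (auto simp: x_def)
    have fx: "f x \<noteq> 0" using inj_onD[OF inj _ x(1), of 0] f0 x(3) \<rho> by auto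
    have lin: "((\<lambda>t::real. of_real t * w) has_derivative (\<lambda>k. of_real k * w)) (at t)"
      by (auto intro!: derivative_eq_intros)
    have "(f has_derivative (\<lambda>k. deriv f x * k)) (at x)"
      using holomorphic_derivI[OF hol open_ball x(1)] by (simp add: has_field_derivative_def)
    from has_derivative_compose[OF lin this[unfolded x_def]]
    have "((\<lambda>t. f (of_real t * w)) has_derivative (\<lambda>k. deriv f x * (of_real k * w))) (at t)" unfolding x_def .
    from has_derivative_compose[OF this has_derivative_norm[of "f (of_real t * w)"]] fx
    have "((\<lambda>t. norm (f (of_real t * w))) has_derivative (\<lambda>k. inner (sgn (f x)) (deriv f x * (of_real k * w)))) (at t)"
      by (simp add: x_def inner_commute)
    moreover have "inner (sgn (f x)) (deriv f x * (of_real k * w)) = inner (sgn (f x)) (deriv f x * w) * k" for k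
    proof -
      have "deriv f x * (of_real k * w) = k *\<^sub>R (deriv f x * w)" by (simp add: scaleR_conv_of_real)
      then show ?thesis by (simp only: inner_scaleR_right mult.commute)
    qed
    ultimately have dn: "((\<lambda>t. norm (f (of_real t * w))) has_real_derivative inner (sgn (f x)) (deriv f x * w)) (at t)"
      unfolding has_field_derivative_def by simp
    define q where "q = inner (sgn (f x)) (deriv f x * w)"
    have fx1: "norm (f x) < 1" using im[OF x(1)] .
    have xx1: "t * norm w < 1" using tw(3)[of t] t by simp
    have a1: "((\<lambda>t. artanh (norm (f (of_real t * w)))) has_real_derivative 1 / (1 - (norm (f x))\<^sup>2) * q) (at t)"
      using DERIV_chain2[OF artanh_real_has_field_derivative dn] fx1 unfolding q_def x_def by simp
    have a2: "((\<lambda>t. artanh (t * norm w)) has_real_derivative 1 / (1 - (t * norm w)\<^sup>2) * norm w) (at t)"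
      using DERIV_chain2[OF artanh_real_has_field_derivative DERIV_cmult_right[OF DERIV_ident, of "norm w"]] xx1 t
      by (simp add: abs_mult)
    have "q \<le> norm (sgn (f x)) * norm (deriv f x * w)" unfolding q_def by (rule norm_cauchy_schwarz)
    also have "\<dots> = norm (deriv f x) * norm w" using fx by (simp add: norm_sgn norm_mult)
    finally have "1 / (1 - (norm (f x))\<^sup>2) * q \<le> 1 / (1 - (norm (f x))\<^sup>2) * (norm (deriv f x) * norm w)"
      using norm_square_less_one[OF fx1] by (intro mult_left_mono) auto
    also have "\<dots> = hyp_pullback f x / 2 * norm w"
    proof -
      have "1 / D * (a * b) = 2 * a / D / 2 * b" for a b D :: real by simp
      then show ?thesis unfolding hyp_pullback_def .
    qed
    also have "\<dots> = 1 / (1 - (t * norm w)\<^sup>2) * norm w" 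
    proof -
      have "2 / D / 2 * b = 1 / D * b" for b D :: real by simp
      then show ?thesis unfolding iso[OF x(1)] x(2) .
    qed
    finally show "\<exists>y. (\<phi> has_real_derivative y) (at t) \<and> y \<le> 0"
      unfolding \<phi>_def[abs_def] using DERIV_diff[OF a1 a2] by force
  next
    have "continuous_on {0..1} (\<lambda>t. f (of_real t * w))"
      by (rule continuous_on_compose2[OF holomorphic_on_imp_continuous_on[OF hol]]) (auto intro!: continuous_intros tw)
    moreover have "\<forall>x\<in>{0..1}. norm (norm (f (of_real x * w))) < 1" using im tw(1) by simp
    moreover have "\<forall>x\<in>{0..1}. norm (x * norm w) < 1" using tw(3) by (simp add: abs_mult)
    ultimately show "continuous_on {0..1} \<phi>"
      unfolding \<phi>_def[abs_def] by (intro continuous_intros continuous_on_artanh) (auto simp: abs_less_iff intro: less_le_trans[of "- 1" 0])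
  qed simp
  then have "artanh (norm (f w)) \<le> artanh (norm w)" using f0 by (simp add: \<phi>_def)
  then show ?thesis using im[OF w] tw(3)[of 1] by - (rule artanh_le_imp_le, auto)
qed

text \<open>
  On a small ball \<open>f\<close> does not increase the distance from the origin, and \<open>norm (deriv f 0) = 1\<close>. This is
  the equality case of Schwarz' lemma for the rescaled function.
\<close>
lemma local_isometry_rotation:
  assumes hol: "f holomorphic_on ball 0 \<rho>" and \<rho>: "0 < \<rho>" "\<rho> \<le> 1"
    and im: "\<And>w. w \<in> ball 0 \<rho> \<Longrightarrow> norm (f w) < 1" and f0: "f 0 = 0"
    and iso: "\<And>w. w \<in> ball 0 \<rho> \<Longrightarrow> hyp_pullback f w = 2 / (1 - (norm w)\<^sup>2)"
  obtains c where "norm c = 1" "\<And>w. w \<in> ball 0 \<rho> \<Longrightarrow> f w = c * w"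
proof -
  have z: "0 \<in> ball 0 \<rho>" using \<rho> by simp
  have d0: "norm (deriv f 0) = 1" using iso[OF z] f0 by (simp add: hyp_pullback_def)
  then have "deriv f 0 \<noteq> 0" by auto
  then obtain r where r: "r > 0" "ball (0::complex) r \<subseteq> ball 0 \<rho>" "inj_on f (ball 0 r)"
    by (rule has_complex_derivative_locally_injective[OF hol z open_ball], intro that)
  have r1: "r \<le> 1"
  proof (rule ccontr)
    assume "\<not> r \<le> 1"
    then have "(1 :: complex) \<in> ball 0 r" by simp
    then have "(1 :: complex) \<in> ball 0 \<rho>" using r(2) by blast
    then show False using \<rho> by simp
  qed
  have le: "norm (f w) \<le> norm w" if "w \<in> ball 0 r" for w
    using local_isometry_norm_le[OF holomorphic_on_subset[OF hol r(2)] r(1) r1 im f0 iso r(3) that] r(2) by blast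
  define F where "F w = f (of_real r * w) / of_real r" for w
  have rw: "of_real r * w \<in> ball 0 r" if "norm w < 1" for w :: complex using that r(1) by (simp add: norm_mult)
  have "(\<lambda>w. f (of_real r * w)) holomorphic_on ball 0 1"
    using holomorphic_on_compose_gen[of "\<lambda>w. of_real r * w" "ball 0 1" f "ball 0 r"]
      holomorphic_on_subset[OF hol r(2)] rw
    by (simp add: o_def image_subset_iff holomorphic_on_mult holomorphic_on_const holomorphic_on_ident)
  then have "F holomorphic_on ball 0 1" unfolding F_def[abs_def] using r(1) by (intro holomorphic_intros) auto
  moreover have "F 0 = 0" by (simp add: F_def f0)
  moreover have "norm (F w) < 1" if "norm w < 1" for w
  proof -
    have "norm (f (of_real r * w)) \<le> r * norm w" using le[OF rw[OF that]] r(1) by (simp add: norm_mult)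
    also have "\<dots> < r * 1" using that r(1) by (intro mult_strict_left_mono) auto
    finally show ?thesis using r(1) by (simp add: F_def norm_divide)
  qed
  moreover have "norm (deriv F 0) = 1"
  proof -
    have "(f has_field_derivative deriv f 0) (at (of_real r * 0))" using holomorphic_derivI[OF hol open_ball z] by simp
    then have "((\<lambda>w. f (of_real r * w)) has_field_derivative deriv f 0 * of_real r) (at 0)"
      by (rule DERIV_chain2) (auto intro!: derivative_eq_intros)
    then have "(F has_field_derivative deriv f 0 * of_real r / of_real r) (at 0)"
      unfolding F_def[abs_def] by (rule DERIV_cdivide)
    then have "deriv F 0 = deriv f 0" using r(1) DERIV_imp_deriv by fastforce
    then show ?thesis using d0 by simp
  qed
  ultimately have "\<exists>c. (\<forall>w. norm w < 1 \<longrightarrow> F w = c * w) \<and> norm c = 1"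
    by (intro Schwarz_Lemma(3)[of F 0]) auto
  then obtain c where c: "norm c = 1" "\<And>w. norm w < 1 \<Longrightarrow> F w = c * w" by blast
  have eq: "f w = c * w" if "w \<in> ball 0 r" for w
  proof -
    have "norm (w / of_real r) < 1" using that r(1) by (simp add: norm_divide)
    from c(2)[OF this] show ?thesis using r(1) by (simp add: F_def field_simps)
  qed
  have "f w = c * w" if "w \<in> ball 0 \<rho>" for w
    by (rule analytic_continuation_open[of "ball 0 r" "ball 0 \<rho>"])
       (use r hol eq that in \<open>auto intro!: holomorphic_intros\<close>)
  with c(1) show thesis by (rule that)
qed

lemma local_inverse:
  assumes "f holomorphic_on U" "open U" "z \<in> U" "deriv f z \<noteq> 0"
  obtains r g where "r > 0" "ball z r \<subseteq> U" "inj_on f (ball z r)" "open (f ` ball z r)"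
    "g holomorphic_on f ` ball z r" "\<And>x. x \<in> ball z r \<Longrightarrow> g (f x) = x"
    "\<And>x. x \<in> ball z r \<Longrightarrow> deriv f x * deriv g (f x) = 1"
proof -
  obtain r where r: "r > 0" "ball z r \<subseteq> U" "open (f ` ball z r)" "inj_on f (ball z r)"
    by (rule has_complex_derivative_locally_invertible[OF assms(1,3,2,4)], intro that)
  obtain g where "g holomorphic_on f ` ball z r" "\<And>x. x \<in> ball z r \<Longrightarrow> deriv f x * deriv g (f x) = 1"
    "\<And>x. x \<in> ball z r \<Longrightarrow> g (f x) = x"
    by (rule holomorphic_has_inverse[OF holomorphic_on_subset[OF assms(1) r(2)] open_ball r(4)], intro that)
  then show thesis using r by (intro that) auto
qed

text \<open>
  After composition with automorphisms both maps vanish at \<open>z0\<close>. Then one of them composed with the local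
  inverse of the other is a local isometry of the disc that fixes the origin, hence a rotation.
\<close>
theorem developing_maps_differ_by_automorphism:
  assumes U: "open U" "connected U" "z0 \<in> U"
    and f1: "f1 holomorphic_on U" "f1 ` U \<subseteq> ball 0 1" and f2: "f2 holomorphic_on U" "f2 ` U \<subseteq> ball 0 1"
    and eq: "\<forall>\<^sub>F z in nhds z0. hyp_pullback f1 z = hyp_pullback f2 z" and nz: "deriv f1 z0 \<noteq> 0"
  obtains T S where "disc_automorphism T S" "\<And>z. z \<in> U \<Longrightarrow> f2 z = T (f1 z)"
proof -
  have im: "norm (f1 z) < 1" "norm (f2 z) < 1" if "z \<in> U" for z using f1(2) f2(2) that by auto
  obtain T1 S1 where T1: "disc_automorphism T1 S1" "T1 (f1 z0) = 0"
    using disc_automorphism_moebius[OF im(1)[OF U(3)]] by blast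
  obtain T2 S2 where T2: "disc_automorphism T2 S2" "T2 (f2 z0) = 0"
    using disc_automorphism_moebius[OF im(2)[OF U(3)]] by blast
  have iso: "disc_isometry T1" "disc_isometry T2" using T1(1) T2(1) unfolding disc_automorphism_def by auto
  define g1 where "g1 = (\<lambda>z. T1 (f1 z))"
  define g2 where "g2 = (\<lambda>z. T2 (f2 z))"
  have hol: "g1 holomorphic_on U" "g2 holomorphic_on U"
    using holomorphic_on_compose_gen[OF f1(1) _ f1(2), of T1] holomorphic_on_compose_gen[OF f2(1) _ f2(2), of T2] iso
    unfolding disc_isometry_def g1_def g2_def o_def by auto
  have gim: "norm (g1 z) < 1" "norm (g2 z) < 1" if "z \<in> U" for z
    using iso im[OF that] disc_isometry_norm_less unfolding g1_def g2_def by auto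
  have hp: "hyp_pullback g1 z = hyp_pullback f1 z" "hyp_pullback g2 z = hyp_pullback f2 z" if "z \<in> U" for z
    unfolding g1_def g2_def using hyp_pullback_compose iso f1(1) f2(1) U(1) that im by blast+
  have g0: "g1 z0 = 0" "g2 z0 = 0" using T1 T2 by (auto simp: g1_def g2_def)
  have "deriv g1 z0 \<noteq> 0"
    using hp(1)[OF U(3)] nz norm_square_less_one[OF im(1)[OF U(3)]] unfolding hyp_pullback_def by auto
  obtain U' where U': "open U'" "z0 \<in> U'" "\<And>z. z \<in> U' \<Longrightarrow> hyp_pullback f1 z = hyp_pullback f2 z"
    using eq unfolding eventually_nhds by blast
  have "g1 holomorphic_on U \<inter> U'" using hol(1) by (rule holomorphic_on_subset) auto
  moreover have "open (U \<inter> U')" "z0 \<in> U \<inter> U'" using U U' by auto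
  ultimately obtain r k where r: "r > 0" "ball z0 r \<subseteq> U \<inter> U'" "inj_on g1 (ball z0 r)" "open (g1 ` ball z0 r)"
    and k: "k holomorphic_on g1 ` ball z0 r" "\<And>x. x \<in> ball z0 r \<Longrightarrow> k (g1 x) = x"
      "\<And>x. x \<in> ball z0 r \<Longrightarrow> deriv g1 x * deriv k (g1 x) = 1"
    using \<open>deriv g1 z0 \<noteq> 0\<close> by (rule local_inverse, intro that)
  have "0 \<in> g1 ` ball z0 r" using g0 r(1) by force
  then obtain \<rho>' where \<rho>': "\<rho>' > 0" "ball 0 \<rho>' \<subseteq> g1 ` ball z0 r" using r(4) open_contains_ball by blast
  define \<rho> where "\<rho> = min \<rho>' 1"
  have \<rho>: "0 < \<rho>" "\<rho> \<le> 1" "ball 0 \<rho> \<subseteq> g1 ` ball z0 r" using \<rho>' by (auto simp: \<rho>_def)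
  define \<psi> where "\<psi> = (\<lambda>w. g2 (k w))"
  have kU: "k ` (g1 ` ball z0 r) \<subseteq> ball z0 r" using k(2) by auto
  have "\<psi> holomorphic_on g1 ` ball z0 r"
    using holomorphic_on_compose_gen[OF k(1) holomorphic_on_subset[OF hol(2)] kU] r(2) by (auto simp: \<psi>_def o_def)
  then have \<psi>h: "\<psi> holomorphic_on ball 0 \<rho>" using \<rho>(3) holomorphic_on_subset by blast
  have \<psi>iso: "hyp_pullback \<psi> w = 2 / (1 - (norm w)\<^sup>2)" and \<psi>im: "norm (\<psi> w) < 1" if w: "w \<in> ball 0 \<rho>" for w
  proof -
    obtain z where z: "z \<in> ball z0 r" "w = g1 z" using w \<rho>(3) by blast
    have zU: "z \<in> U" "z \<in> U'" using z r(2) by auto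
    have kw: "k w = z" using k(2) z by simp
    have dk: "(k has_field_derivative deriv k w) (at w)" using holomorphic_derivI[OF k(1) r(4)] z by auto
    have "(g2 has_field_derivative deriv g2 z) (at (k w))" using holomorphic_derivI[OF hol(2) U(1) zU(1)] kw by simp
    from DERIV_imp_deriv[OF DERIV_chain2[OF this dk]]
    have d: "deriv \<psi> w = deriv g2 z * deriv k w" by (simp add: \<psi>_def)
    show "norm (\<psi> w) < 1" using gim(2)[OF zU(1)] by (simp add: \<psi>_def kw)
    have n1: "norm (deriv g1 z) * norm (deriv k w) = 1" using k(3)[OF z(1)] z(2) by (metis norm_mult norm_one)
    have "hyp_pullback \<psi> w = hyp_pullback g2 z * norm (deriv k w)" unfolding hyp_pullback_def d by (simp add: \<psi>_def kw norm_mult)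
    also have "\<dots> = hyp_pullback g1 z * norm (deriv k w)" using hp zU U'(3) by simp
    also have "\<dots> = 2 * (norm (deriv g1 z) * norm (deriv k w)) / (1 - (norm (g1 z))\<^sup>2)" by (simp add: hyp_pullback_def)
    finally show "hyp_pullback \<psi> w = 2 / (1 - (norm w)\<^sup>2)" unfolding n1[unfolded z(2)] z(2) by simp
  qed
  have \<psi>0: "\<psi> 0 = 0" using k(2)[of z0] g0 r(1) by (simp add: \<psi>_def)
  obtain c where c: "norm c = 1" "\<And>w. w \<in> ball 0 \<rho> \<Longrightarrow> \<psi> w = c * w"
    by (rule local_isometry_rotation[OF \<psi>h \<rho>(1,2) \<psi>im \<psi>0 \<psi>iso], assumption+, intro that)
  have "\<forall>\<^sub>F z in nhds z0. g1 z \<in> ball 0 \<rho> \<and> z \<in> ball z0 r"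
  proof (rule eventually_conj)
    have "isCont g1 z0" using hol(1) U by (meson holomorphic_on_imp_continuous_on continuous_on_eq_continuous_at)
    then have "filterlim g1 (nhds 0) (nhds z0)" using g0 by (metis isCont_def tendsto_at_iff_tendsto_nhds)
    moreover have "\<forall>\<^sub>F w in nhds 0. w \<in> ball 0 \<rho>" using \<rho>(1) by (rule eventually_nhds_ball)
    ultimately show "\<forall>\<^sub>F z in nhds z0. g1 z \<in> ball 0 \<rho>" by (rule eventually_compose_filterlim[rotated])
    show "\<forall>\<^sub>F z in nhds z0. z \<in> ball z0 r" using r(1) by (rule eventually_nhds_ball)
  qed
  then obtain V where V: "open V" "z0 \<in> V" "\<And>z. z \<in> V \<Longrightarrow> g1 z \<in> ball 0 \<rho> \<and> z \<in> ball z0 r"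
    unfolding eventually_nhds by blast
  have geq: "g2 z = c * g1 z" if "z \<in> V" for z
    using c(2)[of "g1 z"] V(3)[OF that] k(2) by (simp add: \<psi>_def)
  have "g2 z = c * g1 z" if "z \<in> U" for z
    by (rule analytic_continuation_open[of V U])
       (use V r geq hol U that in \<open>auto intro!: holomorphic_intros\<close>)
  moreover have "S2 (g2 z) = f2 z" if "z \<in> U" for z
    using T2(1) im(2)[OF that] unfolding disc_automorphism_def g2_def by auto
  ultimately have "f2 z = S2 (c * T1 (f1 z))" if "z \<in> U" for z using that by (metis g1_def)
  moreover have "disc_automorphism (\<lambda>w. S2 (c * T1 w)) (\<lambda>w. S1 (cnj c * T2 w))"
    using disc_automorphism_compose[OF disc_automorphism_sym[OF T2(1)]
        disc_automorphism_compose[OF disc_automorphism_rotation[OF c(1)] T1(1)]] .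
  ultimately show thesis using that by blast
qed

section \<open>Ahlfors' lemma\<close>

lemma has_laplacian_Re_holomorphic:
  assumes "f holomorphic_on U" "open U" "z \<in> U"
  shows "has_laplacian (\<lambda>x. Re (f x)) z 0"
proof (rule has_laplacianI[where w = "\<lambda>x. deriv f x / 2" and P = "deriv (deriv f) z / 2"])
  have "\<forall>\<^sub>F x in nhds z. x \<in> U" using assms by (intro eventually_nhds_in_open)
  then show "\<forall>\<^sub>F x in nhds z. ((\<lambda>x. Re (f x)) has_derivative (\<lambda>k. 2 * Re (deriv f x / 2 * k))) (at x)"
  proof eventually_elim
    case (elim x)
    have "(f has_derivative (\<lambda>k. deriv f x * k)) (at x)"
      using holomorphic_derivI[OF assms(1,2) elim] by (simp add: has_field_derivative_def)
    from has_derivative_Re[OF this] show ?case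
      by (rule has_derivative_eq_rhs) (auto simp: fun_eq_iff algebra_simps)
  qed
  have "(deriv f has_derivative (\<lambda>k. deriv (deriv f) z * k)) (at z)"
    using holomorphic_derivI[OF holomorphic_deriv[OF assms(1,2)] assms(2,3)] by (simp add: has_field_derivative_def)
  from bounded_linear.has_derivative[OF bounded_linear_divide[of 2] this]
  show "((\<lambda>x. deriv f x / 2) has_derivative (\<lambda>k. deriv (deriv f) z / 2 * k + of_real (0 / 4) * cnj k)) (at z)"
    by (rule has_derivative_eq_rhs) (auto simp: fun_eq_iff)
qed

lemma has_laplacian_minus_ln_disc:
  assumes f: "f holomorphic_on U" "open U" "z \<in> U" and im: "\<And>x. x \<in> U \<Longrightarrow> norm (f x) < R"
  shows "has_laplacian (\<lambda>x. - ln (R\<^sup>2 - (norm (f x))\<^sup>2)) z (4 * R\<^sup>2 * (norm (deriv f z))\<^sup>2 / (R\<^sup>2 - (norm (f z))\<^sup>2)\<^sup>2)"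
proof -
  define N where "N x = R\<^sup>2 - (norm (f x))\<^sup>2" for x
  have N: "N x > 0" if "x \<in> U" for x
    using im[OF that] norm_ge_zero[of "f x"] by (simp add: N_def power_strict_mono)
  define b where "b x = deriv f x * cnj (f x)" for x
  have fd: "(f has_derivative (\<lambda>k. deriv f x * k)) (at x)" if "x \<in> U" for x
    using holomorphic_derivI[OF f(1,2) that] by (simp add: has_field_derivative_def)
  have fd2: "(deriv f has_derivative (\<lambda>k. deriv (deriv f) x * k)) (at x)" if "x \<in> U" for x
    using holomorphic_derivI[OF holomorphic_deriv[OF f(1,2)] f(2) that] by (simp add: has_field_derivative_def)
  have cf: "((\<lambda>x. cnj (f x)) has_derivative (\<lambda>k. cnj (deriv f x * k))) (at x)" if "x \<in> U" for x
    by (rule bounded_linear.has_derivative[OF bounded_linear_cnj fd[OF that]])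
  have dN: "(N has_derivative (\<lambda>k. - (2 * Re (b x * k)))) (at x)" if "x \<in> U" for x
  proof -
    have "((\<lambda>x. R\<^sup>2 - Re (f x * cnj (f x))) has_derivative
        (\<lambda>k. 0 - Re (f x * cnj (deriv f x * k) + deriv f x * k * cnj (f x)))) (at x)"
      by (intro has_derivative_diff has_derivative_const has_derivative_Re has_derivative_mult fd cf that)
    moreover have "Re (y * cnj y) = (norm y)\<^sup>2" for y by (simp add: complex_mult_cnj cmod_power2)
    ultimately have "(N has_derivative (\<lambda>k. 0 - Re (f x * cnj (deriv f x * k) + deriv f x * k * cnj (f x)))) (at x)"
      unfolding N_def[abs_def] by simp
    then show ?thesis by (rule has_derivative_eq_rhs) (auto simp: fun_eq_iff b_def algebra_simps)
  qed
  define L where "L = 4 * R\<^sup>2 * (norm (deriv f z))\<^sup>2 / (N z)\<^sup>2"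
  have "has_laplacian (\<lambda>x. - ln (N x)) z L"
  proof (rule has_laplacianI[where w = "\<lambda>x. b x / of_real (N x)" and
       P = "deriv (deriv f) z * cnj (f z) / of_real (N z) + b z * b z / (of_real (N z))\<^sup>2"])
    have "\<forall>\<^sub>F x in nhds z. x \<in> U" using f by (intro eventually_nhds_in_open)
    then show "\<forall>\<^sub>F x in nhds z. ((\<lambda>x. - ln (N x)) has_derivative (\<lambda>k. 2 * Re (b x / of_real (N x) * k))) (at x)"
    proof eventually_elim
      case (elim x)
      have "((\<lambda>x. - ln (N x)) has_derivative (\<lambda>k. - (- (2 * Re (b x * k)) * inverse (N x)))) (at x)"
        using has_derivative_minus[OF has_derivative_ln[OF N[OF elim] dN[OF elim]]] by (simp add: mult.commute)
      moreover have "- (- (2 * Re (b x * k)) * inverse (N x)) = 2 * Re (b x / of_real (N x) * k)" for k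
      proof -
        have "b x / of_real (N x) * k = inverse (N x) *\<^sub>R (b x * k)" using N[OF elim] by (simp add: scaleR_conv_of_real field_simps)
        then show ?thesis by (simp only: scaleR_complex.sel mult_minus_left minus_minus) (simp only: mult_ac)
      qed
      ultimately show ?case by simp
    qed
    have nz: "complex_of_real (N z) \<noteq> 0" using N[OF f(3)] by simp
    have db: "(b has_derivative (\<lambda>k. deriv f z * cnj (deriv f z * k) + deriv (deriv f) z * k * cnj (f z))) (at z)"
      unfolding b_def[abs_def] by (intro has_derivative_mult fd2 cf f(3))
    have "((\<lambda>x. b x / of_real (N x)) has_derivative (\<lambda>k.
       - b z * (inverse (of_real (N z)) * of_real (- (2 * Re (b z * k))) * inverse (of_real (N z))) +
       (deriv f z * cnj (deriv f z * k) + deriv (deriv f) z * k * cnj (f z)) / of_real (N z))) (at z)"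
      by (rule has_derivative_divide[OF db has_derivative_of_real[OF dN[OF f(3)]] nz])
    then show "((\<lambda>x. b x / of_real (N x)) has_derivative (\<lambda>k. (deriv (deriv f) z * cnj (f z) / of_real (N z) + b z * b z / (of_real (N z))\<^sup>2) * k
       + of_real (L / 4) * cnj k)) (at z)"
    proof (rule has_derivative_eq_rhs)
      have re: "complex_of_real (- (2 * Re (b z * k))) = - (b z * k + cnj (b z) * cnj k)" for k by (simp add: complex_eq_iff)
      have R2: "complex_of_real (R\<^sup>2) = of_real (N z) + f z * cnj (f z)"
        unfolding N_def of_real_diff complex_norm_square by simp
      have "complex_of_real (L / 4) = of_real (R\<^sup>2) * (deriv f z * cnj (deriv f z)) / (of_real (N z))\<^sup>2"
        by (simp add: L_def complex_norm_square del: of_real_power) (simp add: of_real_power)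
      then have L4: "complex_of_real (L / 4) = (of_real (N z) + f z * cnj (f z)) * (deriv f z * cnj (deriv f z)) / (of_real (N z))\<^sup>2"
        unfolding R2 .
      show "(\<lambda>k. - b z * (inverse (of_real (N z)) * of_real (- (2 * Re (b z * k))) * inverse (of_real (N z))) +
       (deriv f z * cnj (deriv f z * k) + deriv (deriv f) z * k * cnj (f z)) / of_real (N z)) =
       (\<lambda>k. (deriv (deriv f) z * cnj (f z) / of_real (N z) + b z * b z / (of_real (N z))\<^sup>2) * k + of_real (L / 4) * cnj k)"
        unfolding re L4 using nz by (simp add: fun_eq_iff b_def field_simps power2_eq_square)
    qed
  qed
  then show ?thesis unfolding N_def L_def .
qed

text \<open>
  The hyperbolic metric of the disc of radius \<open>R\<close> pulls back to a metric of curvature \<open>-1\<close>: the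
  term \<open>ln (norm (deriv f x))\<close> is harmonic, being the real part of a local logarithm of \<open>deriv f\<close>.
\<close>
lemma has_laplacian_ln_disc_pullback:
  assumes f: "f holomorphic_on U" "open U" "z \<in> U" and R: "R > 0" and im: "\<And>x. x \<in> U \<Longrightarrow> norm (f x) < R"
    and nz: "deriv f z \<noteq> 0"
  shows "has_laplacian (\<lambda>x. ln (2 * R * norm (deriv f x) / (R\<^sup>2 - (norm (f x))\<^sup>2))) z
     ((2 * R * norm (deriv f z) / (R\<^sup>2 - (norm (f z))\<^sup>2))\<^sup>2)"
proof -
  have hd: "deriv f holomorphic_on U" using f by (intro holomorphic_deriv)
  have "open (U \<inter> deriv f -` (- {0}))"
    using holomorphic_on_imp_continuous_on[OF hd] f(2) by (intro continuous_open_preimage) auto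
  moreover have "z \<in> U \<inter> deriv f -` (- {0})" using f nz by auto
  ultimately obtain r where r: "r > 0" "ball z r \<subseteq> U \<inter> deriv f -` (- {0})"
    using open_contains_ball_eq by blast
  have hb: "deriv f holomorphic_on ball z r" using hd r(2) by (auto elim: holomorphic_on_subset)
  obtain l where l: "l holomorphic_on ball z r" "\<And>x. x \<in> ball z r \<Longrightarrow> deriv f x = exp (l x)"
    using convex_imp_simply_connected[OF convex_ball[of z r]] hb r(2)
    unfolding simply_connected_eq_holomorphic_log[OF open_ball] by blast
  have N: "R\<^sup>2 - (norm (f x))\<^sup>2 > 0" if "x \<in> U" for x
    using im[OF that] norm_ge_zero[of "f x"] by (simp add: power_strict_mono)
  have "has_laplacian (\<lambda>x. ln (2 * R) + (Re (l x) + - ln (R\<^sup>2 - (norm (f x))\<^sup>2))) z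
     (0 + (0 + 4 * R\<^sup>2 * (norm (deriv f z))\<^sup>2 / (R\<^sup>2 - (norm (f z))\<^sup>2)\<^sup>2))"
    using r by (intro has_laplacian_add has_laplacian_const has_laplacian_Re_holomorphic[OF l(1)]
        has_laplacian_minus_ln_disc[OF f im]) auto
  then have "has_laplacian (\<lambda>x. ln (2 * R) + (Re (l x) + - ln (R\<^sup>2 - (norm (f x))\<^sup>2))) z
     ((2 * R * norm (deriv f z) / (R\<^sup>2 - (norm (f z))\<^sup>2))\<^sup>2)"
    by (simp add: power_divide power_mult_distrib)
  then show ?thesis
  proof (rule has_laplacian_cong)
    have "\<forall>\<^sub>F x in nhds z. x \<in> ball z r" using r(1) by (rule eventually_nhds_ball)
    then show "\<forall>\<^sub>F x in nhds z. ln (2 * R) + (Re (l x) + - ln (R\<^sup>2 - (norm (f x))\<^sup>2)) =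
       ln (2 * R * norm (deriv f x) / (R\<^sup>2 - (norm (f x))\<^sup>2))"
    proof eventually_elim
      case (elim x)
      have "x \<in> U" using elim r(2) by blast
      from N[OF this] have "ln (2 * R * exp (Re (l x)) / (R\<^sup>2 - (norm (f x))\<^sup>2))
         = ln (2 * R * exp (Re (l x))) - ln (R\<^sup>2 - (norm (f x))\<^sup>2)"
        using R by (intro ln_divide_pos) auto
      also have "ln (2 * R * exp (Re (l x))) = ln (2 * R) + Re (l x)"
        using R by (subst ln_mult_pos) auto
      finally show ?case unfolding l(2)[OF elim] norm_exp_eq_Re by simp
    qed
  qed
qed

text \<open>
  Circle averages around \<open>z\<close> of \<open>ln \<mu>\<close> increase no faster with the radius than those of \<open>v\<close>, and the latter
  increase at the rate given by the Laplacian.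
\<close>
lemma SK_metric_le_at_touching:
  assumes G: "open G" "z \<in> G" and SK: "SK_metric G \<mu>" and pos: "\<mu> z > 0"
    and lap: "has_laplacian v z L" and eq: "ln (\<mu> z) = v z"
    and le: "\<forall>\<^sub>F x in nhds z. \<mu> x > 0 \<longrightarrow> ln (\<mu> x) \<le> v x"
  shows "(\<mu> z)\<^sup>2 \<le> L"
proof -
  have cont: "continuous_on G \<mu>" and SKz: "ereal ((\<mu> z)\<^sup>2) \<le> lower_laplacian (\<lambda>w. ln (\<mu> w)) z"
    using SK G(2) pos unfolding SK_metric_def by auto
  have "open (G \<inter> \<mu> -` {0<..})" using cont G(1) by (intro continuous_open_preimage) auto
  moreover have "z \<in> G \<inter> \<mu> -` {0<..}" using G pos by auto
  ultimately obtain d1 where d1: "d1 > 0" "ball z d1 \<subseteq> G \<inter> \<mu> -` {0<..}" using open_contains_ball_eq by blast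
  obtain d2 where d2: "d2 > 0" "continuous_on (ball z d2) v" using has_laplacian_continuous[OF lap] by blast
  obtain d3 where d3: "d3 > 0" "\<And>x. dist x z < d3 \<Longrightarrow> \<mu> x > 0 \<longrightarrow> ln (\<mu> x) \<le> v x"
    using le unfolding eventually_nhds_metric by blast
  define d where "d = min d1 (min d2 d3)"
  have d: "d > 0" "ball z d \<subseteq> ball z d1" "ball z d \<subseteq> ball z d2" "ball z d \<subseteq> ball z d3"
    using d1 d2 d3 by (auto simp: d_def)
  have mpos: "\<mu> x > 0" if "x \<in> ball z d" for x using d1 d that by blast
  have "continuous_on (ball z d) (\<lambda>x. ln (\<mu> x))"
    using d1 d mpos by (intro continuous_on_ln continuous_on_subset[OF cont]) (auto simp: less_imp_neq[THEN not_sym])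
  moreover have "continuous_on (ball z d) v" using d2 d continuous_on_subset by blast
  moreover have "ln (\<mu> x) \<le> v x" if "x \<in> ball z d" for x
  proof -
    have "dist x z < d3" using that d(4) by (auto simp: dist_commute d_def)
    then show ?thesis using d3(2) mpos[OF that] by blast
  qed
  ultimately have "lower_laplacian (\<lambda>x. ln (\<mu> x)) z \<le> lower_laplacian v z"
    using d(1) eq by (intro lower_laplacian_mono[of d]) auto
  also have "\<dots> = ereal L" by (rule lower_laplacian_eq[OF lap])
  finally show ?thesis using SKz by (simp add: order_trans[of "ereal ((\<mu> z)\<^sup>2)"] flip: ereal_less_eq(3))
qed

text \<open>
  Divide the pullback of \<open>\<mu>\<close> by the hyperbolic density of the disc of radius \<open>R < 1\<close>. The quotient vanishes on
  the boundary circle, so its maximum is attained inside. At the corresponding point of \<open>G\<close> a multiple of the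
  hyperbolic density, transported by a local inverse of \<open>h\<close>, touches \<open>\<mu>\<close> from above, and the curvature bound for
  \<open>\<mu>\<close> shows that the maximum is at most \<open>1\<close>. The comparison is made in \<open>G\<close> and not in the disc, because the lower
  Laplacian is an average over circles and \<open>h\<close> does not preserve circles. Finally \<open>R\<close> tends to \<open>1\<close>.
\<close>
theorem ahlfors_lemma:
  assumes G: "open G" and SK: "SK_metric G \<mu>"
    and h: "h holomorphic_on ball 0 1" "h ` ball 0 1 \<subseteq> G"
  shows "\<mu> (h 0) * norm (deriv h 0) \<le> 2"
proof -
  have mc: "continuous_on G \<mu>" and mnn: "\<And>z. z \<in> G \<Longrightarrow> \<mu> z \<ge> 0" using SK unfolding SK_metric_def by auto
  have key: "\<mu> (h 0) * norm (deriv h 0) * R \<le> 2" if R: "0 < R" "R < 1" for R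
  proof -
    have sub: "cball 0 R \<subseteq> ball (0::complex) 1" using R by auto
    define q where "q w = \<mu> (h w) * norm (deriv h w) * (R\<^sup>2 - (norm w)\<^sup>2) / (2 * R)" for w
    have "continuous_on (cball 0 R) (\<lambda>w. \<mu> (h w))"
      by (rule continuous_on_compose2[OF mc])
         (use sub h in \<open>auto intro: continuous_on_subset[OF holomorphic_on_imp_continuous_on[OF h(1)]]\<close>)
    moreover have "continuous_on (cball 0 R) (deriv h)"
      using sub holomorphic_on_imp_continuous_on[OF holomorphic_deriv[OF h(1) open_ball]] continuous_on_subset by blast
    ultimately have "continuous_on (cball 0 R) q"
      unfolding q_def[abs_def] using R by (intro continuous_intros) auto
    then obtain w0 where w0: "w0 \<in> cball 0 R" "\<And>w. w \<in> cball 0 R \<Longrightarrow> q w \<le> q w0"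
      using continuous_attains_sup[of "cball (0::complex) R" q] R by auto
    have "q w0 \<le> 1"
    proof (rule ccontr)
      assume "\<not> q w0 \<le> 1"
      then have q0: "q w0 > 1" by simp
      have "norm w0 \<noteq> R" using q0 by (auto simp: q_def)
      then have w0R: "norm w0 < R" using w0(1) by simp
      have hw0: "h w0 \<in> G" using h(2) w0R R by (auto simp: image_subset_iff)
      have nz: "deriv h w0 \<noteq> 0" using q0 by (auto simp: q_def)
      have mz: "\<mu> (h w0) > 0" using q0 mnn[OF hw0] by (cases "\<mu> (h w0) = 0") (auto simp: q_def)
      have hR: "h holomorphic_on ball 0 R" using h(1) R by (auto elim: holomorphic_on_subset)
      have w0b: "w0 \<in> ball 0 R" using w0R by simp
      obtain r k where r: "r > 0" "ball w0 r \<subseteq> ball 0 R" "inj_on h (ball w0 r)" "open (h ` ball w0 r)"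
        and k: "k holomorphic_on h ` ball w0 r" "\<And>x. x \<in> ball w0 r \<Longrightarrow> k (h x) = x"
          "\<And>x. x \<in> ball w0 r \<Longrightarrow> deriv h x * deriv k (h x) = 1"
        by (rule local_inverse[OF hR open_ball w0b nz], intro that)
      let ?V = "h ` ball w0 r"
      have zV: "h w0 \<in> ?V" using r(1) by simp
      have kim: "norm (k x) < R" if "x \<in> ?V" for x using that k(2) r(2) by auto
      have knz: "deriv k (h w0) \<noteq> 0" using k(3)[of w0] r(1) by auto
      define p where "p x = 2 * R * norm (deriv k x) / (R\<^sup>2 - (norm (k x))\<^sup>2)" for x
      have qp: "\<mu> (h x) = q x * p (h x)" and pp: "p (h x) > 0" if "x \<in> ball w0 r" for x
      proof -
        have n1: "norm (deriv h x) * norm (deriv k (h x)) = 1" using k(3)[OF that] by (metis norm_mult norm_one)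
        have xR: "norm x < R" using that r(2) by auto
        then have D: "R\<^sup>2 - (norm x)\<^sup>2 > 0" by (simp add: power_strict_mono)
        have "q x * p (h x) = \<mu> (h x) * (norm (deriv h x) * norm (deriv k (h x)))
            * ((2 * R) / (2 * R)) * ((R\<^sup>2 - (norm x)\<^sup>2) / (R\<^sup>2 - (norm x)\<^sup>2))"
          unfolding q_def p_def k(2)[OF that] by (simp only: times_divide_eq_left times_divide_eq_right mult_ac)
        then show "\<mu> (h x) = q x * p (h x)" unfolding n1 using D R xR by simp
        have "norm (deriv k (h x)) > 0" using n1 by (cases "deriv k (h x) = 0") auto
        then show "p (h x) > 0" unfolding p_def k(2)[OF that] using D R by simp
      qed
      have "has_laplacian (\<lambda>x. ln (p x)) (h w0) ((p (h w0))\<^sup>2)"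
        unfolding p_def using has_laplacian_ln_disc_pullback[OF k(1) r(4) zV R(1) kim knz] .
      from has_laplacian_add[OF has_laplacian_const this]
      have lap: "has_laplacian (\<lambda>x. ln (q w0) + ln (p x)) (h w0) ((p (h w0))\<^sup>2)" by simp
      have w0r: "w0 \<in> ball w0 r" using r(1) by simp
      have eq: "ln (\<mu> (h w0)) = ln (q w0) + ln (p (h w0))"
        unfolding qp[OF w0r] using q0 pp[OF w0r] by (simp add: ln_mult)
      have "\<forall>\<^sub>F x in nhds (h w0). x \<in> ?V" using r(4) zV by (rule eventually_nhds_in_open)
      then have le: "\<forall>\<^sub>F x in nhds (h w0). \<mu> x > 0 \<longrightarrow> ln (\<mu> x) \<le> ln (q w0) + ln (p x)"
      proof eventually_elim
        case (elim y)
        then obtain x where x: "x \<in> ball w0 r" "y = h x" by blast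
        have "q x \<le> q w0" using w0(2) x(1) r(2) by (force simp: less_imp_le)
        then have "\<mu> y \<le> q w0 * p y" using qp[OF x(1)] pp[OF x(1)] x(2) by simp
        moreover have "ln (q w0 * p y) = ln (q w0) + ln (p y)" using q0 pp[OF x(1)] x(2) by (simp add: ln_mult)
        ultimately show ?case using ln_le_cancel_iff[of "\<mu> y" "q w0 * p y"] by auto
      qed
      have "(\<mu> (h w0))\<^sup>2 \<le> (p (h w0))\<^sup>2"
        by (rule SK_metric_le_at_touching[OF G hw0 SK mz lap eq le])
      then have "\<mu> (h w0) \<le> p (h w0)" using pp[OF w0r] by (meson power2_le_imp_le less_imp_le)
      then have "q w0 * p (h w0) \<le> 1 * p (h w0)" using qp[OF w0r] by simp
      then show False using q0 pp[OF w0r] by (simp add: mult_le_cancel_right)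
    qed
    moreover have "q 0 \<le> q w0" using w0(2)[of 0] R by simp
    ultimately have "\<mu> (h 0) * norm (deriv h 0) * R\<^sup>2 / (2 * R) \<le> 1" by (simp add: q_def)
    then show ?thesis using R by (simp add: field_simps power2_eq_square)
  qed
  show ?thesis
  proof (rule ccontr)
    define X where "X = \<mu> (h 0) * norm (deriv h 0)"
    assume "\<not> ?thesis"
    then have X: "X > 2" by (simp add: X_def)
    have "X * ((1 + 2 / X) / 2) \<le> 2" unfolding X_def by (rule key) (use X in \<open>auto simp: X_def[symmetric] field_simps\<close>)
    then show False using X by (simp add: field_simps)
  qed
qed

section \<open>Extending holomorphic functions across a circle\<close>

lemma deriv_eq_on_open:
  assumes "open V" "z \<in> V" "\<And>x. x \<in> V \<Longrightarrow> f x = g x"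
  shows "deriv f z = deriv g z"
proof (rule deriv_cong_ev[OF _ refl])
  have "\<forall>\<^sub>F x in nhds z. x \<in> V" using assms by (intro eventually_nhds_in_open)
  then show "\<forall>\<^sub>F x in nhds z. f x = g x" by eventually_elim (rule assms(3))
qed

lemma field_differentiable_eq_on_open:
  assumes "f field_differentiable (at z)" "open V" "z \<in> V" "\<And>x. x \<in> V \<Longrightarrow> g x = f x"
  shows "g field_differentiable (at z)"
proof -
  obtain D where "(f has_field_derivative D) (at z)" using assms(1) unfolding field_differentiable_def by blast
  then have "(g has_field_derivative D) (at z)"
    by (rule has_field_derivative_transform_within_open[OF _ assms(2,3)]) (simp add: assms(4))
  then show ?thesis unfolding field_differentiable_def by blast
qed

text \<open>
  If two of the balls around points of the circle overlap, then they have a point of the segment between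
  their centres in common. By strict convexity that point lies in \<open>ball 0 R\<close>, so the two local extensions agree
  on the overlap by the identity theorem, and all of them fit together. Compactness of the closed disc gives
  \<open>R'\<close>. The predicate \<open>\<Phi>\<close> transports pointwise conditions on the value and the derivative.
\<close>
lemma holomorphic_extension_past_circle:
  fixes h :: "complex \<Rightarrow> complex" and \<Phi> :: "complex \<Rightarrow> complex \<Rightarrow> complex \<Rightarrow> bool"
  assumes R: "R > 0" and h: "h holomorphic_on ball 0 R" and \<Phi>: "\<And>w. w \<in> ball 0 R \<Longrightarrow> \<Phi> w (h w) (deriv h w)"
    and loc: "\<And>\<zeta>. norm \<zeta> = R \<Longrightarrow> \<exists>\<delta>>0. \<exists>k. k holomorphic_on ball \<zeta> \<delta> \<and>
       (\<forall>w\<in>ball \<zeta> \<delta> \<inter> ball 0 R. k w = h w) \<and> (\<forall>w\<in>ball \<zeta> \<delta>. \<Phi> w (k w) (deriv k w))"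
  shows "\<exists>R'>R. \<exists>H. H holomorphic_on ball 0 R' \<and> (\<forall>w\<in>ball 0 R. H w = h w) \<and> (\<forall>w\<in>ball 0 R'. \<Phi> w (H w) (deriv H w))"
proof -
  have "\<forall>\<zeta>\<in>sphere 0 R. \<exists>p. fst p > 0 \<and> snd p holomorphic_on ball \<zeta> (fst p) \<and>
       (\<forall>w\<in>ball \<zeta> (fst p) \<inter> ball 0 R. snd p w = h w) \<and> (\<forall>w\<in>ball \<zeta> (fst p). \<Phi> w (snd p w) (deriv (snd p) w))"
  proof
    fix \<zeta> :: complex assume "\<zeta> \<in> sphere 0 R"
    then have "norm \<zeta> = R" by simp
    from loc[OF this] obtain \<delta> k where dk: "\<delta> > 0" "k holomorphic_on ball \<zeta> \<delta>"
       "\<forall>w\<in>ball \<zeta> \<delta> \<inter> ball 0 R. k w = h w" "\<forall>w\<in>ball \<zeta> \<delta>. \<Phi> w (k w) (deriv k w)" by blast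
    show "\<exists>p. fst p > 0 \<and> snd p holomorphic_on ball \<zeta> (fst p) \<and>
       (\<forall>w\<in>ball \<zeta> (fst p) \<inter> ball 0 R. snd p w = h w) \<and> (\<forall>w\<in>ball \<zeta> (fst p). \<Phi> w (snd p w) (deriv (snd p) w))"
      by (rule exI[of _ "(\<delta>, k)"]) (use dk in simp)
  qed
  from bchoice[OF this] obtain p where p0: "\<forall>\<zeta>\<in>sphere 0 R. fst (p \<zeta>) > 0 \<and> snd (p \<zeta>) holomorphic_on ball \<zeta> (fst (p \<zeta>)) \<and>
       (\<forall>w\<in>ball \<zeta> (fst (p \<zeta>)) \<inter> ball 0 R. snd (p \<zeta>) w = h w) \<and>
       (\<forall>w\<in>ball \<zeta> (fst (p \<zeta>)). \<Phi> w (snd (p \<zeta>) w) (deriv (snd (p \<zeta>)) w))" ..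
  note p = bspec[OF p0]
  define B where "B \<zeta> = ball \<zeta> (fst (p \<zeta>))" for \<zeta>
  define k where "k \<zeta> = snd (p \<zeta>)" for \<zeta>
  have Bp: "\<zeta> \<in> B \<zeta>" "open (B \<zeta>)" and kh: "k \<zeta> holomorphic_on B \<zeta>"
    and keq: "\<And>w. w \<in> B \<zeta> \<Longrightarrow> w \<in> ball 0 R \<Longrightarrow> k \<zeta> w = h w"
    and k\<Phi>: "\<And>w. w \<in> B \<zeta> \<Longrightarrow> \<Phi> w (k \<zeta> w) (deriv (k \<zeta>) w)" if "\<zeta> \<in> sphere 0 R" for \<zeta>
    using p[OF that] unfolding B_def k_def by auto
  have compat: "k \<zeta> w = k \<xi> w" if "\<zeta> \<in> sphere 0 R" "\<xi> \<in> sphere 0 R" "w \<in> B \<zeta>" "w \<in> B \<xi>" for \<zeta> \<xi> w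
  proof (cases "\<zeta> = \<xi>")
    case False
    define D where "D = dist \<zeta> \<xi>"
    define d1 where "d1 = fst (p \<zeta>)"
    define d2 where "d2 = fst (p \<xi>)"
    have pos: "d1 > 0" "d2 > 0" "D > 0" using p that False by (auto simp: d1_def d2_def D_def)
    have lt: "D < d1 + d2" using that(3,4) dist_triangle[of \<zeta> \<xi> w]
      unfolding B_def D_def d1_def d2_def by (simp add: dist_commute)
    \<comment> \<open>The segment between the centres is divided in the ratio of the radii.\<close>
    define s where "s = d1 / (d1 + d2)"
    have s: "0 < s" "s < 1" "s * D < d1" "(1 - s) * D < d2"
      using pos lt mult_strict_left_mono[OF lt, of d1] mult_strict_left_mono[OF lt, of d2]
      by (auto simp: s_def field_simps add_pos_pos)
    define q where "q = (1 - s) *\<^sub>R \<zeta> + s *\<^sub>R \<xi>"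
    have "q \<in> open_segment \<zeta> \<xi>" using s False unfolding q_def in_segment by blast
    from dist_decreases_open_segment[OF this, of 0] have "q \<in> ball 0 R" using that(1,2) by auto
    moreover have "q \<in> B \<zeta>"
    proof -
      have "\<zeta> - q = s *\<^sub>R (\<zeta> - \<xi>)" by (simp add: q_def algebra_simps)
      then have "dist \<zeta> q = s * D" using s by (simp add: dist_norm D_def)
      then show ?thesis using s(3) by (simp add: B_def d1_def)
    qed
    moreover have "q \<in> B \<xi>"
    proof -
      have "\<xi> - q = (1 - s) *\<^sub>R (\<xi> - \<zeta>)" by (simp add: q_def algebra_simps)
      then have "dist \<xi> q = (1 - s) * D" using s by (simp add: dist_norm D_def norm_minus_commute)
      then show ?thesis using s(4) by (simp add: B_def d2_def)
    qed
    ultimately have ne: "B \<zeta> \<inter> B \<xi> \<inter> ball 0 R \<noteq> {}" by blast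
    show ?thesis
    proof (rule analytic_continuation_open[of "B \<zeta> \<inter> B \<xi> \<inter> ball 0 R" "B \<zeta> \<inter> B \<xi>" "k \<zeta>" "k \<xi>"])
      show "connected (B \<zeta> \<inter> B \<xi>)" unfolding B_def by (intro convex_connected convex_Int convex_ball)
      show "k \<zeta> holomorphic_on B \<zeta> \<inter> B \<xi>" "k \<xi> holomorphic_on B \<zeta> \<inter> B \<xi>"
        using holomorphic_on_subset[OF kh[OF that(1)], of "B \<zeta> \<inter> B \<xi>"] holomorphic_on_subset[OF kh[OF that(2)], of "B \<zeta> \<inter> B \<xi>"]
        by simp_all
    qed (use ne that Bp keq in \<open>auto intro!: open_Int\<close>)
  qed simp
  define H where "H w = (if w \<in> ball 0 R then h w else k (SOME \<zeta>. \<zeta> \<in> sphere 0 R \<and> w \<in> B \<zeta>) w)" for w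
  have Hk: "H w = k \<zeta> w" if "\<zeta> \<in> sphere 0 R" "w \<in> B \<zeta>" for w \<zeta>
  proof (cases "w \<in> ball 0 R")
    case True then show ?thesis using keq that by (simp add: H_def)
  next
    case False
    define \<xi> where "\<xi> = (SOME \<zeta>. \<zeta> \<in> sphere 0 R \<and> w \<in> B \<zeta>)"
    have "\<xi> \<in> sphere 0 R \<and> w \<in> B \<xi>"
      unfolding \<xi>_def by (rule someI[of "\<lambda>\<zeta>. \<zeta> \<in> sphere 0 R \<and> w \<in> B \<zeta>"]) (use that in simp)
    then have \<xi>: "\<xi> \<in> sphere 0 R" "w \<in> B \<xi>" by auto
    have "H w = k \<xi> w" unfolding H_def \<xi>_def by (rule if_not_P[OF False])
    also have "\<dots> = k \<zeta> w" by (rule compat[OF \<xi>(1) that(1) \<xi>(2) that(2)])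
    finally show ?thesis .
  qed
  have Hh: "H w = h w" if "w \<in> ball 0 R" for w using that by (simp add: H_def)
  define U where "U = ball 0 R \<union> (\<Union>\<zeta>\<in>sphere 0 R. B \<zeta>)"
  have HU: "H field_differentiable (at w) \<and> \<Phi> w (H w) (deriv H w)" if w: "w \<in> U" for w
  proof -
    consider "w \<in> ball 0 R" | \<zeta> where "\<zeta> \<in> sphere 0 R" "w \<in> B \<zeta>" using w unfolding U_def by blast
    then show ?thesis
    proof cases
      case 1
      have "h field_differentiable (at w)" by (rule holomorphic_on_imp_differentiable_at[OF h open_ball 1])
      then have "H field_differentiable (at w)"
        by (rule field_differentiable_eq_on_open[OF _ open_ball 1 Hh])
      moreover have "deriv H w = deriv h w" using deriv_eq_on_open[OF open_ball 1 Hh] .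
      ultimately show ?thesis using \<Phi>[OF 1] Hh[OF 1] by simp
    next
      case 2
      have "k \<zeta> field_differentiable (at w)"
        by (rule holomorphic_on_imp_differentiable_at[OF kh[OF 2(1)] Bp(2)[OF 2(1)] 2(2)])
      then have "H field_differentiable (at w)"
        by (rule field_differentiable_eq_on_open[OF _ Bp(2)[OF 2(1)] 2(2) Hk[OF 2(1)]])
      moreover have "deriv H w = deriv (k \<zeta>) w" using deriv_eq_on_open[OF Bp(2)[OF 2(1)] 2(2) Hk[OF 2(1)]] .
      ultimately show ?thesis using k\<Phi>[OF 2] Hk[OF 2] by simp
    qed
  qed
  have "open U" unfolding U_def using Bp(2) by (intro open_Un open_UN open_ball) simp
  moreover have "cball 0 R \<subseteq> U"
  proof
    fix x :: complex assume "x \<in> cball 0 R"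
    then show "x \<in> U" unfolding U_def using Bp(1)[of x] by (cases "norm x = R") auto
  qed
  ultimately obtain e where e: "e > 0" "(\<Union>x\<in>cball 0 R. cball x e) \<subseteq> U"
    using compact_subset_open_imp_cball_epsilon_subset[OF compact_cball] by metis
  have sub: "ball 0 (R + e) \<subseteq> U"
  proof
    fix w :: complex assume w: "w \<in> ball 0 (R + e)"
    show "w \<in> U"
    proof (cases "norm w \<le> R")
      case True then show ?thesis using \<open>cball 0 R \<subseteq> U\<close> by auto
    next
      case False
      define x where "x = (R / norm w) *\<^sub>R w"
      have w0: "norm w > 0" using False R by linarith
      then have "norm x = R" using R by (simp add: x_def)
      moreover have "w - x = (1 - R / norm w) *\<^sub>R w" by (simp add: x_def algebra_simps)
      then have "norm (w - x) = (1 - R / norm w) * norm w" using False R w0 by (simp add: abs_of_nonneg)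
      then have "norm (w - x) = norm w - R" using w0 by (simp add: left_diff_distrib)
      then have "dist x w \<le> e" using w by (simp add: dist_norm norm_minus_commute)
      ultimately show ?thesis using e(2) by fastforce
    qed
  qed
  have "H holomorphic_on ball 0 (R + e)"
    using HU sub by (auto simp: holomorphic_on_def intro: field_differentiable_at_within)
  then show ?thesis using e(1) HU sub Hh by (intro exI[of _ "R + e"] conjI exI[of _ H]) auto
qed

text \<open>
  Extensions to two discs agree on the smaller one, so they patch together to an extension to the disc with
  the supremal radius. If this radius were less than \<open>1\<close>, the function would extend past its circle.
\<close>
lemma holomorphic_extension_to_disc:
  fixes g :: "complex \<Rightarrow> complex" and \<Phi> :: "complex \<Rightarrow> complex \<Rightarrow> complex \<Rightarrow> bool"
  assumes r: "0 < r" "r \<le> 1" and g: "g holomorphic_on ball 0 r" "\<And>w. w \<in> ball 0 r \<Longrightarrow> \<Phi> w (g w) (deriv g w)"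
    and step: "\<And>R h \<zeta>. \<lbrakk>r \<le> R; R < 1; h holomorphic_on ball 0 R; \<And>w. w \<in> ball 0 r \<Longrightarrow> h w = g w;
        \<And>w. w \<in> ball 0 R \<Longrightarrow> \<Phi> w (h w) (deriv h w); norm \<zeta> = R\<rbrakk> \<Longrightarrow>
       \<exists>\<delta>>0. \<exists>k. k holomorphic_on ball \<zeta> \<delta> \<and>
       (\<forall>w\<in>ball \<zeta> \<delta> \<inter> ball 0 R. k w = h w) \<and> (\<forall>w\<in>ball \<zeta> \<delta>. \<Phi> w (k w) (deriv k w))"
  shows "\<exists>H. H holomorphic_on ball 0 1 \<and> (\<forall>w\<in>ball 0 r. H w = g w) \<and> (\<forall>w\<in>ball 0 1. \<Phi> w (H w) (deriv H w))"
proof -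
  define P where "P R h \<longleftrightarrow> h holomorphic_on ball 0 R \<and> (\<forall>w\<in>ball 0 r. h w = g w) \<and>
     (\<forall>w\<in>ball 0 R. \<Phi> w (h w) (deriv h w))" for R h
  define S where "S = {R. r \<le> R \<and> R \<le> 1 \<and> (\<exists>h. P R h)}"
  have rS: "r \<in> S" using g r unfolding S_def P_def by auto
  define h where "h R = (SOME h. P R h)" for R
  have hP: "P R (h R)" if "R \<in> S" for R
  proof -
    obtain h' where "P R h'" using \<open>R \<in> S\<close> unfolding S_def by blast
    then show ?thesis unfolding h_def using someI[of "P R" h'] by simp
  qed
  have agree: "h R w = h R' w" if "R \<in> S" "R' \<in> S" "R \<le> R'" "w \<in> ball 0 R" for R R' w
  proof (rule analytic_continuation_open[of "ball 0 r" "ball 0 R" "h R" "h R'"])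
    show "h R holomorphic_on ball 0 R" "h R' holomorphic_on ball 0 R"
      using hP[OF that(1)] hP[OF that(2)] that(3) unfolding P_def by (auto elim: holomorphic_on_subset)
    show "ball 0 r \<subseteq> ball (0::complex) R" using that(1) by (auto simp: S_def)
  qed (use hP[OF that(1)] hP[OF that(2)] r that in \<open>auto simp: P_def\<close>)
  have bdd: "bdd_above S" unfolding S_def by (rule bdd_aboveI[of _ 1]) auto
  define M where "M = Sup S"
  have M: "r \<le> M" "M \<le> 1"
    unfolding M_def using rS bdd by (auto intro: cSup_upper cSup_least simp: S_def)
  define H where "H w = h (SOME R. R \<in> S \<and> norm w < R) w" for w
  have Hh: "H w = h R w" if "R \<in> S" "w \<in> ball 0 R" for w R
  proof -
    define R' where "R' = (SOME R. R \<in> S \<and> norm w < R)"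
    have "R' \<in> S \<and> norm w < R'" unfolding R'_def using that by (intro someI[of "\<lambda>R. R \<in> S \<and> norm w < R" R]) auto
    then have R': "R' \<in> S" "w \<in> ball 0 R'" by auto
    have "h R' w = h R w"
    proof (cases "R \<le> R'")
      case True
      from agree[OF that(1) R'(1) True that(2)] show ?thesis by simp
    next
      case False
      then have "R' \<le> R" by simp
      from agree[OF R'(1) that(1) this R'(2)] show ?thesis .
    qed
    then show ?thesis unfolding H_def R'_def[symmetric] .
  qed
  have cover: "\<exists>R\<in>S. w \<in> ball 0 R" if "w \<in> ball 0 M" for w :: complex
    using that rS bdd less_cSup_iff[of S "norm w"] unfolding M_def by auto
  have HM: "P M H"
  proof -
    have "H field_differentiable (at w) \<and> \<Phi> w (H w) (deriv H w)" if w: "w \<in> ball 0 M" for w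
    proof -
      obtain R where R: "R \<in> S" "w \<in> ball 0 R" using cover[OF w] by blast
      have PR: "P R (h R)" by (rule hP[OF R(1)])
      have "h R field_differentiable (at w)" 
        using PR unfolding P_def by (rule conjE) (rule holomorphic_on_imp_differentiable_at[OF _ open_ball R(2)])
      then have "H field_differentiable (at w)"
        by (rule field_differentiable_eq_on_open[OF _ open_ball R(2) Hh[OF R(1)]])
      moreover have "deriv H w = deriv (h R) w" using deriv_eq_on_open[OF open_ball R(2) Hh[OF R(1)]] .
      ultimately show ?thesis using PR R Hh[OF R] unfolding P_def by simp
    qed
    moreover have "H w = g w" if "w \<in> ball 0 r" for w
      using Hh[OF rS that] hP[OF rS] that unfolding P_def by simp
    ultimately show ?thesis unfolding P_def
      by (auto simp: holomorphic_on_def intro: field_differentiable_at_within)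
  qed
  have "M = 1"
  proof (rule ccontr)
    assume "M \<noteq> 1"
    then have M1: "M < 1" using M by simp
    have Hhol: "H holomorphic_on ball 0 M" and Hg: "\<And>w. w \<in> ball 0 r \<Longrightarrow> H w = g w"
      and H\<Phi>: "\<And>w. w \<in> ball 0 M \<Longrightarrow> \<Phi> w (H w) (deriv H w)" using HM unfolding P_def by auto
    have "0 < M" using M r by simp
    from holomorphic_extension_past_circle[OF this Hhol, of \<Phi>, OF H\<Phi> step[OF M(1) M1 Hhol Hg H\<Phi>]]
    obtain R' H' where R': "R' > M" "H' holomorphic_on ball 0 R'" "\<forall>w\<in>ball 0 M. H' w = H w"
       "\<forall>w\<in>ball 0 R'. \<Phi> w (H' w) (deriv H' w)" by blast
    define R where "R = min R' 1"
    have "P R H'" unfolding P_def using R' Hg M by (auto simp: R_def elim: holomorphic_on_subset)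
    then have "R \<in> S" using R' M M1 by (auto simp: S_def R_def)
    then have "R \<le> M" unfolding M_def using bdd by (rule cSup_upper)
    then show False using R' M1 by (simp add: R_def min_def split: if_splits)
  qed
  then show ?thesis using HM unfolding P_def by blast
qed

section \<open>Isometries into a complete metric\<close>

text \<open>
  If no such \<open>K\<close> existed, there would be points of bounded distance outside each set of a compact exhaustion of
  \<open>G\<close>, and these points would leave every compact set.
\<close>
lemma complete_imp_bounded_distance_compact:
  assumes "open G" and "complete_conformal_metric G lam"
  obtains z0 where "z0 \<in> G"
    "\<And>M. \<exists>K. compact K \<and> K \<subseteq> G \<and> (\<forall>z\<in>G. metric_dist G lam z z0 \<le> ennreal M \<longrightarrow> z \<in> K)"
proof -
  obtain z0 where z0: "z0 \<in> G" and seq: "\<And>zs :: nat \<Rightarrow> complex. \<lbrakk>\<forall>n. zs n \<in> G;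
        \<forall>K. compact K \<and> K \<subseteq> G \<longrightarrow> (\<forall>\<^sub>F n in sequentially. zs n \<notin> K)\<rbrakk> \<Longrightarrow>
        (\<lambda>n. metric_dist G lam (zs n) z0) \<longlonglongrightarrow> top"
    using assms(2) unfolding complete_conformal_metric_def by blast
  obtain C :: "nat \<Rightarrow> complex set" where C: "\<And>n. compact (C n)" "\<And>n. C n \<subseteq> G"
      "\<And>n. C n \<subseteq> interior (C (Suc n))" "\<Union> (range C) = G"
      "\<And>K. \<lbrakk>compact K; K \<subseteq> G\<rbrakk> \<Longrightarrow> \<exists>N. \<forall>n\<ge>N. K \<subseteq> C n"
    by (rule open_Union_compact_subsets[OF assms(1)], intro that)
  have "\<exists>K. compact K \<and> K \<subseteq> G \<and> (\<forall>z\<in>G. metric_dist G lam z z0 \<le> ennreal M \<longrightarrow> z \<in> K)" for M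
  proof (rule ccontr)
    assume "\<nexists>K. compact K \<and> K \<subseteq> G \<and> (\<forall>z\<in>G. metric_dist G lam z z0 \<le> ennreal M \<longrightarrow> z \<in> K)"
    then have "\<forall>n. \<exists>z. z \<in> G \<and> metric_dist G lam z z0 \<le> ennreal M \<and> z \<notin> C n" using C(1,2) by blast
    then obtain zs where zs: "\<And>n. zs n \<in> G" "\<And>n. metric_dist G lam (zs n) z0 \<le> ennreal M" "\<And>n. zs n \<notin> C n"
      by metis
    have "(\<lambda>n. metric_dist G lam (zs n) z0) \<longlonglongrightarrow> top"
    proof (rule seq)
      show "\<forall>K. compact K \<and> K \<subseteq> G \<longrightarrow> (\<forall>\<^sub>F n in sequentially. zs n \<notin> K)"
      proof (intro allI impI)
        fix K assume K: "compact K \<and> K \<subseteq> G"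
        then obtain N where N: "\<forall>n\<ge>N. K \<subseteq> C n" using C(5)[of K] by auto
        show "\<forall>\<^sub>F n in sequentially. zs n \<notin> K"
        proof (rule eventually_sequentiallyI[of N])
          fix n assume "N \<le> n"
          then have "K \<subseteq> C n" using N by simp
          then show "zs n \<notin> K" using zs(3)[of n] by (rule contra_subsetD)
        qed
      qed
    qed (use zs in simp)
    then have "\<forall>\<^sub>F n in sequentially. ennreal M < metric_dist G lam (zs n) z0"
      by (rule order_tendstoD) simp
    then obtain n where "ennreal M < metric_dist G lam (zs n) z0"
      unfolding eventually_sequentially by blast
    with zs(2)[of n] show False by simp
  qed
  with z0 show thesis by (rule that)
qed

text \<open>
  Bounds for the speed, in place of bounds for the length, pass to the concatenation: there the speed is
  doubled, and finitely many parameters do not contribute to the integral.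
\<close>
lemma metric_dist_le_join:
  fixes \<gamma>1 \<gamma>2 :: "real \<Rightarrow> complex"
  assumes "valid_path \<gamma>1" "valid_path \<gamma>2" "path_image \<gamma>1 \<subseteq> G" "path_image \<gamma>2 \<subseteq> G" "pathfinish \<gamma>1 = pathstart \<gamma>2"
    and d1: "\<And>t. \<lbrakk>0 < t; t < 1\<rbrakk> \<Longrightarrow> \<exists>d. (\<gamma>1 has_vector_derivative d) (at t) \<and> lam (\<gamma>1 t) * norm d \<le> C"
    and d2: "\<And>t. \<lbrakk>0 < t; t < 1\<rbrakk> \<Longrightarrow> \<exists>d. (\<gamma>2 has_vector_derivative d) (at t) \<and> lam (\<gamma>2 t) * norm d \<le> C"
  shows "metric_dist G lam (pathstart \<gamma>1) (pathfinish \<gamma>2) \<le> ennreal (2 * C)"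
proof -
  let ?\<gamma> = "\<gamma>1 +++ \<gamma>2"
  have b: "lam (?\<gamma> t) * norm (vector_derivative ?\<gamma> (at t within {0..1})) \<le> 2 * C"
    if t: "t \<in> {0..1}" "t \<noteq> 0" "t \<noteq> 1 / 2" "t \<noteq> 1" for t
  proof (cases "t < 1 / 2")
    case True
    obtain d where d: "(\<gamma>1 has_vector_derivative d) (at (2 * t))" "lam (\<gamma>1 (2 * t)) * norm d \<le> C"
      using d1[of "2 * t"] True t by auto
    have "((\<lambda>x. \<gamma>1 (2 * x)) has_vector_derivative 2 *\<^sub>R d) (at t)"
    proof -
      have "((\<lambda>x. 2 * x) has_vector_derivative 2) (at t)"
        by (auto simp flip: has_real_derivative_iff_has_vector_derivative intro!: derivative_eq_intros)
      from vector_diff_chain_at[OF this d(1)] show ?thesis by (simp add: o_def)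
    qed
    then have "(?\<gamma> has_vector_derivative 2 *\<^sub>R d) (at t)"
      by (rule has_vector_derivative_transform_within_open[of _ _ _ "{0<..<1/2}"]) (use True t in \<open>auto simp: joinpaths_def\<close>)
    then have "vector_derivative ?\<gamma> (at t within {0..1}) = 2 *\<^sub>R d"
      using t by (intro vector_derivative_at_within_ivl) auto
    then show ?thesis using d(2) True by (simp add: joinpaths_def)
  next
    case False
    obtain d where d: "(\<gamma>2 has_vector_derivative d) (at (2 * t - 1))" "lam (\<gamma>2 (2 * t - 1)) * norm d \<le> C"
      using d2[of "2 * t - 1"] False t by auto
    have "((\<lambda>x. \<gamma>2 (2 * x - 1)) has_vector_derivative 2 *\<^sub>R d) (at t)"
    proof -
      have "((\<lambda>x. 2 * x - 1) has_vector_derivative 2) (at t)"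
        by (auto simp flip: has_real_derivative_iff_has_vector_derivative intro!: derivative_eq_intros)
      from vector_diff_chain_at[OF this d(1)] show ?thesis by (simp add: o_def)
    qed
    then have "(?\<gamma> has_vector_derivative 2 *\<^sub>R d) (at t)"
      by (rule has_vector_derivative_transform_within_open[of _ _ _ "{1/2<..<1}"]) (use False t in \<open>auto simp: joinpaths_def\<close>)
    then have "vector_derivative ?\<gamma> (at t within {0..1}) = 2 *\<^sub>R d"
      using t by (intro vector_derivative_at_within_ivl) auto
    then show ?thesis using d(2) False t by (simp add: joinpaths_def)
  qed
  have "valid_path ?\<gamma>" using assms by (intro valid_path_join)
  moreover have "path_image ?\<gamma> \<subseteq> G" using assms by (simp add: path_image_join)
  ultimately have "metric_dist G lam (pathstart \<gamma>1) (pathfinish \<gamma>2) \<le> metric_length lam ?\<gamma>"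
    unfolding metric_dist_def by (intro INF_lower) simp
  also have "\<dots> \<le> (\<integral>\<^sup>+ t\<in>{0..1::real}. ennreal (2 * C) \<partial>lborel)"
    unfolding metric_length_def
  proof (rule nn_integral_mono_AE)
    have "AE t in lborel. t \<noteq> (0::real)" "AE t in lborel. t \<noteq> (1/2::real)" "AE t in lborel. t \<noteq> (1::real)"
      by (rule AE_lborel_singleton)+
    then show "AE t in lborel. ennreal (lam (?\<gamma> t) * norm (vector_derivative ?\<gamma> (at t within {0..1}))) * indicator {0..1} t
       \<le> ennreal (2 * C) * indicator {0..1} t"
    proof eventually_elim
      case (elim t)
      then show ?case using b[of t] by (cases "t \<in> {0..1}") (auto intro!: ennreal_leI)
    qed
  qed
  also have "\<dots> = ennreal (2 * C)" by (simp add: nn_integral_cmult)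
  finally show ?thesis .
qed

lemma polynomial_path_bounded_speed:
  fixes lam :: "complex \<Rightarrow> real"
  assumes G: "open G" "connected G" "a \<in> G" "b \<in> G" and cont: "continuous_on G lam"
  obtains \<gamma> C where "valid_path \<gamma>" "path_image \<gamma> \<subseteq> G" "pathstart \<gamma> = a" "pathfinish \<gamma> = b"
    "\<And>t. \<lbrakk>0 < t; t < 1\<rbrakk> \<Longrightarrow> \<exists>d. (\<gamma> has_vector_derivative d) (at t) \<and> lam (\<gamma> t) * norm d \<le> C"
proof -
  obtain \<gamma> :: "real \<Rightarrow> complex" where g: "polynomial_function \<gamma>" "path_image \<gamma> \<subseteq> G" "pathstart \<gamma> = a" "pathfinish \<gamma> = b"
    using connected_open_polynomial_connected[OF G] by blast
  obtain d where d: "polynomial_function d" "\<And>x. (\<gamma> has_vector_derivative d x) (at x)"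
    by (rule has_vector_derivative_polynomial_function[OF g(1)], intro that)
  have "continuous_on {0..1} (\<lambda>t. lam (\<gamma> t))"
    by (rule continuous_on_compose2[OF cont continuous_on_polymonial_function[OF g(1)]])
       (use g(2) in \<open>auto simp: path_image_def\<close>)
  then have "continuous_on {0..1} (\<lambda>t. lam (\<gamma> t) * norm (d t))"
    using continuous_on_polymonial_function[OF d(1)] by (intro continuous_on_mult continuous_on_norm) auto
  then have "bounded ((\<lambda>t. lam (\<gamma> t) * norm (d t)) ` {0..1})"
    by (intro compact_imp_bounded compact_continuous_image) auto
  then obtain C where C: "\<And>t. t \<in> {0..1} \<Longrightarrow> norm (lam (\<gamma> t) * norm (d t)) \<le> C"
    unfolding bounded_iff by blast
  have "\<exists>d. (\<gamma> has_vector_derivative d) (at t) \<and> lam (\<gamma> t) * norm d \<le> C" if "0 < t" "t < 1" for t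
    using d(2)[of t] C[of t] that by (intro exI[of _ "d t"]) auto
  with g valid_path_polynomial_function[OF g(1)] show thesis by (intro that[of \<gamma> C])
qed

text \<open>
  The image of a radius under the isometry has speed at most \<open>2 / (1 - R\<^sup>2)\<close>, so all points of the image have
  bounded distance from the base point of completeness.
\<close>
lemma complete_isometry_image_compact:
  assumes G: "open G" "connected G" and reg: "regular_conformal_metric G lam"
    and complete: "complete_conformal_metric G lam"
    and R: "0 < R" "R < 1" and h: "h holomorphic_on ball 0 R"
    and iso: "\<And>w. w \<in> ball 0 R \<Longrightarrow> h w \<in> G \<and> lam (h w) * norm (deriv h w) = 2 / (1 - (norm w)\<^sup>2)"
  obtains K where "compact K" "K \<subseteq> G" "h ` ball 0 R \<subseteq> K"
proof -
  obtain z0 where z0: "z0 \<in> G"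
    "\<And>M. \<exists>K. compact K \<and> K \<subseteq> G \<and> (\<forall>z\<in>G. metric_dist G lam z z0 \<le> ennreal M \<longrightarrow> z \<in> K)"
    using complete_imp_bounded_distance_compact[OF G(1) complete] by blast
  have h0: "h 0 \<in> G" using iso[of 0] R by simp
  obtain \<gamma>2 C2 where g2: "valid_path \<gamma>2" "path_image \<gamma>2 \<subseteq> G" "pathstart \<gamma>2 = h 0" "pathfinish \<gamma>2 = z0"
    "\<And>t. \<lbrakk>0 < t; t < 1\<rbrakk> \<Longrightarrow> \<exists>d. (\<gamma>2 has_vector_derivative d) (at t) \<and> lam (\<gamma>2 t) * norm d \<le> C2"
    by (rule polynomial_path_bounded_speed[OF G h0 z0(1) regular_conformal_metric_continuous[OF reg]], intro that)
  define C where "C = max C2 (2 / (1 - R\<^sup>2))"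
  have R2: "R\<^sup>2 < 1" using R by (simp add: power_less_one_iff)
  have dist: "metric_dist G lam (h w) z0 \<le> ennreal (2 * C)" if w: "w \<in> ball 0 R" for w
  proof -
    define \<gamma>1 where "\<gamma>1 = h \<circ> linepath w 0"
    have seg: "path_image (linepath w 0) \<subseteq> ball 0 R"
      using w R by (simp add: closed_segment_subset)
    have "valid_path \<gamma>1" unfolding \<gamma>1_def by (rule valid_path_compose_holomorphic[OF _ h open_ball seg]) simp
    moreover have "path_image \<gamma>1 \<subseteq> G" unfolding \<gamma>1_def path_image_compose using seg iso by blast
    moreover have "\<exists>d. (\<gamma>1 has_vector_derivative d) (at t) \<and> lam (\<gamma>1 t) * norm d \<le> C" if t: "0 < t" "t < 1" for t
    proof -
      define x where "x = linepath w 0 t"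
      have x: "x \<in> ball 0 R" using seg t unfolding x_def path_image_def by (auto simp: image_subset_iff)
      have "(h has_field_derivative deriv h x) (at x)" by (rule holomorphic_derivI[OF h open_ball x])
      then have "(\<gamma>1 has_vector_derivative (0 - w) * deriv h x) (at t)"
        unfolding \<gamma>1_def x_def using field_vector_diff_chain_at[OF has_vector_derivative_linepath_within[of w 0 t UNIV]] by simp
      moreover have "lam (\<gamma>1 t) * norm ((0 - w) * deriv h x) \<le> C"
      proof -
        have xR: "(norm x)\<^sup>2 \<le> R\<^sup>2" using x R by (intro power_mono) auto
        have "lam (\<gamma>1 t) * norm ((0 - w) * deriv h x) = norm w * (lam (h x) * norm (deriv h x))"
          by (simp add: \<gamma>1_def x_def norm_mult)
        also have "\<dots> = norm w * (2 / (1 - (norm x)\<^sup>2))" using iso[OF x] by simp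
        also have "\<dots> \<le> 1 * (2 / (1 - R\<^sup>2))"
        proof (intro mult_mono divide_left_mono)
          show "0 < (1 - (norm x)\<^sup>2) * (1 - R\<^sup>2)" using xR R2 by (intro mult_pos_pos) linarith+
          show "0 \<le> 2 / (1 - (norm x)\<^sup>2)" using xR R2 by (intro divide_nonneg_nonneg) linarith+
        qed (use w R xR in auto)
        also have "\<dots> \<le> C" by (simp add: C_def)
        finally show ?thesis .
      qed
      ultimately show ?thesis by blast
    qed
    moreover have "\<exists>d. (\<gamma>2 has_vector_derivative d) (at t) \<and> lam (\<gamma>2 t) * norm d \<le> C" if t: "0 < t" "t < 1" for t
    proof -
      obtain d where "(\<gamma>2 has_vector_derivative d) (at t)" "lam (\<gamma>2 t) * norm d \<le> C2" using g2(5)[OF t] by blast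
      then show ?thesis by (intro exI[of _ d]) (auto simp: C_def)
    qed
    moreover have "pathfinish \<gamma>1 = pathstart \<gamma>2" using g2(3) by (simp add: \<gamma>1_def pathfinish_compose)
    ultimately have "metric_dist G lam (pathstart \<gamma>1) (pathfinish \<gamma>2) \<le> ennreal (2 * C)"
      using g2(1,2) by (intro metric_dist_le_join)
    then show ?thesis using g2(4) by (simp add: \<gamma>1_def pathstart_compose)
  qed
  obtain K where "compact K" "K \<subseteq> G" "\<forall>z\<in>G. metric_dist G lam z z0 \<le> ennreal (2 * C) \<longrightarrow> z \<in> K"
    using z0(2)[of "2 * C"] by blast
  moreover from this have "h ` ball 0 R \<subseteq> K" using dist iso by blast
  ultimately show thesis by (intro that)
qed

text \<open>
  On \<open>K\<close> the density \<open>lam\<close> is bounded below, which makes \<open>h\<close> Lipschitz. Hence \<open>h\<close> has a boundary value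
  \<open>z1\<close> at \<open>\<zeta>\<close>, and \<open>z1\<close> is a point of \<open>G\<close>. Near \<open>\<zeta>\<close> a local developing map at \<open>z1\<close> composed with \<open>h\<close> is a
  local isometry of the disc, therefore an automorphism. So a suitably normalised developing map at \<open>z1\<close> is a
  left inverse of \<open>h\<close>, and its local inverse extends \<open>h\<close>.
\<close>
lemma isometry_extends_over_boundary_point:
  assumes G: "open G" and reg: "regular_conformal_metric G lam"
    and curv: "\<forall>z\<in>G. curvature lam z = -1"
    and R: "0 < R" "R < 1" and h: "h holomorphic_on ball 0 R"
    and iso: "\<And>w. w \<in> ball 0 R \<Longrightarrow> h w \<in> G \<and> lam (h w) * norm (deriv h w) = 2 / (1 - (norm w)\<^sup>2)"
    and K: "compact K" "K \<subseteq> G" "h ` ball 0 R \<subseteq> K" and \<zeta>: "norm \<zeta> = R"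
  shows "\<exists>\<delta>>0. \<exists>k. k holomorphic_on ball \<zeta> \<delta> \<and> (\<forall>w\<in>ball \<zeta> \<delta> \<inter> ball 0 R. k w = h w) \<and>
     (\<forall>w\<in>ball \<zeta> \<delta>. k w \<in> G \<and> lam (k w) * norm (deriv k w) = 2 / (1 - (norm w)\<^sup>2))"
proof -
  have pos: "lam z > 0" if "z \<in> G" for z using reg that by (simp add: regular_conformal_metric_def)
  have R2: "R\<^sup>2 < 1" using R by (simp add: power_less_one_iff)
  have "K \<noteq> {}" using K(3) R by auto
  have "continuous_on K lam" using regular_conformal_metric_continuous[OF reg] K(2) continuous_on_subset by blast
  then obtain x0 where x0: "x0 \<in> K" "\<And>x. x \<in> K \<Longrightarrow> lam x0 \<le> lam x"
    using continuous_attains_inf[OF K(1) \<open>K \<noteq> {}\<close>] by blast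
  define C where "C = 2 / (1 - R\<^sup>2) / lam x0"
  have m: "lam x0 > 0" using x0(1) K(2) pos by blast
  have C: "C > 0" using m R2 by (simp add: C_def)
  have dC: "norm (deriv h w) \<le> C" if w: "w \<in> ball 0 R" for w
  proof -
    have "(norm w)\<^sup>2 \<le> R\<^sup>2" using w R by (intro power_mono) auto
    have "lam x0 * norm (deriv h w) \<le> lam (h w) * norm (deriv h w)"
      using x0(2)[of "h w"] subsetD[OF K(3) imageI[OF w]] by (intro mult_right_mono) auto
    also have "\<dots> = 2 / (1 - (norm w)\<^sup>2)" using iso[OF w] by simp
    also have "\<dots> \<le> 2 / (1 - R\<^sup>2)" using \<open>(norm w)\<^sup>2 \<le> R\<^sup>2\<close> R2 by (intro divide_left_mono) auto
    finally show ?thesis 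
      unfolding C_def using m by (subst pos_le_divide_eq) (simp_all add: mult.commute)
  qed
  have lip: "norm (h a - h b) \<le> C * norm (a - b)" if "a \<in> ball 0 R" "b \<in> ball 0 R" for a b
    by (rule field_differentiable_bound[OF convex_ball _ dC that(1,2)])
       (auto intro!: has_field_derivative_at_within holomorphic_derivI[OF h open_ball])
  \<comment> \<open>The boundary value is found along a subsequence of a radial sequence; the Lipschitz bound makes it a limit.\<close>
  define wn where "wn n = of_real (1 - 1 / real (n + 2)) * \<zeta>" for n :: nat
  have wn: "wn n \<in> ball 0 R" for n
  proof -
    have "norm (wn n) = (1 - 1 / real (n + 2)) * R" unfolding wn_def norm_mult norm_of_real \<zeta> by (simp add: abs_of_nonneg)
    also have "\<dots> < 1 * R" using R by (intro mult_strict_right_mono) auto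
    finally show ?thesis by simp
  qed
  have "(\<lambda>n. 1 / real (n + 2)) \<longlonglongrightarrow> 0" by real_asymp
  then have "(\<lambda>n. of_real (1 - 1 / real (n + 2)) * \<zeta>) \<longlonglongrightarrow> of_real (1 - 0) * \<zeta>" by (intro tendsto_intros)
  then have wlim: "wn \<longlonglongrightarrow> \<zeta>" by (simp add: wn_def[abs_def])
  have "\<forall>n. (h \<circ> wn) n \<in> K" using wn K(3) by auto
  then obtain z1 \<sigma> where z1: "z1 \<in> K" and \<sigma>: "strict_mono (\<sigma> :: nat \<Rightarrow> nat)" "((h \<circ> wn) \<circ> \<sigma>) \<longlonglongrightarrow> z1"
    using K(1) unfolding compact_def by blast
  define v where "v n = wn (\<sigma> n)" for n
  have v: "v n \<in> ball 0 R" for n using wn by (simp add: v_def)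
  have vlim: "v \<longlonglongrightarrow> \<zeta>" using LIMSEQ_subseq_LIMSEQ[OF wlim \<sigma>(1)] by (simp add: v_def[abs_def] o_def)
  have hvlim: "(\<lambda>n. h (v n)) \<longlonglongrightarrow> z1" using \<sigma>(2) by (simp add: v_def o_def)
  have near: "norm (h w - z1) \<le> C * norm (w - \<zeta>)" if "w \<in> ball 0 R" for w
  proof (rule tendsto_le[OF trivial_limit_sequentially])
    show "(\<lambda>n. norm (h w - h (v n))) \<longlonglongrightarrow> norm (h w - z1)" by (intro tendsto_intros hvlim)
    show "(\<lambda>n. C * norm (w - v n)) \<longlonglongrightarrow> C * norm (w - \<zeta>)" by (intro tendsto_intros vlim)
    show "\<forall>\<^sub>F n in sequentially. norm (h w - h (v n)) \<le> C * norm (w - v n)"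
      using lip[OF that v] by simp
  qed
  obtain r1 \<phi> where r1: "r1 > 0" "ball z1 r1 \<subseteq> G" "\<phi> holomorphic_on ball z1 r1"
    and \<phi>: "\<forall>z\<in>ball z1 r1. norm (\<phi> z) < 1 \<and> lam z = 2 * norm (deriv \<phi> z) / (1 - (norm (\<phi> z))\<^sup>2)"
    using liouville_local_representation[OF G reg curv, of z1] z1 K(2) by blast
  define \<delta>0 where "\<delta>0 = r1 / (C + 1)"
  have \<delta>0: "\<delta>0 > 0" "C * \<delta>0 < r1" using r1(1) C by (auto simp: \<delta>0_def field_simps)
  have small: "h w \<in> ball z1 \<rho>" if "w \<in> ball 0 R" "w \<in> ball \<zeta> \<delta>" "C * \<delta> \<le> \<rho>" for w \<delta> \<rho>
  proof -
    have "norm (h w - z1) \<le> C * norm (w - \<zeta>)" by (rule near[OF that(1)])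
    also have "\<dots> < C * \<delta>" using that(2) C by (intro mult_strict_left_mono) (auto simp: dist_norm norm_minus_commute)
    finally show ?thesis using that(3) by (simp add: dist_norm norm_minus_commute)
  qed
  define N where "N = ball 0 R \<inter> ball \<zeta> \<delta>0"
  have Nop: "open N" "connected N" unfolding N_def by (auto intro!: convex_connected convex_Int)
  have hN: "h ` N \<subseteq> ball z1 r1" using small \<delta>0 unfolding N_def by (meson IntE image_subsetI less_imp_le)
  have vN: "\<forall>\<^sub>F n in sequentially. v n \<in> N"
  proof -
    have "\<forall>\<^sub>F n in sequentially. dist (v n) \<zeta> < \<delta>0" using vlim \<delta>0(1) by (rule tendstoD)
    then show ?thesis by eventually_elim (use v in \<open>simp add: N_def dist_commute\<close>)
  qed
  then obtain n0 where n0: "v n0 \<in> N" unfolding eventually_sequentially by blast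
  have holN: "(\<lambda>w. \<phi> (h w)) holomorphic_on N"
    using holomorphic_on_compose_gen[OF holomorphic_on_subset[OF h] r1(3) hN] by (auto simp: o_def N_def)
  have hp: "hyp_pullback (\<lambda>w. \<phi> (h w)) w = 2 / (1 - (norm w)\<^sup>2)" if w: "w \<in> N" for w
  proof -
    have hw: "h w \<in> ball z1 r1" using hN w by blast
    have wR: "w \<in> ball 0 R" using w by (simp add: N_def)
    have d: "deriv (\<lambda>w. \<phi> (h w)) w = deriv \<phi> (h w) * deriv h w"
      by (rule DERIV_imp_deriv[OF DERIV_chain2[OF holomorphic_derivI[OF r1(3) open_ball hw] holomorphic_derivI[OF h open_ball wR]]])
    have "hyp_pullback (\<lambda>w. \<phi> (h w)) w = (2 * norm (deriv \<phi> (h w)) / (1 - (norm (\<phi> (h w)))\<^sup>2)) * norm (deriv h w)"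
      unfolding hyp_pullback_def d norm_mult by simp
    also have "\<dots> = lam (h w) * norm (deriv h w)" using \<phi> hw by metis
    finally show ?thesis using iso[OF wR] by simp
  qed
  have hid: "hyp_pullback (\<lambda>w. w) w = 2 / (1 - (norm w)\<^sup>2)" for w by (simp add: hyp_pullback_def)
  have lt1: "norm w < 1" if "w \<in> N" for w using that R by (simp add: N_def)
  have ev: "\<forall>\<^sub>F w in nhds (v n0). hyp_pullback (\<lambda>w. \<phi> (h w)) w = hyp_pullback (\<lambda>w. w) w"
    using eventually_nhds_in_open[OF Nop(1) n0] by eventually_elim (simp add: hp hid)
  have nz: "deriv (\<lambda>w. \<phi> (h w)) (v n0) \<noteq> 0"
    using hp[OF n0] norm_square_less_one[OF lt1[OF n0]] unfolding hyp_pullback_def by auto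
  obtain T S where T: "disc_automorphism T S" "\<And>w. w \<in> N \<Longrightarrow> w = T (\<phi> (h w))"
    by (rule developing_maps_differ_by_automorphism[OF Nop n0 holN _ holomorphic_on_ident _ ev nz])
       (use hN \<phi> lt1 that in auto)
  have Tiso: "disc_isometry T" using T(1) by (simp add: disc_automorphism_def)
  define \<psi> where "\<psi> = (\<lambda>z. T (\<phi> z))"
  have \<phi>im: "\<phi> ` ball z1 r1 \<subseteq> ball 0 1" using \<phi> by auto
  have \<psi>h: "\<psi> holomorphic_on ball z1 r1"
    using holomorphic_on_compose_gen[OF r1(3) _ \<phi>im, of T] Tiso unfolding disc_isometry_def by (simp add: \<psi>_def o_def)
  have \<psi>lam: "lam z = hyp_pullback \<psi> z" if "z \<in> ball z1 r1" for z
  proof -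
    have "hyp_pullback \<psi> z = hyp_pullback \<phi> z"
      unfolding \<psi>_def using \<phi> that by (intro hyp_pullback_compose[OF Tiso r1(3) open_ball that]) auto
    then show ?thesis using \<phi> that by (simp add: hyp_pullback_def)
  qed
  have z1b: "z1 \<in> ball z1 r1" using r1 by simp
  have "\<psi> z1 = \<zeta>"
  proof (rule tendsto_unique[OF trivial_limit_sequentially])
    have "isCont \<psi> z1" using \<psi>h z1b by (meson holomorphic_on_imp_continuous_on continuous_on_eq_continuous_at open_ball)
    then show "(\<lambda>n. \<psi> (h (v n))) \<longlonglongrightarrow> \<psi> z1" using hvlim by (rule isCont_tendsto_compose)
    have "\<forall>\<^sub>F n in sequentially. \<psi> (h (v n)) = v n"
      using vN by eventually_elim (simp add: \<psi>_def T(2)[symmetric])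
    then show "(\<lambda>n. \<psi> (h (v n))) \<longlonglongrightarrow> \<zeta>" using vlim by (simp add: tendsto_cong)
  qed
  have "deriv \<psi> z1 \<noteq> 0"
    using \<psi>lam[OF z1b] pos[of z1] z1 K(2) unfolding hyp_pullback_def by auto
  then obtain r' k where r': "r' > 0" "ball z1 r' \<subseteq> ball z1 r1" "inj_on \<psi> (ball z1 r')" "open (\<psi> ` ball z1 r')"
    and k: "k holomorphic_on \<psi> ` ball z1 r'" "\<And>x. x \<in> ball z1 r' \<Longrightarrow> k (\<psi> x) = x"
      "\<And>x. x \<in> ball z1 r' \<Longrightarrow> deriv \<psi> x * deriv k (\<psi> x) = 1"
    using local_inverse[OF \<psi>h open_ball z1b] by metis
  have "\<zeta> \<in> \<psi> ` ball z1 r'" using \<open>\<psi> z1 = \<zeta>\<close> r'(1) by force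
  then obtain \<delta>1 where \<delta>1: "\<delta>1 > 0" "ball \<zeta> \<delta>1 \<subseteq> \<psi> ` ball z1 r'" using r'(4) open_contains_ball by blast
  define \<delta> where "\<delta> = min (min \<delta>0 \<delta>1) (r' / C)"
  have \<delta>: "\<delta> > 0" "\<delta> \<le> \<delta>0" "\<delta> \<le> \<delta>1" "C * \<delta> \<le> r'"
    using \<delta>0 \<delta>1 r' C mult_left_mono[of \<delta> "r' / C" C] by (auto simp: \<delta>_def)
  have sub: "ball \<zeta> \<delta> \<subseteq> \<psi> ` ball z1 r'" using \<delta>1(2) \<delta>(3) by auto
  have "k w = h w" if w: "w \<in> ball \<zeta> \<delta> \<inter> ball 0 R" for w
  proof -
    have "h w \<in> ball z1 r'" using small[of w \<delta> r'] w \<delta>(4) by auto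
    moreover have "w \<in> N" using w \<delta>(2) by (simp add: N_def)
    then have "\<psi> (h w) = w" using T(2) by (simp add: \<psi>_def)
    ultimately show ?thesis using k(2)[of "h w"] by simp
  qed
  moreover have "k w \<in> G \<and> lam (k w) * norm (deriv k w) = 2 / (1 - (norm w)\<^sup>2)" if w: "w \<in> ball \<zeta> \<delta>" for w
  proof -
    obtain x where x: "x \<in> ball z1 r'" "w = \<psi> x" using w sub by blast
    have kw: "k w = x" using k(2) x by simp
    have xG: "x \<in> G" "x \<in> ball z1 r1" using x r' r1 by auto
    have n1: "norm (deriv \<psi> x) * norm (deriv k w) = 1" using k(3)[OF x(1)] x(2) by (metis norm_mult norm_one)
    have "lam (k w) * norm (deriv k w) = 2 * (norm (deriv \<psi> x) * norm (deriv k w)) / (1 - (norm w)\<^sup>2)"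
    proof -
      have "lam (k w) = 2 * norm (deriv \<psi> x) / (1 - (norm w)\<^sup>2)"
        using \<psi>lam[OF xG(2)] kw x(2)[symmetric] by (simp add: hyp_pullback_def)
      then show ?thesis by simp
    qed
    then show ?thesis using n1 xG kw by simp
  qed
  moreover have "k holomorphic_on ball \<zeta> \<delta>" using k(1) sub holomorphic_on_subset by blast
  ultimately show ?thesis using \<delta>(1) by blast
qed

theorem complete_isometry_extends_to_disc:
  assumes G: "open G" "connected G" and reg: "regular_conformal_metric G lam"
    and curv: "\<forall>z\<in>G. curvature lam z = -1" and complete: "complete_conformal_metric G lam"
    and r: "0 < r" "r \<le> 1" and g: "g holomorphic_on ball 0 r"
    and iso: "\<And>w. w \<in> ball 0 r \<Longrightarrow> g w \<in> G \<and> lam (g w) * norm (deriv g w) = 2 / (1 - (norm w)\<^sup>2)"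
  obtains H where "H holomorphic_on ball 0 1" "\<And>w. w \<in> ball 0 r \<Longrightarrow> H w = g w" "H ` ball 0 1 \<subseteq> G"
proof -
  have "\<exists>H. H holomorphic_on ball 0 1 \<and> (\<forall>w\<in>ball 0 r. H w = g w) \<and>
     (\<forall>w\<in>ball 0 1. H w \<in> G \<and> lam (H w) * norm (deriv H w) = 2 / (1 - (norm w)\<^sup>2))"
  proof (rule holomorphic_extension_to_disc[where \<Phi> = "\<lambda>w z d. z \<in> G \<and> lam z * norm d = 2 / (1 - (norm w)\<^sup>2)", OF r g iso])
    fix R h \<zeta>
    assume R: "r \<le> R" "R < 1" and h: "h holomorphic_on ball 0 R" 
      and hiso: "\<And>w. w \<in> ball 0 R \<Longrightarrow> h w \<in> G \<and> lam (h w) * norm (deriv h w) = 2 / (1 - (norm w)\<^sup>2)"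
      and \<zeta>: "norm (\<zeta>::complex) = R"
    have R0: "0 < R" using R r by simp
    obtain K where K: "compact K" "K \<subseteq> G" "h ` ball 0 R \<subseteq> K"
      by (rule complete_isometry_image_compact[OF G reg complete R0 R(2) h hiso], assumption, intro that)
    show "\<exists>\<delta>>0. \<exists>k. k holomorphic_on ball \<zeta> \<delta> \<and> (\<forall>w\<in>ball \<zeta> \<delta> \<inter> ball 0 R. k w = h w) \<and>
       (\<forall>w\<in>ball \<zeta> \<delta>. k w \<in> G \<and> lam (k w) * norm (deriv k w) = 2 / (1 - (norm w)\<^sup>2))"
      by (rule isometry_extends_over_boundary_point[OF G(1) reg curv R0 R(2) h hiso K \<zeta>])
  qed
  then show thesis using that by blast
qed

section \<open>Continuation of developing maps and of their inverses\<close>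

lemma analytic_at_obtain_ball:
  assumes "f analytic_on {z}" "open S" "f z \<in> S" "open U" "z \<in> U"
  obtains r where "r > 0" "f holomorphic_on ball z r" "f ` ball z r \<subseteq> S" "ball z r \<subseteq> U"
proof -
  obtain e where e: "e > 0" "f holomorphic_on ball z e" using assms(1) unfolding analytic_on_def by auto
  have "open (ball z e \<inter> f -` S)"
    by (rule continuous_open_preimage[OF holomorphic_on_imp_continuous_on[OF e(2)] open_ball assms(2)])
  then have "open (ball z e \<inter> f -` S \<inter> U)" using assms(4) by (rule open_Int)
  moreover have "z \<in> ball z e \<inter> f -` S \<inter> U" using e(1) assms by simp
  ultimately obtain r where r: "r > 0" "ball z r \<subseteq> ball z e \<inter> f -` S \<inter> U"
    using openE[of "ball z e \<inter> f -` S \<inter> U" z] by metis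
  show thesis
    by (rule that[of r]) (use r e(2) in \<open>auto elim: holomorphic_on_subset\<close>)
qed

lemma eventually_eq_imp_eq_on_connected:
  assumes "open U" "connected U" "x \<in> U" "f holomorphic_on U" "g holomorphic_on U"
    and "\<forall>\<^sub>F y in nhds x. f y = g y" and "y \<in> U"
  shows "f y = g y"
proof -
  obtain V where V: "open V" "x \<in> V" "\<And>y. y \<in> V \<Longrightarrow> f y = g y"
    using assms(6) unfolding eventually_nhds by blast
  show ?thesis
    by (rule analytic_continuation_open[of "V \<inter> U" U]) (use V assms in auto)
qed

lemma propagation_on_connected_set:
  fixes P :: "real \<Rightarrow> bool"
  assumes "connected S" "a \<in> S" "b \<in> S" "P a"
    and loc: "\<And>t. t \<in> S \<Longrightarrow> \<exists>\<delta>>0. \<forall>s\<in>S. \<forall>s'\<in>S. \<bar>s - t\<bar> < \<delta> \<longrightarrow> \<bar>s' - t\<bar> < \<delta> \<longrightarrow> P s \<longrightarrow> P s'"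
  shows "P b"
proof (rule connected_induction_simple[where P = P, OF assms(1-4)])
  fix t assume t: "t \<in> S"
  then obtain \<delta> where d: "\<delta> > 0" "\<forall>s\<in>S. \<forall>s'\<in>S. \<bar>s - t\<bar> < \<delta> \<longrightarrow> \<bar>s' - t\<bar> < \<delta> \<longrightarrow> P s \<longrightarrow> P s'"
    using loc by blast
  have "openin (top_of_set S) (S \<inter> ball t \<delta>)" by (intro openin_open_Int open_ball)
  moreover have "t \<in> S \<inter> ball t \<delta>" using t d(1) by simp
  moreover have "\<forall>x\<in>S \<inter> ball t \<delta>. \<forall>y\<in>S \<inter> ball t \<delta>. P x \<longrightarrow> P y"
    using d(2) by (auto simp: dist_real_def abs_minus_commute)
  ultimately show "\<exists>T. openin (top_of_set S) T \<and> t \<in> T \<and> (\<forall>x\<in>T. \<forall>y\<in>T. P x \<longrightarrow> P y)" by blast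
qed

text \<open>
  The parameters \<open>t\<close> at which \<open>F t\<close> represents the metric propagate: if \<open>F t\<close> represents it near one point
  close to \<open>\<gamma> t\<close>, then \<open>F t\<close> differs from a local representation around \<open>\<gamma> t\<close> by an automorphism of the disc
  and so represents the metric on a whole neighbourhood.
\<close>
lemma continuation_preserves_representation:
  assumes G: "open G" and reg: "regular_conformal_metric G lam"
    and curv: "\<forall>z\<in>G. curvature lam z = -1"
    and \<gamma>: "valid_path \<gamma>" "path_image \<gamma> \<subseteq> G" and F: "continuation_along (ball 0 1) \<gamma> F"
    and start: "\<forall>\<^sub>F x in nhds (\<gamma> 0). lam x = hyp_pullback (F 0) x"
  shows "\<forall>\<^sub>F x in nhds (\<gamma> 1). lam x = hyp_pullback (F 1) x"
proof -
  let ?P = "\<lambda>t. \<forall>\<^sub>F x in nhds (\<gamma> t). lam x = hyp_pullback (F t) x"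
  show ?thesis
  proof (rule propagation_on_connected_set[of "{0..1}" 0 1 ?P])
    fix t :: real assume t: "t \<in> {0..1}"
    have F1: "F t analytic_on {\<gamma> t}" "F t (\<gamma> t) \<in> ball 0 1" using F t unfolding continuation_along_def by auto
    obtain \<delta>1 where d1: "\<delta>1 > 0" "\<And>s. s \<in> {0..1} \<Longrightarrow> \<bar>s - t\<bar> < \<delta>1 \<Longrightarrow> \<forall>\<^sub>F z in nhds (\<gamma> s). F s z = F t z"
      using F t unfolding continuation_along_def by blast
    have gG: "\<gamma> t \<in> G" using \<gamma>(2) t unfolding path_image_def by auto
    obtain r1 \<phi> where r1: "r1 > 0" "ball (\<gamma> t) r1 \<subseteq> G" "\<phi> holomorphic_on ball (\<gamma> t) r1"
      and \<phi>: "\<forall>z\<in>ball (\<gamma> t) r1. norm (\<phi> z) < 1 \<and> lam z = 2 * norm (deriv \<phi> z) / (1 - (norm (\<phi> z))\<^sup>2)"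
      using liouville_local_representation[OF G reg curv gG] by blast
    have gb: "\<gamma> t \<in> ball (\<gamma> t) r1" using r1(1) by simp
    obtain r where r: "r > 0" "F t holomorphic_on ball (\<gamma> t) r" "F t ` ball (\<gamma> t) r \<subseteq> ball 0 1" "ball (\<gamma> t) r \<subseteq> ball (\<gamma> t) r1"
      by (rule analytic_at_obtain_ball[OF F1(1) open_ball F1(2) open_ball gb], intro that)
    have "continuous_on {0..1} \<gamma>" using valid_path_imp_path[OF \<gamma>(1)] by (simp add: path_def)
    then obtain \<delta>2 where d2: "\<delta>2 > 0" "\<And>s. s \<in> {0..1} \<Longrightarrow> \<bar>s - t\<bar> < \<delta>2 \<Longrightarrow> dist (\<gamma> s) (\<gamma> t) < r"
      using t r(1) unfolding continuous_on_iff dist_real_def by blast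
    have propagate: "?P s'" if s: "s \<in> {0..1}" "\<bar>s - t\<bar> < min \<delta>1 \<delta>2" "?P s" and s': "s' \<in> {0..1}" "\<bar>s' - t\<bar> < min \<delta>1 \<delta>2" for s s'
    proof -
      let ?B = "ball (\<gamma> t) r"
      have gs: "\<gamma> s \<in> ?B" "\<gamma> s' \<in> ?B" using d2(2)[OF s(1)] d2(2)[OF s'(1)] s s' by (auto simp: dist_commute)
      have lamphi: "lam z = hyp_pullback \<phi> z" if "z \<in> ?B" for z
        using \<phi> that r(4) unfolding hyp_pullback_def by blast
      have Fs: "\<forall>\<^sub>F x in nhds (\<gamma> s). F s x = F t x" using d1(2)[OF s(1)] s(2) by simp
      have Fs': "\<forall>\<^sub>F x in nhds (\<gamma> s'). F t x = F s' x"
        using d1(2)[OF s'(1)] s'(2) by (simp add: eq_commute)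
      have hpF: "\<forall>\<^sub>F x in nhds (\<gamma> s). hyp_pullback (F s) x = hyp_pullback (F t) x"
        by (rule hyp_pullback_eventually_cong[OF Fs])
      have ev: "\<forall>\<^sub>F x in nhds (\<gamma> s). hyp_pullback \<phi> x = hyp_pullback (F t) x"
        using eventually_nhds_in_open[OF open_ball gs(1)] hpF s(3) by eventually_elim (simp add: lamphi)
      have "lam (\<gamma> s) > 0" using reg gs(1) r(4) r1(2) unfolding regular_conformal_metric_def by blast
      then have nz: "deriv \<phi> (\<gamma> s) \<noteq> 0" using lamphi[OF gs(1)] by (auto simp: hyp_pullback_def)
      have \<phi>B: "\<phi> holomorphic_on ?B" "\<phi> ` ?B \<subseteq> ball 0 1"
        using r1(3) r(4) \<phi> by (auto elim: holomorphic_on_subset)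
      obtain T S where T: "disc_automorphism T S" "\<And>z. z \<in> ?B \<Longrightarrow> F t z = T (\<phi> z)"
        by (rule developing_maps_differ_by_automorphism[OF open_ball connected_ball gs(1) \<phi>B r(2,3) ev nz], intro that)
      have Tiso: "disc_isometry T" using T(1) by (simp add: disc_automorphism_def)
      have lamF: "lam z = hyp_pullback (F t) z" if z: "z \<in> ?B" for z
      proof -
        have "\<forall>\<^sub>F x in nhds z. F t x = T (\<phi> x)"
          using eventually_nhds_in_open[OF open_ball z] by eventually_elim (rule T(2))
        then have "hyp_pullback (F t) z = hyp_pullback (\<lambda>x. T (\<phi> x)) z" by (rule hyp_pullback_cong)
        also have "\<dots> = hyp_pullback \<phi> z"
        proof (rule hyp_pullback_compose[OF Tiso \<phi>B(1) open_ball z])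
          show "norm (\<phi> z) < 1" using subsetD[OF \<phi>B(2) imageI[OF z]] by simp
        qed
        finally show ?thesis using lamphi[OF z] by simp
      qed
      have "\<forall>\<^sub>F x in nhds (\<gamma> s'). hyp_pullback (F t) x = hyp_pullback (F s') x"
        by (rule hyp_pullback_eventually_cong[OF Fs'])
      with eventually_nhds_in_open[OF open_ball gs(2)] show "?P s'"
        by eventually_elim (simp add: lamF)
    qed
    show "\<exists>\<delta>>0. \<forall>s\<in>{0..1}. \<forall>s'\<in>{0..1}. \<bar>s - t\<bar> < \<delta> \<longrightarrow> \<bar>s' - t\<bar> < \<delta> \<longrightarrow> ?P s \<longrightarrow> ?P s'"
    proof (intro exI[of _ "min \<delta>1 \<delta>2"] conjI ballI impI)
      show "0 < min \<delta>1 \<delta>2" using d1(1) d2(1) by simp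
    qed (rule propagate)
  qed (use start in auto)
qed

text \<open>
  A germ of the developing map pulls the hyperbolic metric back to \<open>lam\<close>, so its local inverse pulls \<open>lam\<close> back
  to the hyperbolic metric.
\<close>
lemma inverse_branch_isometry:
  assumes G: "open G" and reg: "regular_conformal_metric G lam"
    and curv: "\<forall>z\<in>G. curvature lam z = -1"
    and f: "developing_map G lam f" and g: "inverse_branch f w0 g"
  obtains r where "r > 0" "ball w0 r \<subseteq> ball 0 1" "g holomorphic_on ball w0 r"
    "\<And>w. w \<in> ball w0 r \<Longrightarrow> g w \<in> G \<and> lam (g w) * norm (deriv g w) = 2 / (1 - (norm w)\<^sup>2)"
proof -
  obtain z0 \<phi> where z0: "(z0, \<phi>) \<in> f" "w0 = \<phi> z0" "g analytic_on {w0}"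
    and inv: "\<forall>\<^sub>F z in nhds z0. g (\<phi> z) = z" "\<forall>\<^sub>F w in nhds w0. \<phi> (g w) = w"
    using g unfolding inverse_branch_def by blast
  obtain zb \<phi>b where zb: "represents_metric_at lam \<phi>b zb" and feq: "f = {(z, \<phi>). \<exists>\<gamma> F. valid_path \<gamma> \<and> path_image \<gamma> \<subseteq> G \<and>
               pathstart \<gamma> = zb \<and> pathfinish \<gamma> = z \<and> continuation_along (ball 0 1) \<gamma> F \<and>
               (\<forall>\<^sub>F w in nhds zb. F 0 w = \<phi>b w) \<and> (\<forall>\<^sub>F w in nhds z. F 1 w = \<phi> w)}"
    using f unfolding developing_map_def by blast
  obtain \<gamma> F where \<gamma>: "valid_path \<gamma>" "path_image \<gamma> \<subseteq> G" "pathstart \<gamma> = zb" "pathfinish \<gamma> = z0"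
    and F: "continuation_along (ball 0 1) \<gamma> F" "\<forall>\<^sub>F w in nhds zb. F 0 w = \<phi>b w" "\<forall>\<^sub>F w in nhds z0. F 1 w = \<phi> w"
    using z0(1) unfolding feq by blast
  have ends: "\<gamma> 0 = zb" "\<gamma> 1 = z0" using \<gamma>(3,4) by (auto simp: pathstart_def pathfinish_def)
  have "\<forall>\<^sub>F x in nhds zb. hyp_pullback (F 0) x = hyp_pullback \<phi>b x"
    by (rule hyp_pullback_eventually_cong[OF F(2)])
  moreover have "\<forall>\<^sub>F x in nhds zb. lam x = hyp_pullback \<phi>b x"
    using zb unfolding represents_metric_at_def hyp_pullback_def by simp
  ultimately have "\<forall>\<^sub>F x in nhds (\<gamma> 0). lam x = hyp_pullback (F 0) x"
    unfolding ends by eventually_elim simp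
  from continuation_preserves_representation[OF G reg curv \<gamma>(1,2) F(1) this]
  have lamF: "\<forall>\<^sub>F x in nhds z0. lam x = hyp_pullback (F 1) x" unfolding ends .
  have F1: "F 1 analytic_on {z0}" "F 1 z0 \<in> ball 0 1"
    using F(1) ends unfolding continuation_along_def by auto
  have gw0: "g w0 = z0" using eventually_nhds_x_imp_x[OF inv(1)] z0(2) by simp
  have w01: "w0 \<in> ball 0 1" using F1(2) eventually_nhds_x_imp_x[OF F(3)] z0(2) by simp
  have z0G: "z0 \<in> G" using \<gamma>(2,4) pathfinish_in_path_image by blast
  obtain V where V: "open V" "z0 \<in> V" "\<And>x. x \<in> V \<Longrightarrow> lam x = hyp_pullback (F 1) x \<and> F 1 x = \<phi> x"
    using eventually_conj[OF lamF F(3)] unfolding eventually_nhds by blast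
  have "open (V \<inter> G)" "z0 \<in> V \<inter> G" using V G z0G by auto
  then obtain r1 where r1: "r1 > 0" "F 1 holomorphic_on ball z0 r1" "F 1 ` ball z0 r1 \<subseteq> UNIV" "ball z0 r1 \<subseteq> V \<inter> G"
    by (rule analytic_at_obtain_ball[OF F1(1) open_UNIV UNIV_I], intro that)
  obtain W where W: "open W" "w0 \<in> W" "\<And>w. w \<in> W \<Longrightarrow> \<phi> (g w) = w"
    using inv(2) unfolding eventually_nhds by blast
  have 1: "g w0 \<in> ball z0 r1" using gw0 r1(1) by simp
  have 2: "open (W \<inter> ball 0 1)" "w0 \<in> W \<inter> ball 0 1" using W w01 by auto
  obtain r where r: "r > 0" "g holomorphic_on ball w0 r" "g ` ball w0 r \<subseteq> ball z0 r1" "ball w0 r \<subseteq> W \<inter> ball 0 1"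
    by (rule analytic_at_obtain_ball[OF z0(3) open_ball 1 2], intro that)
  have "g w \<in> G \<and> lam (g w) * norm (deriv g w) = 2 / (1 - (norm w)\<^sup>2)" if w: "w \<in> ball w0 r" for w
  proof -
    have gb: "g x \<in> ball z0 r1" if "x \<in> ball w0 r" for x using r(3) that by blast
    have gV: "g x \<in> V" "g x \<in> G" if "x \<in> ball w0 r" for x using gb[OF that] r1(4) by auto
    have eq: "F 1 (g x) = x" if "x \<in> ball w0 r" for x
      using V(3)[OF gV(1)[OF that]] W(3)[of x] r(4) that by auto
    have "((\<lambda>x. F 1 (g x)) has_field_derivative deriv (F 1) (g w) * deriv g w) (at w)"
      by (rule DERIV_chain2[OF holomorphic_derivI[OF r1(2) open_ball gb[OF w]] holomorphic_derivI[OF r(2) open_ball w]])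
    moreover have "deriv (\<lambda>x. F 1 (g x)) w = deriv (\<lambda>x. x) w"
      by (rule deriv_eq_on_open[OF open_ball w]) (rule eq)
    ultimately have "deriv (F 1) (g w) * deriv g w = 1" using DERIV_imp_deriv by fastforce
    then have n1: "norm (deriv (F 1) (g w)) * norm (deriv g w) = 1" by (metis norm_mult norm_one)
    have "lam (g w) * norm (deriv g w) = 2 * (norm (deriv (F 1) (g w)) * norm (deriv g w)) / (1 - (norm w)\<^sup>2)"
      using V(3)[OF gV(1)[OF w]] eq[OF w] by (simp add: hyp_pullback_def)
    then show ?thesis using n1 gV(2)[OF w] by simp
  qed
  with r show thesis by (intro that[of r]) auto
qed

text \<open>
  After an automorphism has moved \<open>w0\<close> to the origin, the inverse branch extends to the whole disc. The
  extension itself is then a continuation along every path.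
\<close>
theorem complete_imp_inverse_branches_continuable:
  assumes G: "open G" "connected G" and reg: "regular_conformal_metric G lam"
    and curv: "\<forall>z\<in>G. curvature lam z = -1" and complete: "complete_conformal_metric G lam"
    and f: "developing_map G lam f" and g: "inverse_branch f w0 g"
    and \<gamma>: "path_image \<gamma> \<subseteq> ball 0 1" "pathstart \<gamma> = w0"
  shows "continuable_along G \<gamma> g"
proof -
  obtain r where r: "r > 0" "ball w0 r \<subseteq> ball 0 1" "g holomorphic_on ball w0 r"
    and iso: "\<And>w. w \<in> ball w0 r \<Longrightarrow> g w \<in> G \<and> lam (g w) * norm (deriv g w) = 2 / (1 - (norm w)\<^sup>2)"
    by (rule inverse_branch_isometry[OF G(1) reg curv f g], intro that)
  have w01: "norm w0 < 1" using r(1,2) by (auto simp: subset_iff)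
  obtain T S where TS: "disc_automorphism T S" "T w0 = 0" "S 0 = w0"
    using disc_automorphism_moebius[OF w01] by blast
  have Tiso: "disc_isometry T" and Siso: "disc_isometry S" and ST: "\<And>w. norm w < 1 \<Longrightarrow> S (T w) = w"
    using TS(1) unfolding disc_automorphism_def by auto
  have Thol: "T holomorphic_on ball 0 1" and Shol: "S holomorphic_on ball 0 1"
    using Tiso Siso unfolding disc_isometry_def by auto
  have "S analytic_on {0}" using Shol unfolding analytic_at by (intro exI[of _ "ball 0 1"]) simp
  moreover have "S 0 \<in> ball w0 r" "0 \<in> ball (0::complex) 1" using TS(3) r(1) by auto
  ultimately obtain r0 where r0': "r0 > 0" "S holomorphic_on ball 0 r0" "S ` ball 0 r0 \<subseteq> ball w0 r" "ball (0::complex) r0 \<subseteq> ball 0 1"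
    by (rule analytic_at_obtain_ball[OF _ open_ball _ open_ball], intro that)
  note r0 = r0'(1,3,4)
  have r01: "r0 \<le> 1"
  proof (rule ccontr)
    assume "\<not> r0 \<le> 1"
    then have "(1 :: complex) \<in> ball 0 r0" by simp
    then have "(1 :: complex) \<in> ball 0 1" using r0(3) by (rule subsetD[rotated])
    then show False by simp
  qed
  define g0 where "g0 = (\<lambda>w. g (S w))"
  have S0: "S holomorphic_on ball 0 r0" using Shol r0(3) holomorphic_on_subset by blast
  have g0h: "g0 holomorphic_on ball 0 r0"
    using holomorphic_on_compose_gen[OF S0 r(3) r0(2)] by (simp add: g0_def o_def)
  have g0iso: "g0 w \<in> G \<and> lam (g0 w) * norm (deriv g0 w) = 2 / (1 - (norm w)\<^sup>2)" if w: "w \<in> ball 0 r0" for w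
  proof -
    have Sw: "S w \<in> ball w0 r" using r0(2) w by blast
    have d: "deriv g0 w = deriv g (S w) * deriv S w"
      unfolding g0_def
      by (rule DERIV_imp_deriv[OF DERIV_chain2[OF holomorphic_derivI[OF r(3) open_ball Sw] holomorphic_derivI[OF S0 open_ball w]]])
    have "lam (g0 w) * norm (deriv g0 w) = (lam (g (S w)) * norm (deriv g (S w))) * norm (deriv S w)"
      unfolding d norm_mult by (simp add: g0_def)
    also have "\<dots> = hyp_pullback S w" unfolding conjunct2[OF iso[OF Sw]] hyp_pullback_def by simp
    also have "\<dots> = 2 / (1 - (norm w)\<^sup>2)" using Siso w r0(3) unfolding disc_isometry_def by blast
    finally show ?thesis using iso[OF Sw] by (simp add: g0_def)
  qed
  obtain H where H: "H holomorphic_on ball 0 1" "\<And>w. w \<in> ball 0 r0 \<Longrightarrow> H w = g0 w" "H ` ball 0 1 \<subseteq> G"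
    by (rule complete_isometry_extends_to_disc[OF G reg curv complete r0(1) r01 g0h g0iso], assumption, intro that)
  define E where "E = (\<lambda>w. H (T w))"
  have Tim: "T ` ball 0 1 \<subseteq> ball 0 1" using Tiso unfolding disc_isometry_def by blast
  have Eh: "E holomorphic_on ball 0 1"
    using holomorphic_on_compose_gen[OF Thol H(1) Tim] by (simp add: E_def o_def)
  have EG: "E w \<in> G" if "w \<in> ball 0 1" for w using Tim H(3) that unfolding E_def by blast
  have g\<gamma>: "\<gamma> t \<in> ball 0 1" if "t \<in> {0..1}" for t using \<gamma>(1) that unfolding path_image_def by blast
  have "continuation_along G \<gamma> (\<lambda>_. E)"
    unfolding continuation_along_def
    using Eh EG g\<gamma> by (auto simp: analytic_at intro!: exI[of _ "1::real"] exI[of _ "ball (0::complex) 1"])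
  moreover have "\<forall>\<^sub>F z in nhds (pathstart \<gamma>). E z = g z"
  proof -
    have w0b: "w0 \<in> ball 0 1" using w01 by simp
    have "isCont T w0" using Thol w0b by (meson holomorphic_on_imp_continuous_on continuous_on_eq_continuous_at open_ball)
    then have "filterlim T (nhds 0) (nhds w0)" using TS(2) by (metis isCont_def tendsto_at_iff_tendsto_nhds)
    moreover have "\<forall>\<^sub>F w in nhds 0. w \<in> ball 0 r0" using r0(1) by (rule eventually_nhds_ball)
    ultimately have "\<forall>\<^sub>F z in nhds w0. T z \<in> ball 0 r0" by (rule eventually_compose_filterlim[rotated])
    with eventually_nhds_in_open[OF open_ball w0b] have "\<forall>\<^sub>F z in nhds w0. E z = g z"
    proof eventually_elim
      case (elim z)
      then show ?case using H(2)[of "T z"] ST[of z] by (simp add: E_def g0_def)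
    qed
    then show ?thesis using \<gamma>(2) by simp
  qed
  ultimately show ?thesis unfolding continuable_along_def by blast
qed

text \<open>
  By the identity theorem the germs agree with \<open>h\<close> for all parameters near a given one as soon as one of them does.
\<close>
lemma continuation_along_radius_agrees:
  assumes R: "0 < R" "R < 1" and h: "h holomorphic_on ball 0 R" and \<zeta>: "norm \<zeta> = R"
    and F: "continuation_along G (linepath 0 \<zeta>) F" and start: "\<forall>\<^sub>F z in nhds 0. F 0 z = h z"
    and t: "0 \<le> t" "t < 1"
  shows "\<forall>\<^sub>F z in nhds (of_real t * \<zeta>). F t z = h z"
proof -
  have lp: "linepath 0 \<zeta> s = of_real s * \<zeta>" for s by (simp add: linepath_def scaleR_conv_of_real)
  let ?P = "\<lambda>t. \<forall>\<^sub>F z in nhds (of_real t * \<zeta>). F t z = h z"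
  show ?thesis
  proof (rule propagation_on_connected_set[of "{0..<1}" 0 t ?P])
    fix u :: real assume u: "u \<in> {0..<1}"
    have F1: "F u analytic_on {of_real u * \<zeta>}" using F u unfolding continuation_along_def lp by auto
    have u01: "u \<in> {0..1}" using u by auto
    have "\<exists>\<delta>>0. \<forall>s\<in>{0..1}. \<bar>s - u\<bar> < \<delta> \<longrightarrow> (\<forall>\<^sub>F z in nhds (of_real s * \<zeta>). F s z = F u z)"
      using F u01 unfolding continuation_along_def lp by blast
    then obtain \<delta>1 where d1: "\<delta>1 > 0" "\<And>s. s \<in> {0..1} \<Longrightarrow> \<bar>s - u\<bar> < \<delta>1 \<Longrightarrow> \<forall>\<^sub>F z in nhds (of_real s * \<zeta>). F s z = F u z"
      by blast
    have "of_real u * \<zeta> \<in> ball 0 R" using u R \<zeta> by (simp add: norm_mult)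
    then obtain \<rho> where \<rho>': "\<rho> > 0" "F u holomorphic_on ball (of_real u * \<zeta>) \<rho>" "F u ` ball (of_real u * \<zeta>) \<rho> \<subseteq> UNIV"
        "ball (of_real u * \<zeta>) \<rho> \<subseteq> ball 0 R"
      by (rule analytic_at_obtain_ball[OF F1 open_UNIV UNIV_I open_ball], intro that)
    note \<rho> = \<rho>'(1,2,4)
    let ?B = "ball (of_real u * \<zeta>) \<rho>"
    have near: "of_real s * \<zeta> \<in> ?B" if "\<bar>s - u\<bar> < \<rho>" for s
    proof -
      have "of_real u * \<zeta> - of_real s * \<zeta> = of_real (u - s) * \<zeta>" by (simp add: algebra_simps)
      then have "dist (of_real u * \<zeta>) (of_real s * \<zeta>) = \<bar>s - u\<bar> * R" using \<zeta> by (simp add: dist_norm norm_mult abs_minus_commute del: of_real_diff)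
      also have "\<dots> \<le> \<bar>s - u\<bar>" using R by (simp add: mult_left_le)
      finally show ?thesis using that by simp
    qed
    have propagate: "?P s'" if s: "s \<in> {0..<1}" "\<bar>s - u\<bar> < min \<delta>1 \<rho>" "?P s" and s': "s' \<in> {0..<1}" "\<bar>s' - u\<bar> < min \<delta>1 \<rho>" for s s'
    proof -
      have Fs: "\<forall>\<^sub>F z in nhds (of_real s * \<zeta>). F s z = F u z" and Fs': "\<forall>\<^sub>F z in nhds (of_real s' * \<zeta>). F s' z = F u z"
        using d1(2)[of s] d1(2)[of s'] s s' by auto
      have ns: "of_real s * \<zeta> \<in> ?B" "of_real s' * \<zeta> \<in> ?B" using near[of s] near[of s'] s s' by auto
      have "\<forall>\<^sub>F z in nhds (of_real s * \<zeta>). F u z = h z" using Fs s(3) by eventually_elim simp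
      then have eq: "F u z = h z" if "z \<in> ?B" for z
        by (rule eventually_eq_imp_eq_on_connected[OF open_ball connected_ball ns(1) \<rho>(2) holomorphic_on_subset[OF h \<rho>(3)] _ that])
      show "?P s'" using Fs' eventually_nhds_in_open[OF open_ball ns(2)] by eventually_elim (simp add: eq)
    qed
    show "\<exists>\<delta>>0. \<forall>s\<in>{0..<1}. \<forall>s'\<in>{0..<1}. \<bar>s - u\<bar> < \<delta> \<longrightarrow> \<bar>s' - u\<bar> < \<delta> \<longrightarrow> ?P s \<longrightarrow> ?P s'"
    proof (intro exI[of _ "min \<delta>1 \<rho>"] conjI ballI impI)
      show "0 < min \<delta>1 \<rho>" using d1(1) \<rho>(1) by simp
    qed (rule propagate)
  qed (use start t in auto)
qed

text \<open>
  The last germ of the continuation along the radius to \<open>\<zeta>\<close> extends the function across the circle at \<open>\<zeta>\<close>.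
\<close>
lemma radially_continuable_extends_to_disc:
  assumes G: "open G" and r: "0 < r" "r \<le> 1" and g: "g holomorphic_on ball 0 r" "g ` ball 0 r \<subseteq> G"
    and cont: "\<And>\<zeta>. norm \<zeta> < 1 \<Longrightarrow> continuable_along G (linepath 0 \<zeta>) g"
  obtains H where "H holomorphic_on ball 0 1" "\<And>w. w \<in> ball 0 r \<Longrightarrow> H w = g w" "H ` ball 0 1 \<subseteq> G"
proof -
  have "\<exists>H. H holomorphic_on ball 0 1 \<and> (\<forall>w\<in>ball 0 r. H w = g w) \<and> (\<forall>w\<in>ball 0 1. H w \<in> G)"
  proof (rule holomorphic_extension_to_disc[where \<Phi> = "\<lambda>w z d. z \<in> G", OF r g(1)])
    show "g w \<in> G" if "w \<in> ball 0 r" for w using g(2) that by blast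
    fix R h \<zeta>
    assume R: "r \<le> R" "R < 1" and h: "h holomorphic_on ball 0 R" and hg: "\<And>w. w \<in> ball 0 r \<Longrightarrow> h w = g w"
      and \<zeta>: "norm (\<zeta>::complex) = R"
    have R0: "0 < R" using R r by simp
    have lp: "linepath 0 \<zeta> s = of_real s * \<zeta>" for s by (simp add: linepath_def scaleR_conv_of_real)
    obtain F where F: "continuation_along G (linepath 0 \<zeta>) F" "\<forall>\<^sub>F z in nhds 0. F 0 z = g z"
      using cont[of \<zeta>] R \<zeta> unfolding continuable_along_def by auto
    have "\<forall>\<^sub>F z in nhds 0. z \<in> ball 0 r" using r(1) by (rule eventually_nhds_ball)
    with F(2) have start: "\<forall>\<^sub>F z in nhds 0. F 0 z = h z" by eventually_elim (simp add: hg)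
    have F1: "F 1 analytic_on {\<zeta>}" "F 1 \<zeta> \<in> G" using F(1) unfolding continuation_along_def lp by (auto dest: bspec[of _ _ 1])
    have "\<exists>\<delta>>0. \<forall>s\<in>{0..1}. \<bar>s - 1\<bar> < \<delta> \<longrightarrow> (\<forall>\<^sub>F z in nhds (of_real s * \<zeta>). F s z = F 1 z)"
      using F(1) unfolding continuation_along_def lp by (metis atLeastAtMost_iff order_refl zero_le_one)
    then obtain d where d: "d > 0" "\<And>s. s \<in> {0..1} \<Longrightarrow> \<bar>s - 1\<bar> < d \<Longrightarrow> \<forall>\<^sub>F z in nhds (of_real s * \<zeta>). F s z = F 1 z"
      by blast
    obtain \<rho> where \<rho>: "\<rho> > 0" "F 1 holomorphic_on ball \<zeta> \<rho>" "F 1 ` ball \<zeta> \<rho> \<subseteq> G" "ball \<zeta> \<rho> \<subseteq> UNIV"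
      by (rule analytic_at_obtain_ball[OF F1(1) G F1(2) open_UNIV UNIV_I], intro that)
    define s where "s = 1 - min (min d \<rho>) 1 / 2"
    have s: "0 \<le> s" "s < 1" "\<bar>s - 1\<bar> < d" "\<bar>s - 1\<bar> < \<rho>" using d(1) \<rho>(1) by (auto simp: s_def)
    have sb: "of_real s * \<zeta> \<in> ball \<zeta> \<rho> \<inter> ball 0 R"
    proof -
      have "\<zeta> - of_real s * \<zeta> = of_real (1 - s) * \<zeta>" by (simp add: algebra_simps)
      then have "dist \<zeta> (of_real s * \<zeta>) = \<bar>s - 1\<bar> * R" using \<zeta> by (simp add: dist_norm norm_mult abs_minus_commute del: of_real_diff)
      also have "\<dots> \<le> \<bar>s - 1\<bar>" using R R0 by (simp add: mult_left_le)
      finally show ?thesis using s R0 \<zeta> by (simp add: norm_mult)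
    qed
    have "\<forall>\<^sub>F z in nhds (of_real s * \<zeta>). F s z = h z"
      by (rule continuation_along_radius_agrees[OF R0 R(2) h \<zeta> F(1) start s(1,2)])
    moreover have "\<forall>\<^sub>F z in nhds (of_real s * \<zeta>). F s z = F 1 z" using d(2) s by simp
    ultimately have ev: "\<forall>\<^sub>F z in nhds (of_real s * \<zeta>). F 1 z = h z" by eventually_elim simp
    have "F 1 w = h w" if "w \<in> ball \<zeta> \<rho> \<inter> ball 0 R" for w
      by (rule eventually_eq_imp_eq_on_connected[OF _ _ sb _ _ ev that])
         (use \<rho>(2) h in \<open>auto intro!: convex_connected convex_Int elim: holomorphic_on_subset\<close>)
    then show "\<exists>\<delta>>0. \<exists>k. k holomorphic_on ball \<zeta> \<delta> \<and> (\<forall>w\<in>ball \<zeta> \<delta> \<inter> ball 0 R. k w = h w) \<and> (\<forall>w\<in>ball \<zeta> \<delta>. k w \<in> G)"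
      using \<rho> by (intro exI[of _ \<rho>] conjI exI[of _ "F 1"]) auto
  qed
  then show thesis using that by blast
qed

lemma curvature_minus_one_SK_metric:
  assumes "open G" "G \<noteq> {}" and reg: "regular_conformal_metric G lam" and "\<forall>z\<in>G. curvature lam z = -1"
  shows "SK_metric G lam"
  unfolding SK_metric_def
proof (intro conjI ballI impI)
  have pos: "lam z > 0" if "z \<in> G" for z using reg that by (simp add: regular_conformal_metric_def)
  show "continuous_on G lam" by (rule regular_conformal_metric_continuous[OF reg])
  show "0 \<le> lam z" if "z \<in> G" for z using pos[OF that] by simp
  show "\<exists>z\<in>G. lam z \<noteq> 0" using \<open>G \<noteq> {}\<close> pos by fastforce
  show "ereal ((lam z)\<^sup>2) \<le> lower_laplacian (\<lambda>w. ln (lam w)) z" if "z \<in> G" for z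
    using lower_laplacian_eq[OF log_conformal_metric_has_laplacian[OF assms(1) reg assms(4) that]] by simp
qed

text \<open>
  For given \<open>z\<close> use the developing map that starts with a germ vanishing at \<open>z\<close>. Its inverse branch at the origin
  extends to a holomorphic map \<open>H\<close> of the disc into \<open>G\<close> with \<open>H 0 = z\<close>, and Ahlfors' lemma for \<open>H\<close> compares an
  arbitrary SK-metric with \<open>lam\<close> at \<open>z\<close>.
\<close>
theorem continuable_imp_hyperbolic:
  assumes G: "open G" "G \<noteq> {}" and reg: "regular_conformal_metric G lam"
    and curv: "\<forall>z\<in>G. curvature lam z = -1"
    and cont: "\<forall>f. developing_map G lam f \<longrightarrow>
           (\<forall>w0 g \<gamma>. inverse_branch f w0 g \<and> valid_path \<gamma> \<and> path_image \<gamma> \<subseteq> ball 0 1 \<and>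
              pathstart \<gamma> = w0 \<longrightarrow> continuable_along G \<gamma> g)"
  shows "is_hyperbolic_metric G lam"
proof -
  have SKlam: "SK_metric G lam" by (rule curvature_minus_one_SK_metric[OF G reg curv])
  have max: "\<mu> z \<le> lam z" if SK: "SK_metric G \<mu>" and z: "z \<in> G" for \<mu> z
  proof -
    obtain r \<phi> where r: "r > 0" "ball z r \<subseteq> G" "\<phi> holomorphic_on ball z r" "\<phi> z = 0"
      and \<phi>: "\<forall>x\<in>ball z r. norm (\<phi> x) < 1 \<and> lam x = 2 * norm (deriv \<phi> x) / (1 - (norm (\<phi> x))\<^sup>2)"
      using liouville_local_representation[OF G(1) reg curv z] by blast
    have zb: "z \<in> ball z r" using r(1) by simp
    have pos: "lam z > 0" using reg z by (simp add: regular_conformal_metric_def)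
    have lz: "lam z = 2 * norm (deriv \<phi> z)" using \<phi> zb r(4) by auto
    then have nz: "deriv \<phi> z \<noteq> 0" using pos by auto
    obtain r' k where r': "r' > 0" "ball z r' \<subseteq> ball z r" "inj_on \<phi> (ball z r')" "open (\<phi> ` ball z r')"
      and k: "k holomorphic_on \<phi> ` ball z r'" "\<And>x. x \<in> ball z r' \<Longrightarrow> k (\<phi> x) = x"
        "\<And>x. x \<in> ball z r' \<Longrightarrow> deriv \<phi> x * deriv k (\<phi> x) = 1"
      by (rule local_inverse[OF r(3) open_ball zb nz], intro that)
    have zb': "z \<in> ball z r'" using r'(1) by simp
    have an: "\<phi> analytic_on {z}" using r(3) zb unfolding analytic_at by blast
    have im0: "0 \<in> \<phi> ` ball z r'" using r(4) zb' by force
    define f where "f = {(x, \<psi>). \<exists>\<gamma> F. valid_path \<gamma> \<and> path_image \<gamma> \<subseteq> G \<and>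
               pathstart \<gamma> = z \<and> pathfinish \<gamma> = x \<and>
               continuation_along (ball 0 1) \<gamma> F \<and>
               (\<forall>\<^sub>F w in nhds z. F 0 w = \<phi> w) \<and> (\<forall>\<^sub>F w in nhds x. F 1 w = \<psi> w)}"
    have rep: "represents_metric_at lam \<phi> z"
      unfolding represents_metric_at_def
    proof (intro conjI)
      show "\<exists>U. open U \<and> z \<in> U \<and> inj_on \<phi> U" using r' zb' by (intro exI[of _ "ball z r'"]) auto
      show "\<forall>\<^sub>F w in nhds z. lam w = 2 * norm (deriv \<phi> w) / (1 - (norm (\<phi> w))\<^sup>2)"
        using eventually_nhds_in_open[OF open_ball zb] by eventually_elim (use \<phi> in blast)
    qed (use an r(4) in auto)
    have dev: "developing_map G lam f"
      unfolding developing_map_def f_def using z rep by (intro bexI[of _ z] exI[of _ \<phi>] conjI) auto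
    have mem: "(z, \<phi>) \<in> f"
    proof -
      have "continuation_along (ball 0 1) (linepath z z) (\<lambda>_. \<phi>)"
        unfolding continuation_along_def using an r(4) by (auto simp: linepath_def algebra_simps intro!: exI[of _ "1::real"])
      then show ?thesis unfolding f_def using z
        by (auto intro!: exI[of _ "linepath z z"] exI[of _ "\<lambda>_::real. \<phi>"])
    qed
    have inv: "inverse_branch f 0 k"
      unfolding inverse_branch_def
    proof (intro exI conjI)
      show "(z, \<phi>) \<in> f" by (rule mem)
      show "k analytic_on {0}" using k(1) r'(4) im0 unfolding analytic_at by blast
      show "\<forall>\<^sub>F x in nhds z. k (\<phi> x) = x"
        using eventually_nhds_in_open[OF open_ball zb'] by eventually_elim (rule k(2))
      show "\<forall>\<^sub>F w in nhds 0. \<phi> (k w) = w"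
        using eventually_nhds_in_open[OF r'(4) im0] by eventually_elim (use k(2) in auto)
    qed (use r(4) in simp)
    have rad: "continuable_along G (linepath 0 \<zeta>) k" if "norm \<zeta> < 1" for \<zeta>
    proof -
      have "path_image (linepath 0 \<zeta>) \<subseteq> ball 0 1" using that by (simp add: closed_segment_subset)
      then show ?thesis using cont dev inv by simp
    qed
    obtain e where e: "e > 0" "ball 0 e \<subseteq> \<phi> ` ball z r'" using r'(4) im0 open_contains_ball by blast
    define r0 where "r0 = min e 1"
    have r0: "0 < r0" "r0 \<le> 1" "ball 0 r0 \<subseteq> \<phi> ` ball z r'" using e by (auto simp: r0_def)
    have k0: "k holomorphic_on ball 0 r0" using k(1) r0(3) holomorphic_on_subset by blast
    have kG: "k ` ball 0 r0 \<subseteq> G"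
    proof
      fix y assume "y \<in> k ` ball 0 r0"
      then obtain x where "x \<in> ball z r'" "y = k (\<phi> x)" using r0(3) by auto
      then show "y \<in> G" using k(2) r' r(2) by auto
    qed
    obtain H where H: "H holomorphic_on ball 0 1" "\<And>w. w \<in> ball 0 r0 \<Longrightarrow> H w = k w" "H ` ball 0 1 \<subseteq> G"
      by (rule radially_continuable_extends_to_disc[OF G(1) r0(1,2) k0 kG rad], assumption, intro that)
    have "\<mu> (H 0) * norm (deriv H 0) \<le> 2" by (rule ahlfors_lemma[OF G(1) SK H(1,3)])
    moreover have z0r: "(0::complex) \<in> ball 0 r0" using r0(1) by simp
    have "H 0 = z" using H(2)[OF z0r] k(2)[OF zb'] r(4) by simp
    moreover have "deriv H 0 = deriv k 0" by (rule deriv_eq_on_open[OF open_ball z0r H(2)])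
    moreover have n1: "norm (deriv \<phi> z) * norm (deriv k 0) = 1" using k(3)[OF zb'] r(4) by (metis norm_mult norm_one)
    ultimately have "\<mu> z * norm (deriv k 0) \<le> (2 * norm (deriv \<phi> z)) * norm (deriv k 0)" by simp
    moreover have "norm (deriv k 0) > 0" using n1 by (cases "deriv k 0 = 0") auto
    ultimately show ?thesis unfolding lz by (simp add: mult_le_cancel_right)
  qed
  have "ereal (lam z) = (SUP \<mu> \<in> {\<mu>. SK_metric G \<mu>}. ereal (\<mu> z))" if "z \<in> G" for z
  proof (rule antisym)
    show "ereal (lam z) \<le> (SUP \<mu> \<in> {\<mu>. SK_metric G \<mu>}. ereal (\<mu> z))" using SKlam by (intro SUP_upper) simp
    show "(SUP \<mu> \<in> {\<mu>. SK_metric G \<mu>}. ereal (\<mu> z)) \<le> ereal (lam z)" using max that by (intro SUP_least) simp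
  qed
  then show ?thesis using SKlam unfolding is_hyperbolic_metric_def by blast
qed

section \<open>SK-metrics with a cusp\<close>

lemma has_derivative_ln_norm:
  assumes "z \<noteq> a"
  shows "((\<lambda>x. ln (norm (x - a))) has_derivative (\<lambda>k. Re (k / (z - a)))) (at z)"
proof -
  define y where "y = z - a"
  have y: "y \<noteq> 0" using assms by (simp add: y_def)
  have "((\<lambda>x. x - a) has_derivative (\<lambda>k. k)) (at z)" by (auto intro!: derivative_eq_intros)
  from has_derivative_compose[OF this has_derivative_norm[of "z - a"]] assms
  have "((\<lambda>x. norm (x - a)) has_derivative (\<lambda>k. inner (sgn y) k)) (at z)" by (simp add: y_def inner_commute)
  from has_derivative_ln[OF _ this]
  have "((\<lambda>x. ln (norm (x - a))) has_derivative (\<lambda>k. inner (sgn y) k * inverse (norm y))) (at z)"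
    using y by (simp add: y_def mult.commute)
  moreover have "inner (sgn y) k * inverse (norm y) = Re (k / y)" for k
  proof -
    have "k / y = (1 / (norm y)\<^sup>2) *\<^sub>R (k * cnj y)"
      using y by (simp add: complex_div_cnj[of k y] scaleR_conv_of_real)
    then have "Re (k / y) = 1 / (norm y)\<^sup>2 * Re (k * cnj y)" by (simp only: scaleR_complex.sel)
    then show ?thesis
      using y by (simp add: sgn_div_norm inner_complex_def power2_eq_square field_simps)
  qed
  ultimately show ?thesis by (simp add: y_def)
qed

lemma has_laplacian_radial:
  assumes z: "z \<noteq> a"
    and d1: "\<forall>\<^sub>F s in nhds (ln (norm (z - a))). (ch has_real_derivative ch' s) (at s)"
    and d2: "(ch' has_real_derivative c) (at (ln (norm (z - a))))"
  shows "has_laplacian (\<lambda>x. ch (ln (norm (x - a)))) z (c / (norm (z - a))\<^sup>2)"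
proof (rule has_laplacianI[where w = "\<lambda>x. of_real (ch' (ln (norm (x - a)))) / (2 * (x - a))" and
      P = "of_real c / (4 * (z - a)\<^sup>2) - of_real (ch' (ln (norm (z - a)))) / (2 * (z - a)\<^sup>2)"])
  have "isCont (\<lambda>x. ln (norm (x - a))) z"
    using has_derivative_continuous[OF has_derivative_ln_norm[OF z]] .
  then have "filterlim (\<lambda>x. ln (norm (x - a))) (nhds (ln (norm (z - a)))) (nhds z)"
    by (metis isCont_def tendsto_at_iff_tendsto_nhds)
  from eventually_compose_filterlim[OF d1 this]
  have ev: "\<forall>\<^sub>F x in nhds z. (ch has_real_derivative ch' (ln (norm (x - a)))) (at (ln (norm (x - a))))" .
  have "\<forall>\<^sub>F x in nhds z. x \<noteq> a" using z by (intro t1_space_nhds)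
  with ev show "\<forall>\<^sub>F x in nhds z. ((\<lambda>x. ch (ln (norm (x - a)))) has_derivative
      (\<lambda>k. 2 * Re (of_real (ch' (ln (norm (x - a)))) / (2 * (x - a)) * k))) (at x)"
  proof eventually_elim
    case (elim x)
    have "((\<lambda>x. ch (ln (norm (x - a)))) has_derivative (\<lambda>k. ch' (ln (norm (x - a))) * Re (k / (x - a)))) (at x)"
      using has_derivative_compose[OF has_derivative_ln_norm[OF elim(2)] elim(1)[unfolded has_field_derivative_def]] .
    moreover have "ch' (ln (norm (x - a))) * Re (k / (x - a)) = 2 * Re (of_real (ch' (ln (norm (x - a)))) / (2 * (x - a)) * k)" for k
    proof -
      have "of_real (ch' (ln (norm (x - a)))) / (2 * (x - a)) * k = (ch' (ln (norm (x - a))) / 2) *\<^sub>R (k / (x - a))"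
        by (simp add: scaleR_conv_of_real)
      then show ?thesis by (simp only: scaleR_complex.sel)
    qed
    ultimately show ?case by simp
  qed
  define y where "y = z - a"
  define p where "p = ch' (ln (norm y))"
  have y: "y \<noteq> 0" using z by (simp add: y_def)
  have dn: "((\<lambda>x. complex_of_real (ch' (ln (norm (x - a))))) has_derivative (\<lambda>k. of_real (c * Re (k / y)))) (at z)"
    using has_derivative_of_real[OF has_derivative_compose[OF has_derivative_ln_norm[OF z] d2[unfolded has_field_derivative_def]]]
    by (simp add: y_def)
  have dd: "((\<lambda>x. 2 * (x - a)) has_derivative (\<lambda>k. 2 * k)) (at z)" by (auto intro!: derivative_eq_intros)
  have "((\<lambda>x. of_real (ch' (ln (norm (x - a)))) / (2 * (x - a))) has_derivative
     (\<lambda>k. - of_real p * (inverse (2 * y) * (2 * k) * inverse (2 * y)) + of_real (c * Re (k / y)) / (2 * y))) (at z)"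
    using has_derivative_divide[OF dn dd] z by (simp add: y_def p_def)
  then show "((\<lambda>x. of_real (ch' (ln (norm (x - a)))) / (2 * (x - a))) has_derivative
     (\<lambda>k. (of_real c / (4 * (z - a)\<^sup>2) - of_real (ch' (ln (norm (z - a)))) / (2 * (z - a)\<^sup>2)) * k
        + of_real (c / (norm (z - a))\<^sup>2 / 4) * cnj k)) (at z)"
  proof (rule has_derivative_eq_rhs)
    have re: "complex_of_real (c * Re (k / y)) = of_real c * (k / y + cnj k / cnj y) / 2" for k
      unfolding complex_cnj_divide[symmetric] complex_add_cnj by simp
    have nm: "complex_of_real (c / (norm y)\<^sup>2 / 4) = of_real c / (y * cnj y) / 4"
      by (simp only: of_real_divide complex_norm_square of_real_numeral)
    show "(\<lambda>k. - of_real p * (inverse (2 * y) * (2 * k) * inverse (2 * y)) + of_real (c * Re (k / y)) / (2 * y)) =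
      (\<lambda>k. (of_real c / (4 * (z - a)\<^sup>2) - of_real (ch' (ln (norm (z - a)))) / (2 * (z - a)\<^sup>2)) * k
        + of_real (c / (norm (z - a))\<^sup>2 / 4) * cnj k)"
      unfolding y_def[symmetric] p_def[symmetric] re nm
      using y by (simp add: fun_eq_iff field_simps power2_eq_square)
  qed
qed

text \<open>
  The logarithm of \<open>sqrt (1 + r powr (2/5)) / r powr (4/5)\<close> as a function of \<open>s = ln r\<close>: the factor that one
  puncture contributes to a metric of negative curvature on the twice punctured plane.
\<close>
definition twice_punctured_log :: "real \<Rightarrow> real" where
  "twice_punctured_log s = ln (1 + exp (2 / 5 * s)) / 2 - 4 / 5 * s"

lemma has_laplacian_twice_punctured_log:
  assumes "z \<noteq> a"
  defines "X \<equiv> exp (2 / 5 * ln (norm (z - a)))"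
  shows "has_laplacian (\<lambda>x. twice_punctured_log (ln (norm (x - a)))) z (2 / 25 / ((1 + X)\<^sup>2 * X ^ 4))"
proof -
  define ch' where "ch' s = exp (2 / 5 * s) / (1 + exp (2 / 5 * s)) / 5 - 4 / 5" for s :: real
  define E where "E s = exp (2 / 5 * s)" for s :: real
  have E: "1 + E s > 0" for s by (simp add: E_def add_pos_pos)
  have dE0: "(E has_real_derivative 2 / 5 * E s) (at s)" for s
    unfolding E_def[abs_def] by (auto intro!: derivative_eq_intros)
  have dE: "((\<lambda>s. 1 + E s) has_real_derivative 2 / 5 * E s) (at s)" for s
    using DERIV_add[OF DERIV_const dE0, of 1 s] by simp
  have d1: "(twice_punctured_log has_real_derivative ch' s) (at s)" for s
  proof -
    have "((\<lambda>s. ln (1 + E s) / 2 - 4 / 5 * s) has_real_derivative inverse (1 + E s) * (2 / 5 * E s) / 2 - 4 / 5 * 1) (at s)"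
      by (intro DERIV_diff DERIV_cdivide DERIV_chain2[OF DERIV_ln dE] DERIV_cmult DERIV_ident E)
    moreover have "inverse (1 + E s) * (2 / 5 * E s) / 2 - 4 / 5 * 1 = ch' s"
    proof -
      have "inverse (1 + e) * (2 / 5 * e) / 2 - 4 / 5 * 1 = e / (1 + e) / 5 - 4 / 5" for e :: real
        by (cases "1 + e = 0") (simp_all add: divide_simps algebra_simps)
      then show ?thesis unfolding ch'_def E_def .
    qed
    ultimately show ?thesis unfolding twice_punctured_log_def[abs_def] E_def by simp
  qed
  have d2: "(ch' has_real_derivative 2 / 25 * exp (2 / 5 * s) / (1 + exp (2 / 5 * s))\<^sup>2) (at s)" for s
  proof -
    have nz: "1 + E s \<noteq> 0" using E[of s] by simp
    have "((\<lambda>s. E s / (1 + E s) / 5 - 4 / 5) has_real_derivative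
        (2 / 5 * E s * (1 + E s) - E s * (2 / 5 * E s)) / ((1 + E s) * (1 + E s)) / 5 - 0) (at s)"
      by (intro DERIV_diff DERIV_cdivide DERIV_divide dE0 dE DERIV_const nz)
    moreover have "(2 / 5 * E s * (1 + E s) - E s * (2 / 5 * E s)) / ((1 + E s) * (1 + E s)) / 5 - 0
        = 2 / 25 * E s / (1 + E s)\<^sup>2"
    proof -
      have num: "2 / 5 * E s * (1 + E s) - E s * (2 / 5 * E s) = 2 / 5 * E s" by (simp add: algebra_simps)
      show ?thesis unfolding num power2_eq_square by simp
    qed
    ultimately show ?thesis unfolding ch'_def[abs_def] E_def by simp
  qed
  have X: "X > 0" by (simp add: X_def)
  have "X ^ 5 = exp (2 * ln (norm (z - a)))" unfolding X_def by (simp flip: exp_of_nat_mult)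
  also have "\<dots> = (norm (z - a))\<^sup>2" using assms by (simp add: exp_double)
  finally have X5: "(norm (z - a))\<^sup>2 = X ^ 5" by simp
  have "has_laplacian (\<lambda>x. twice_punctured_log (ln (norm (x - a)))) z
     (2 / 25 * exp (2 / 5 * ln (norm (z - a))) / (1 + exp (2 / 5 * ln (norm (z - a))))\<^sup>2 / (norm (z - a))\<^sup>2)"
    by (rule has_laplacian_radial[OF assms(1) _ d2]) (simp add: d1)
  also have "2 / 25 * exp (2 / 5 * ln (norm (z - a))) / (1 + exp (2 / 5 * ln (norm (z - a))))\<^sup>2 / (norm (z - a))\<^sup>2
     = 2 / 25 / ((1 + X)\<^sup>2 * X ^ 4)"
  proof -
    have "2 / 25 * x / D / (F * x) = 2 / 25 / (D * F)" if "x \<noteq> 0" for x D F :: real using that by simp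
    from this[of X "(1 + X)\<^sup>2" "X ^ 4"] X show ?thesis
      unfolding X5 X_def[symmetric] by (simp only: power_Suc2[symmetric] numeral_eq_Suc pred_numeral_simps)
  qed
  finally show ?thesis .
qed

text \<open>
  The metric \<open>exp u\<close> is a multiple of the product of the factors of the two punctures. The exponents are
  chosen such that the contribution of the nearer puncture to the Laplacian dominates \<open>exp (2 * u)\<close> up to a
  constant, near both punctures and near \<open>\<infinity>\<close>; the constant \<open>C\<close> absorbs the rest.
\<close>
lemma twice_punctured_plane_metric:
  assumes "a \<noteq> (b :: complex)"
  obtains u where "\<And>z. z \<noteq> a \<Longrightarrow> z \<noteq> b \<Longrightarrow> \<exists>L. has_laplacian u z L \<and> exp (2 * u z) \<le> L"
proof -
  define X where "X c z = exp (2 / 5 * ln (norm (z - c)))" for c z :: complex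
  define m where "m = exp (2 / 5 * ln (norm (a - b) / 2))"
  define C where "C = 2 / 25 / (1 + 1 / m) ^ 4"
  have m: "m > 0" by (simp add: m_def)
  have "1 + 1 / m > 0" using divide_pos_pos[OF zero_less_one m] by linarith
  then have C: "C > 0" by (simp only: C_def zero_less_power divide_pos_pos zero_less_numeral)
  define u where "u z = ln C / 2 + (twice_punctured_log (ln (norm (z - a))) + twice_punctured_log (ln (norm (z - b))))" for z
  have X: "X c z > 0" for c z by (simp add: X_def)
  \<comment> \<open>Here \<open>x\<close> belongs to the nearer puncture; the distance of the other one is at least half that of \<open>a\<close> and \<open>b\<close>.\<close>
  have ineq: "C * ((1 + x) * (1 + y) / (x ^ 4 * y ^ 4)) \<le> 2 / 25 / ((1 + x)\<^sup>2 * x ^ 4)"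
    if "0 < x" "x \<le> y" "m \<le> y" for x y :: real
  proof -
    have y: "y > 0" using that by simp
    have "1 + y \<le> (1 + 1 / m) * y" using that m y by (simp add: field_simps)
    then have b: "(1 + y) ^ 4 \<le> ((1 + 1 / m) * y) ^ 4" using y by (intro power_mono) auto
    have "(1 + x) ^ 3 * (1 + y) \<le> (1 + y) ^ 3 * (1 + y)"
      using that by (intro mult_right_mono power_mono) auto
    also have "\<dots> = (1 + y) ^ 4" by (simp add: eval_nat_numeral)
    finally have "C * ((1 + x) ^ 3 * (1 + y)) \<le> C * (((1 + 1 / m) * y) ^ 4)"
      using b C by (intro mult_left_mono) auto
    also have "\<dots> = 2 / 25 * y ^ 4" 
    proof -
      have "1 / m > 0" using m by simp
      then have "1 + 1 / m \<noteq> 0" by linarith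
      then show ?thesis by (simp add: C_def power_mult_distrib)
    qed
    finally have key: "C * ((1 + x) ^ 3 * (1 + y)) \<le> 2 / 25 * y ^ 4" .
    have "C * ((1 + x) * (1 + y) / (x ^ 4 * y ^ 4)) = C * ((1 + x) ^ 3 * (1 + y)) / ((1 + x)\<^sup>2 * x ^ 4 * y ^ 4)"
    proof -
      have "C * (p * q / (F * K)) = C * (D * p * q) / (D * F * K)" if "D \<noteq> 0" for p q D F K :: real using that by simp
      moreover have "(1 + x) ^ 3 = (1 + x)\<^sup>2 * (1 + x)" by (simp add: eval_nat_numeral)
      ultimately show ?thesis using \<open>0 < x\<close> by simp
    qed
    also have "\<dots> \<le> 2 / 25 * y ^ 4 / ((1 + x)\<^sup>2 * x ^ 4 * y ^ 4)"
      using key that y by (intro divide_right_mono) auto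
    also have "\<dots> = 2 / 25 / ((1 + x)\<^sup>2 * x ^ 4)" using y that by simp
    finally show ?thesis .
  qed
  have "\<exists>L. has_laplacian u z L \<and> exp (2 * u z) \<le> L" if z: "z \<noteq> a" "z \<noteq> b" for z
  proof (intro exI conjI)
    let ?L = "0 + (2 / 25 / ((1 + X a z)\<^sup>2 * X a z ^ 4) + 2 / 25 / ((1 + X b z)\<^sup>2 * X b z ^ 4))"
    show "has_laplacian u z ?L"
      unfolding u_def[abs_def] X_def
      by (intro has_laplacian_add has_laplacian_const has_laplacian_twice_punctured_log z)
    have tw: "exp (2 * twice_punctured_log (ln (norm (z - c)))) = (1 + X c z) / X c z ^ 4" for c
    proof -
      have "exp (2 * twice_punctured_log (ln (norm (z - c)))) = exp (ln (1 + X c z)) / exp (4 * (2 / 5 * ln (norm (z - c))))"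
        by (simp add: twice_punctured_log_def X_def exp_diff[symmetric])
      also have "exp (ln (1 + X c z)) = 1 + X c z" using X[of c z] by (simp add: add_pos_pos)
      also have "exp (4 * (2 / 5 * ln (norm (z - c)))) = X c z ^ 4"
        using exp_of_nat_mult[of 4 "2 / 5 * ln (norm (z - c))"] by (simp add: X_def)
      finally show ?thesis .
    qed
    have "2 * u z = ln C + (2 * twice_punctured_log (ln (norm (z - a))) + 2 * twice_punctured_log (ln (norm (z - b))))"
      by (simp add: u_def)
    then have "exp (2 * u z) = C * ((1 + X a z) / X a z ^ 4 * ((1 + X b z) / X b z ^ 4))"
      using C by (simp add: exp_add tw)
    then have eu: "exp (2 * u z) = C * ((1 + X a z) * (1 + X b z) / (X a z ^ 4 * X b z ^ 4))" by simp
    have Xmono: "X c z \<le> X d z" if "norm (z - c) \<le> norm (z - d)" "z \<noteq> c" for c d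
    proof -
      have "0 < norm (z - c)" using that(2) by simp
      moreover from this that(1) have "0 < norm (z - d)" by (rule less_le_trans)
      ultimately have "ln (norm (z - c)) \<le> ln (norm (z - d))" using that(1) by (simp only: ln_le_cancel_iff)
      then show ?thesis unfolding X_def by simp
    qed
    have Xm: "m \<le> X c z" if "norm (a - b) / 2 \<le> norm (z - c)" "z \<noteq> c" for c
    proof -
      have "0 < norm (a - b) / 2" "0 < norm (z - c)" using that(2) assms by simp_all
      then have "ln (norm (a - b) / 2) \<le> ln (norm (z - c))" using that(1) by (simp only: ln_le_cancel_iff)
      then show ?thesis unfolding X_def m_def by simp
    qed
    have tri: "norm (a - b) \<le> norm (z - a) + norm (z - b)"
      using norm_triangle_ineq4[of "z - b" "z - a"] by (simp add: norm_minus_commute)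
    have nn: "0 \<le> 2 / 25 / ((1 + X c z)\<^sup>2 * X c z ^ 4)" for c using X[of c z] by simp
    show "exp (2 * u z) \<le> ?L"
    proof (cases "norm (z - a) \<le> norm (z - b)")
      case True
      then have "C * ((1 + X a z) * (1 + X b z) / (X a z ^ 4 * X b z ^ 4)) \<le> 2 / 25 / ((1 + X a z)\<^sup>2 * X a z ^ 4)"
        using z tri by (intro ineq X Xmono Xm) auto
      then show ?thesis unfolding eu using nn[of b] by linarith
    next
      case False
      then have "C * ((1 + X b z) * (1 + X a z) / (X b z ^ 4 * X a z ^ 4)) \<le> 2 / 25 / ((1 + X b z)\<^sup>2 * X b z ^ 4)"
        using z tri by (intro ineq X Xmono Xm) auto
      then show ?thesis
        unfolding eu mult.commute[of "1 + X b z"] mult.commute[of "X b z ^ 4"] using nn[of a] by linarith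
    qed
  qed
  then show thesis by (rule that)
qed

text \<open>
  For \<open>c = 0\<close> this says that the density \<open>1 / (\<bar>z - a\<bar> \<bar>ln \<bar>z - a\<bar> - \<sigma>\<bar>)\<close> has curvature \<open>-1\<close>. It is the hyperbolic density of a
  punctured disc around \<open>a\<close> if \<open>\<kappa> = - 1\<close>, and of the exterior of a disc if \<open>\<kappa> = 1\<close>.
\<close>
lemma has_laplacian_cusp:
  assumes "z \<noteq> a" and \<kappa>: "\<kappa> = 1 \<or> \<kappa> = (-1::real)" and \<tau>: "\<kappa> * (ln (norm (z - a)) - \<sigma>) > 0"
  shows "has_laplacian (\<lambda>x. c - ln (norm (x - a)) - ln (\<kappa> * (ln (norm (x - a)) - \<sigma>))) z
     (1 / (norm (z - a) * (\<kappa> * (ln (norm (z - a)) - \<sigma>)))\<^sup>2)"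
proof -
  define s0 where "s0 = ln (norm (z - a))"
  have k2: "\<kappa> * \<kappa> = 1" using \<kappa> by auto
  have op: "open {s. \<kappa> * (s - \<sigma>) > 0}" by (intro open_Collect_less continuous_intros)
  have d1: "((\<lambda>s. c - s - ln (\<kappa> * (s - \<sigma>))) has_real_derivative - 1 - 1 / (s - \<sigma>)) (at s)" if "\<kappa> * (s - \<sigma>) > 0" for s
    using that \<kappa> by (auto intro!: derivative_eq_intros simp: field_simps)
  have "\<forall>\<^sub>F s in nhds s0. \<kappa> * (s - \<sigma>) > 0"
    using eventually_nhds_in_open[OF op, of s0] \<tau> by (simp add: s0_def)
  then have ev: "\<forall>\<^sub>F s in nhds s0. ((\<lambda>s. c - s - ln (\<kappa> * (s - \<sigma>))) has_real_derivative - 1 - 1 / (s - \<sigma>)) (at s)"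
    by eventually_elim (rule d1)
  have ne: "s0 - \<sigma> \<noteq> 0" using \<tau> by (auto simp: s0_def)
  have d2: "((\<lambda>s. - 1 - 1 / (s - \<sigma>)) has_real_derivative 1 / (s0 - \<sigma>)\<^sup>2) (at s0)"
    using ne by (auto intro!: derivative_eq_intros simp: power2_eq_square field_simps)
  have "has_laplacian (\<lambda>x. c - ln (norm (x - a)) - ln (\<kappa> * (ln (norm (x - a)) - \<sigma>))) z
     (1 / (s0 - \<sigma>)\<^sup>2 / (norm (z - a))\<^sup>2)"
    using has_laplacian_radial[OF assms(1) ev[unfolded s0_def] d2[unfolded s0_def]] by (simp add: s0_def)
  moreover have "(\<kappa> * (s0 - \<sigma>))\<^sup>2 = (s0 - \<sigma>)\<^sup>2" using \<kappa> by (auto simp: power2_eq_square algebra_simps)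
  moreover have "1 / (s0 - \<sigma>)\<^sup>2 / (norm (z - a))\<^sup>2 = 1 / (norm (z - a) * (\<kappa> * (s0 - \<sigma>)))\<^sup>2"
    unfolding power_mult_distrib[of "norm (z - a)"] calculation(2) by simp
  ultimately show ?thesis by (simp only: s0_def)
qed

lemma lower_laplacian_ge_touching:
  assumes "open V" "z \<in> V" "continuous_on V v" and lap: "has_laplacian u z L"
    and le: "\<And>x. x \<in> V \<Longrightarrow> u x \<le> v x" and eq: "u z = v z"
  shows "ereal L \<le> lower_laplacian v z"
proof -
  obtain d1 where d1: "d1 > 0" "ball z d1 \<subseteq> V" using assms(1,2) by (rule openE)
  obtain d2 where d2: "d2 > 0" "continuous_on (ball z d2) u" using has_laplacian_continuous[OF lap] by blast
  define d where "d = min d1 d2"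
  have d: "d > 0" "ball z d \<subseteq> V" "ball z d \<subseteq> ball z d2" using d1 d2 by (auto simp: d_def)
  have "lower_laplacian u z \<le> lower_laplacian v z"
    using le d eq by (intro lower_laplacian_mono[OF d(1) continuous_on_subset[OF d2(2) d(3)] continuous_on_subset[OF assms(3) d(2)]]) auto
  then show ?thesis using lower_laplacian_eq[OF lap] by simp
qed

text \<open>
  The cusp density is multiplied by a constant \<open>\<epsilon> \<le> 1\<close>, which preserves the curvature bound, such that on the
  circle \<open>\<tau> = 1\<close> it does not exceed the metric of the twice punctured plane. Beyond this circle, towards
  \<open>a\<close> or towards \<open>\<infinity>\<close>, take the maximum of the two, and elsewhere the metric of the twice punctured plane. At every
  point one of the two metrics touches the result from below, so the curvature bound is inherited.
\<close>
lemma cusp_SK_metric: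
  assumes ab: "a \<noteq> (b :: complex)" and \<kappa>: "\<kappa> = 1 \<or> \<kappa> = (-1::real)"
  obtains \<epsilon> \<sigma> M where "\<epsilon> > 0"
    "\<And>G. \<lbrakk>open G; G \<noteq> {}; a \<notin> G; b \<notin> G\<rbrakk> \<Longrightarrow> SK_metric G M"
    "\<And>z. \<lbrakk>z \<noteq> a; z \<noteq> b; \<kappa> * (ln (norm (z - a)) - \<sigma>) \<ge> 1\<rbrakk> \<Longrightarrow>
        \<epsilon> / (norm (z - a) * (\<kappa> * (ln (norm (z - a)) - \<sigma>))) \<le> M z"
proof -
  obtain u where u: "\<And>z. z \<noteq> a \<Longrightarrow> z \<noteq> b \<Longrightarrow> \<exists>L. has_laplacian u z L \<and> exp (2 * u z) \<le> L"
    by (rule twice_punctured_plane_metric[OF ab], intro that)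
  have uc: "continuous_on (- {a, b}) u"
  proof (rule continuous_at_imp_continuous_on, rule ballI)
    fix z assume "z \<in> - {a, b}"
    then obtain L where "has_laplacian u z L" using u[of z] by auto
    then obtain d where "d > 0" "continuous_on (ball z d) u" using has_laplacian_continuous by blast
    then show "isCont u z" by (simp add: continuous_on_eq_continuous_at)
  qed
  define \<rho> where "\<rho> = (if \<kappa> = 1 then 2 else 1 / 2) * norm (b - a)"
  have \<rho>: "\<rho> > 0" "\<rho> \<noteq> norm (b - a)" using ab by (auto simp: \<rho>_def)
  define \<sigma> where "\<sigma> = ln \<rho> - \<kappa>"
  define \<tau> where "\<tau> z = \<kappa> * (ln (norm (z - a)) - \<sigma>)" for z
  have \<tau>1: "\<tau> z = 1 \<longleftrightarrow> norm (z - a) = \<rho>" if "z \<noteq> a" for z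
  proof -
    have "\<tau> z = 1 \<longleftrightarrow> ln (norm (z - a)) = ln \<rho>" using \<kappa> by (auto simp: \<tau>_def \<sigma>_def)
    then show ?thesis using that \<rho> by simp
  qed
  have sph: "sphere a \<rho> \<subseteq> - {a, b}" using \<rho> by (auto simp: dist_norm norm_minus_commute)
  have "a + of_real \<rho> \<in> sphere a \<rho>" using \<rho> by (simp add: dist_norm)
  then obtain x0 where x0: "\<And>x. x \<in> sphere a \<rho> \<Longrightarrow> u x0 \<le> u x"
    using continuous_attains_inf[OF compact_sphere _ continuous_on_subset[OF uc sph]] by blast
  define \<epsilon> where "\<epsilon> = min 1 (exp (u x0) * \<rho>)"
  have \<epsilon>: "0 < \<epsilon>" "\<epsilon> \<le> 1" "\<epsilon> \<le> exp (u x0) * \<rho>" using \<rho> by (auto simp: \<epsilon>_def)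
  define v where "v z = ln \<epsilon> - ln (norm (z - a)) - ln (\<tau> z)" for z
  have ev: "exp (v z) = \<epsilon> / (norm (z - a) * \<tau> z)" if "z \<noteq> a" "\<tau> z > 0" for z
    using that \<epsilon> by (simp add: v_def exp_diff)
  have vL: "has_laplacian v z (1 / (norm (z - a) * \<tau> z)\<^sup>2)" if "z \<noteq> a" "\<tau> z > 0" for z
    using has_laplacian_cusp[OF that(1) \<kappa> that(2)[unfolded \<tau>_def], of "ln \<epsilon>"] unfolding v_def[abs_def] \<tau>_def .
  have vle: "exp (2 * v z) \<le> 1 / (norm (z - a) * \<tau> z)\<^sup>2" if "z \<noteq> a" "\<tau> z > 0" for z
  proof -
    have "exp (2 * v z) = (\<epsilon> / (norm (z - a) * \<tau> z))\<^sup>2" using ev[OF that] by (simp add: exp_double)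
    also have "\<dots> \<le> (1 / (norm (z - a) * \<tau> z))\<^sup>2" using \<epsilon> that by (intro power_mono divide_right_mono) auto
    finally show ?thesis by (simp add: power_divide)
  qed
  have vu: "v z \<le> u z" if "z \<noteq> a" "\<tau> z = 1" for z
  proof -
    have nz: "norm (z - a) = \<rho>" using \<tau>1 that by simp
    then have "u x0 \<le> u z" by (intro x0) (simp add: dist_norm norm_minus_commute)
    have "exp (v z) = \<epsilon> / \<rho>" using ev[OF that(1)] that(2) nz by simp
    also have "\<dots> \<le> exp (u x0)" using \<epsilon>(3) \<rho> by (simp add: field_simps)
    also have "\<dots> \<le> exp (u z)" using \<open>u x0 \<le> u z\<close> by simp
    finally show ?thesis by simp
  qed
  define p where "p z = (if \<tau> z \<ge> 1 then max (u z) (v z) else u z)" for z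
  have \<tau>c: "continuous_on (- {a, b}) \<tau>" unfolding \<tau>_def[abs_def] by (intro continuous_intros) auto
  have pc: "continuous_on (- {a, b}) p"
  proof -
    have 1: "closedin (top_of_set (- {a, b})) ({z \<in> - {a, b}. 1 \<le> \<tau> z})"
      using continuous_closedin_preimage[OF \<tau>c closed_atLeast[of 1]] by (simp add: vimage_def Int_def)
    have 2: "closedin (top_of_set (- {a, b})) ({z \<in> - {a, b}. \<tau> z \<le> 1})"
      using continuous_closedin_preimage[OF \<tau>c closed_atMost[of 1]] by (simp add: vimage_def Int_def)
    have vc: "continuous_on {z \<in> - {a, b}. 1 \<le> \<tau> z} v"
      unfolding v_def[abs_def]
      by (intro continuous_intros continuous_on_subset[OF \<tau>c]) auto
    have 3: "continuous_on {z \<in> - {a, b}. 1 \<le> \<tau> z} (\<lambda>z. max (u z) (v z))"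
      by (intro continuous_intros vc continuous_on_subset[OF uc]) auto
    have 4: "continuous_on {z \<in> - {a, b}. \<tau> z \<le> 1} u" by (rule continuous_on_subset[OF uc]) auto
    have "continuous_on ({z \<in> - {a, b}. 1 \<le> \<tau> z} \<union> {z \<in> - {a, b}. \<tau> z \<le> 1})
        (\<lambda>z. if \<tau> z \<ge> 1 then max (u z) (v z) else u z)"
    proof (rule continuous_on_cases_local)
      have U: "{z \<in> - {a, b}. 1 \<le> \<tau> z} \<union> {z \<in> - {a, b}. \<tau> z \<le> 1} = - {a, b}" by auto
      show "closedin (top_of_set ({z \<in> - {a, b}. 1 \<le> \<tau> z} \<union> {z \<in> - {a, b}. \<tau> z \<le> 1})) {z \<in> - {a, b}. 1 \<le> \<tau> z}"
        "closedin (top_of_set ({z \<in> - {a, b}. 1 \<le> \<tau> z} \<union> {z \<in> - {a, b}. \<tau> z \<le> 1})) {z \<in> - {a, b}. \<tau> z \<le> 1}"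
        unfolding U by (rule 1, rule 2)
      show "continuous_on {z \<in> - {a, b}. 1 \<le> \<tau> z} (\<lambda>z. max (u z) (v z))" by (rule 3)
      show "continuous_on {z \<in> - {a, b}. \<tau> z \<le> 1} u" by (rule 4)
      fix z assume "z \<in> {z \<in> - {a, b}. 1 \<le> \<tau> z} \<and> \<not> 1 \<le> \<tau> z \<or> z \<in> {z \<in> - {a, b}. \<tau> z \<le> 1} \<and> 1 \<le> \<tau> z"
      then have z: "z \<noteq> a" "\<tau> z = 1" by auto
      from vu[OF this] show "max (u z) (v z) = u z" by simp
    qed
    moreover have "{z \<in> - {a, b}. 1 \<le> \<tau> z} \<union> {z \<in> - {a, b}. \<tau> z \<le> 1} = - {a, b}" by auto
    ultimately show ?thesis unfolding p_def[abs_def] by simp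
  qed
  have LL: "ereal (exp (2 * p z)) \<le> lower_laplacian p z" if z: "z \<noteq> a" "z \<noteq> b" for z
  proof (cases "p z = u z")
    case True
    obtain L where L: "has_laplacian u z L" "exp (2 * u z) \<le> L" using u[OF z] by blast
    have "ereal L \<le> lower_laplacian p z"
      by (rule lower_laplacian_ge_touching[OF _ _ pc L(1)]) (use z True in \<open>auto simp: p_def open_Compl\<close>)
    moreover have "ereal (exp (2 * p z)) \<le> ereal L" using True L(2) by simp
    ultimately show ?thesis by (rule order_trans[rotated])
  next
    case False
    then have t: "\<tau> z \<ge> 1" and pv: "p z = v z" by (auto simp: p_def max_def split: if_splits)
    have "\<tau> z \<noteq> 1"
    proof
      assume t1: "\<tau> z = 1"
      from vu[OF z(1) t1] False show False by (simp add: p_def max_def split: if_splits)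
    qed
    then have t1: "\<tau> z > 1" using t by simp
    have op: "open ({z \<in> - {a, b}. 1 < \<tau> z})"
      using continuous_open_preimage[OF \<tau>c _ open_greaterThan[of 1]] by (simp add: vimage_def Int_def open_Compl)
    have zi: "z \<in> {z \<in> - {a, b}. 1 < \<tau> z}" using z t1 by simp
    have sub: "{z \<in> - {a, b}. 1 < \<tau> z} \<subseteq> - {a, b}" by auto
    have t0: "\<tau> z > 0" using t1 by simp
    have "ereal (1 / (norm (z - a) * \<tau> z)\<^sup>2) \<le> lower_laplacian p z"
      by (rule lower_laplacian_ge_touching[OF op zi continuous_on_subset[OF pc sub] vL[OF z(1) t0]])
         (use pv in \<open>auto simp: p_def\<close>)
    moreover have "ereal (exp (2 * p z)) \<le> ereal (1 / (norm (z - a) * \<tau> z)\<^sup>2)" using vle[OF z(1) t0] pv by simp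
    ultimately show ?thesis by (rule order_trans[rotated])
  qed
  define M where "M z = exp (p z)" for z
  have "SK_metric G M" if G: "open G" "G \<noteq> {}" "a \<notin> G" "b \<notin> G" for G
    unfolding SK_metric_def
  proof (intro conjI ballI impI)
    have sub: "G \<subseteq> - {a, b}" using G by auto
    show "continuous_on G M" unfolding M_def[abs_def] by (intro continuous_intros continuous_on_subset[OF pc sub])
    show "\<exists>z\<in>G. M z \<noteq> 0" using G(2) by (auto simp: M_def)
    fix z assume "z \<in> G"
    then have "ereal (exp (2 * p z)) \<le> lower_laplacian p z" using G by (intro LL) auto
    then show "ereal ((M z)\<^sup>2) \<le> lower_laplacian (\<lambda>w. ln (M w)) z" by (simp add: M_def exp_double)
  qed (simp add: M_def)
  moreover have "\<epsilon> / (norm (z - a) * (\<kappa> * (ln (norm (z - a)) - \<sigma>))) \<le> M z"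
    if "z \<noteq> a" "z \<noteq> b" "\<kappa> * (ln (norm (z - a)) - \<sigma>) \<ge> 1" for z
  proof -
    have t: "\<tau> z \<ge> 1" using that(3) by (simp add: \<tau>_def)
    then have "exp (v z) = \<epsilon> / (norm (z - a) * \<tau> z)" using that by (intro ev) auto
    moreover have "exp (v z) \<le> M z" using t by (simp add: M_def p_def)
    ultimately show ?thesis by (simp add: \<tau>_def)
  qed
  ultimately show thesis using \<epsilon>(1) by (intro that[of \<epsilon> M \<sigma>])
qed

section \<open>Completeness of the hyperbolic metric\<close>

text \<open>
  This is the fundamental theorem of calculus if \<open>h'\<close> is integrable; otherwise the right hand side is infinite.
\<close>
lemma nn_integral_ge_increment:
  fixes h h' f :: "real \<Rightarrow> real"
  assumes S: "finite S" and ab: "a \<le> b" and cont: "continuous_on {a..b} h"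
    and der: "\<And>t. t \<in> {a<..<b} - S \<Longrightarrow> (h has_real_derivative h' t) (at t)"
    and cont': "continuous_on ({a<..<b} - S) h'"
    and le: "\<And>t. t \<in> {a<..<b} - S \<Longrightarrow> \<bar>h' t\<bar> \<le> f t"
  shows "ennreal \<bar>h b - h a\<bar> \<le> (\<integral>\<^sup>+ t\<in>{a..b}. ennreal (f t) \<partial>lborel)"
proof -
  define V where "V = {a<..<b} - S"
  define \<phi> where "\<phi> t = indicator V t *\<^sub>R h' t" for t
  have "open V" unfolding V_def using S by (intro open_Diff finite_imp_closed) auto
  then have meas: "\<phi> \<in> borel_measurable borel"
    unfolding \<phi>_def[abs_def] using cont' by (intro borel_measurable_continuous_on_indicator) (auto simp: V_def)
  have "(\<integral>\<^sup>+ t. ennreal (norm (\<phi> t)) \<partial>lborel) \<le> (\<integral>\<^sup>+ t\<in>{a..b}. ennreal (f t) \<partial>lborel)"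
  proof (rule nn_integral_mono)
    fix t show "ennreal (norm (\<phi> t)) \<le> ennreal (f t) * indicator {a..b} t"
      using le[of t] by (cases "t \<in> V") (auto simp: \<phi>_def V_def intro!: ennreal_leI)
  qed
  moreover have "ennreal \<bar>h b - h a\<bar> \<le> (\<integral>\<^sup>+ t. ennreal (norm (\<phi> t)) \<partial>lborel)"
  proof (cases "(\<integral>\<^sup>+ t. ennreal (norm (\<phi> t)) \<partial>lborel) = \<infinity>")
    case False
    then have int: "integrable lborel \<phi>"
      using meas by (intro integrableI_bounded) (auto simp: top.not_eq_extremum less_top)
    have "(\<phi> has_integral (h b - h a)) {a..b}"
    proof (rule fundamental_theorem_of_calculus_interior_strong[OF S ab _ cont])
      fix t assume t: "t \<in> {a<..<b} - S"
      then show "(h has_vector_derivative \<phi> t) (at t)"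
        using der[OF t] by (simp add: \<phi>_def V_def has_real_derivative_iff_has_vector_derivative)
    qed
    then have "(\<phi> has_integral (h b - h a)) UNIV"
      by (rule has_integral_on_superset) (auto simp: \<phi>_def V_def)
    then have "h b - h a = integral\<^sup>L lborel \<phi>"
      using has_integral_integral_lborel[OF int] has_integral_unique by blast
    then show ?thesis using integral_norm_bound_ennreal[OF int] by simp
  qed simp
  ultimately show ?thesis by (rule order_trans[rotated])
qed

text \<open>
  In the region where \<open>\<kappa> * (ln \<bar>z - a\<bar> - \<sigma>)\<close> is at least \<open>1\<close>, the gradient of \<open>\<epsilon>\<close> times the logarithm of this
  expression is bounded by \<open>lam\<close>. The increment of that function up to the first time at which the path
  reaches the level \<open>T\<close> is a lower bound for the length.
\<close>
lemma metric_length_ge_near_cusp: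
  assumes \<gamma>: "valid_path \<gamma>" "path_image \<gamma> \<subseteq> G" "a \<notin> G" and \<kappa>: "\<kappa> = 1 \<or> \<kappa> = (-1::real)" and "\<epsilon> > 0"
    and lam: "\<And>z. \<lbrakk>z \<in> G; \<kappa> * (ln (norm (z - a)) - \<sigma>) \<ge> 1\<rbrakk> \<Longrightarrow>
        \<epsilon> / (norm (z - a) * (\<kappa> * (ln (norm (z - a)) - \<sigma>))) \<le> lam z"
    and T: "1 \<le> T" "\<kappa> * (ln (norm (\<gamma> 1 - a)) - \<sigma>) \<le> T" "T \<le> \<kappa> * (ln (norm (\<gamma> 0 - a)) - \<sigma>)"
  shows "ennreal (\<epsilon> * (ln (\<kappa> * (ln (norm (\<gamma> 0 - a)) - \<sigma>)) - ln T)) \<le> metric_length lam \<gamma>"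
proof -
  define \<tau> where "\<tau> t = \<kappa> * (ln (norm (\<gamma> t - a)) - \<sigma>)" for t
  have \<gamma>G: "\<gamma> t \<in> G" if "t \<in> {0..1}" for t using \<gamma>(2) that unfolding path_image_def by blast
  have \<gamma>a: "\<gamma> t \<noteq> a" if "t \<in> {0..1}" for t using \<gamma>G[OF that] \<gamma>(3) by auto
  have \<gamma>c: "continuous_on {0..1} \<gamma>" using valid_path_imp_path[OF \<gamma>(1)] by (simp add: path_def)
  have \<tau>c: "continuous_on {0..1} \<tau>" unfolding \<tau>_def[abs_def] using \<gamma>a by (intro continuous_intros \<gamma>c) auto
  obtain S where S: "finite S" "\<gamma> C1_differentiable_on ({0..1} - S)"
    using \<gamma>(1) unfolding valid_path_def piecewise_C1_differentiable_on_def by blast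
  obtain D where D: "\<And>t. t \<in> {0..1} - S \<Longrightarrow> (\<gamma> has_vector_derivative D t) (at t)" "continuous_on ({0..1} - S) D"
    using S(2) unfolding C1_differentiable_on_def by blast
  \<comment> \<open>From its start to the first time in \<open>Z\<close> the path stays in the region where the bound for \<open>lam\<close> applies.\<close>
  define Z where "Z = {t \<in> {0..1}. \<tau> t \<le> T}"
  have "closed Z" unfolding Z_def using continuous_on_closed_Collect_le[OF \<tau>c continuous_on_const closed_atLeastAtMost] by simp
  moreover have "1 \<in> Z" using T(2) by (simp add: Z_def \<tau>_def)
  moreover have bZ: "bdd_below Z" unfolding Z_def by (rule bdd_belowI[of _ 0]) auto
  ultimately have Inf: "Inf Z \<in> Z" by (intro closed_contains_Inf) auto
  define t1 where "t1 = Inf Z"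
  have t1: "t1 \<in> {0..1}" "\<tau> t1 \<le> T" using Inf by (auto simp: t1_def Z_def)
  have before: "\<tau> t > T" if "t \<in> {0..<t1}" for t
  proof (rule ccontr)
    assume "\<not> T < \<tau> t"
    then have "t \<in> Z" using that t1 by (simp add: Z_def)
    then have "t1 \<le> t" unfolding t1_def using bZ by (rule cInf_lower)
    then show False using that by simp
  qed
  have pos: "\<tau> t \<ge> T" if "t \<in> {0..t1}" for t
  proof (cases "t < t1")
    case True then show ?thesis using before[of t] that by auto
  next
    case False
    then have t: "t = t1" using that by simp
    show ?thesis
    proof (cases "t1 = 0")
      case True then show ?thesis using T(3) t by (simp add: \<tau>_def)
    next
      case False
      then have "0 < t1" using t1 by simp
      have "(\<tau> \<longlongrightarrow> \<tau> t1) (at_left t1)"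
      proof -
        have "(\<tau> \<longlongrightarrow> \<tau> t1) (at t1 within {0..1})" using \<tau>c t1 by (simp add: continuous_on_def)
        then have "(\<tau> \<longlongrightarrow> \<tau> t1) (at t1 within {0..t1})" using t1 by (elim tendsto_within_subset) auto
        moreover have "at t1 within {0..t1} = at_left t1"
          using \<open>0 < t1\<close> by (simp add: at_within_Icc_at_left)
        ultimately show ?thesis by simp
      qed
      moreover have "\<forall>\<^sub>F s in at_left t1. T \<le> \<tau> s"
        using eventually_at_left_real[OF \<open>0 < t1\<close>] by eventually_elim (use before in \<open>auto simp: less_imp_le\<close>)
      ultimately show ?thesis unfolding t by (intro tendsto_lowerbound[of \<tau> "\<tau> t1" "at_left t1"]) auto
    qed
  qed
  define h where "h t = \<epsilon> * ln (\<tau> t)" for t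
  define h' where "h' t = \<epsilon> * (\<kappa> * Re (D t / (\<gamma> t - a)) / \<tau> t)" for t
  have sub: "{0<..<t1} - S \<subseteq> {0..1} - S" "{0..t1} \<subseteq> {0..1}" using t1 by auto
  have "ennreal \<bar>h t1 - h 0\<bar> \<le> (\<integral>\<^sup>+ t\<in>{0..t1}. ennreal (lam (\<gamma> t) * norm (vector_derivative \<gamma> (at t within {0..1}))) \<partial>lborel)"
  proof (rule nn_integral_ge_increment[OF S(1)])
    show "0 \<le> t1" using t1 by simp
    have tp: "\<tau> t > 0" if "t \<in> {0..t1}" for t using pos[OF that] T(1) by simp
    show "continuous_on {0..t1} h"
      unfolding h_def[abs_def] using tp by (intro continuous_intros continuous_on_subset[OF \<tau>c sub(2)]) (auto simp: less_imp_neq[THEN not_sym])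
    show "continuous_on ({0<..<t1} - S) h'"
      unfolding h'_def[abs_def]
      by (intro continuous_intros continuous_on_subset[OF D(2) sub(1)] continuous_on_subset[OF \<gamma>c] continuous_on_subset[OF \<tau>c])
         (use tp \<gamma>a t1 in \<open>auto simp: less_imp_neq[THEN not_sym]\<close>)
    fix t assume t: "t \<in> {0<..<t1} - S"
    then have t': "t \<in> {0..1} - S" "t \<in> {0..1}" "t \<in> {0..t1}" using t1 by auto
    have "(\<gamma> has_derivative (\<lambda>k. k *\<^sub>R D t)) (at t)" using D(1)[OF t'(1)] by (simp add: has_vector_derivative_def)
    from has_derivative_compose[OF this has_derivative_ln_norm[OF \<gamma>a[OF t'(2)]]]
    have "((\<lambda>t. ln (norm (\<gamma> t - a))) has_real_derivative Re (D t / (\<gamma> t - a))) (at t)"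
      unfolding has_field_derivative_def
    proof (rule has_derivative_eq_rhs)
      have "k *\<^sub>R D t / (\<gamma> t - a) = k *\<^sub>R (D t / (\<gamma> t - a))" for k by (simp add: scaleR_conv_of_real)
      then have "Re (k *\<^sub>R D t / (\<gamma> t - a)) = k * Re (D t / (\<gamma> t - a))" for k by (simp only: scaleR_complex.sel)
      then show "(\<lambda>k. Re (k *\<^sub>R D t / (\<gamma> t - a))) = (*) (Re (D t / (\<gamma> t - a)))" by (simp add: fun_eq_iff mult.commute)
    qed
    then have "(\<tau> has_real_derivative \<kappa> * (Re (D t / (\<gamma> t - a)) - 0)) (at t)"
      unfolding \<tau>_def[abs_def] by (intro DERIV_cmult DERIV_diff DERIV_const)
    then have "((\<lambda>t. ln (\<tau> t)) has_real_derivative inverse (\<tau> t) * (\<kappa> * (Re (D t / (\<gamma> t - a)) - 0))) (at t)"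
      by (rule DERIV_chain2[where f = ln and g = \<tau>, OF DERIV_ln[OF tp[OF t'(3)]]])
    from DERIV_cmult[OF this, of \<epsilon>]
    show "(h has_real_derivative h' t) (at t)" unfolding h_def[abs_def] h'_def by (simp add: divide_inverse mult_ac)
    have vd: "vector_derivative \<gamma> (at t within {0..1}) = D t"
      using D(1)[OF t'(1)] t'(2) by (intro vector_derivative_at_within_ivl) auto
    have "\<bar>Re (D t / (\<gamma> t - a))\<bar> \<le> norm (D t) / norm (\<gamma> t - a)"
      using abs_Re_le_cmod[of "D t / (\<gamma> t - a)"] by (simp add: norm_divide)
    then have "\<bar>h' t\<bar> \<le> \<epsilon> * (norm (D t) / norm (\<gamma> t - a) / \<tau> t)"
      using tp[OF t'(3)] \<open>\<epsilon> > 0\<close> \<kappa> unfolding h'_def abs_mult abs_divide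
      by (intro mult_mono divide_mono) auto
    also have "\<dots> = \<epsilon> / (norm (\<gamma> t - a) * \<tau> t) * norm (D t)" by simp
    also have "\<dots> \<le> lam (\<gamma> t) * norm (D t)"
      using lam[OF \<gamma>G[OF t'(2)]] pos[OF t'(3)] T(1) unfolding \<tau>_def by (intro mult_right_mono) auto
    finally show "\<bar>h' t\<bar> \<le> lam (\<gamma> t) * norm (vector_derivative \<gamma> (at t within {0..1}))" unfolding vd .
  qed
  also have "\<dots> \<le> metric_length lam \<gamma>"
    unfolding metric_length_def using t1 by (intro nn_integral_mono mult_left_mono) (auto simp: indicator_def)
  finally have "ennreal \<bar>h t1 - h 0\<bar> \<le> metric_length lam \<gamma>" .
  moreover have "\<epsilon> * (ln (\<tau> 0) - ln T) \<le> \<bar>h t1 - h 0\<bar>"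
  proof -
    have "\<tau> t1 = T" using pos[of t1] t1 by simp
    then have "h 0 - h t1 = \<epsilon> * (ln (\<tau> 0) - ln T)" by (simp add: h_def algebra_simps)
    then show ?thesis by linarith
  qed
  ultimately show ?thesis unfolding \<tau>_def using ennreal_leI order_trans by blast
qed

text \<open>
  The lower bound \<open>\<epsilon> * (ln \<tau> - ln T)\<close> for the distance at level \<open>\<tau>\<close> exceeds \<open>M\<close> as soon as \<open>\<tau>\<close> exceeds
  \<open>T * exp (max M 0 / \<epsilon>)\<close>.
\<close>
lemma bounded_distance_near_cusp:
  assumes "a \<notin> G" and \<kappa>: "\<kappa> = 1 \<or> \<kappa> = (-1::real)" and "\<epsilon> > 0"
    and lam: "\<And>z. \<lbrakk>z \<in> G; \<kappa> * (ln (norm (z - a)) - \<sigma>) \<ge> 1\<rbrakk> \<Longrightarrow>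
        \<epsilon> / (norm (z - a) * (\<kappa> * (ln (norm (z - a)) - \<sigma>))) \<le> lam z"
  obtains B where "\<And>z. \<lbrakk>z \<in> G; metric_dist G lam z z0 \<le> ennreal M\<rbrakk> \<Longrightarrow> \<kappa> * (ln (norm (z - a)) - \<sigma>) \<le> B"
proof -
  define T where "T = max 1 (\<kappa> * (ln (norm (z0 - a)) - \<sigma>))"
  define M' where "M' = max M 0"
  define B where "B = T * exp (M' / \<epsilon>)"
  have T: "T \<ge> 1" "T \<ge> \<kappa> * (ln (norm (z0 - a)) - \<sigma>)" by (auto simp: T_def)
  have TB: "T \<le> B" using T(1) \<open>\<epsilon> > 0\<close> by (simp add: B_def M'_def)
  have "\<kappa> * (ln (norm (z - a)) - \<sigma>) \<le> B" if z: "z \<in> G" "metric_dist G lam z z0 \<le> ennreal M" for z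
  proof (rule ccontr)
    assume "\<not> \<kappa> * (ln (norm (z - a)) - \<sigma>) \<le> B"
    define t where "t = \<kappa> * (ln (norm (z - a)) - \<sigma>)"
    have t: "t > B" using \<open>\<not> \<kappa> * (ln (norm (z - a)) - \<sigma>) \<le> B\<close> by (simp add: t_def)
    have "ennreal (\<epsilon> * (ln t - ln T)) \<le> metric_dist G lam z z0"
      unfolding metric_dist_def
    proof (rule INF_greatest)
      fix \<gamma> assume "\<gamma> \<in> {\<gamma>. valid_path \<gamma> \<and> path_image \<gamma> \<subseteq> G \<and> pathstart \<gamma> = z \<and> pathfinish \<gamma> = z0}"
      then have \<gamma>: "valid_path \<gamma>" "path_image \<gamma> \<subseteq> G" "\<gamma> 0 = z" "\<gamma> 1 = z0" by (auto simp: pathstart_def pathfinish_def)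
      show "ennreal (\<epsilon> * (ln t - ln T)) \<le> metric_length lam \<gamma>"
        using metric_length_ge_near_cusp[OF \<gamma>(1,2) assms(1) \<kappa> \<open>\<epsilon> > 0\<close> lam T(1)] T(2) t TB
        unfolding \<gamma>(3,4) t_def by simp
    qed
    also have "\<dots> \<le> ennreal M" by (rule z(2))
    also have "\<dots> \<le> ennreal M'" by (simp add: M'_def ennreal_leI)
    finally have "\<epsilon> * (ln t - ln T) \<le> M'" by (simp add: M'_def ennreal_le_iff)
    then have "ln t \<le> ln T + M' / \<epsilon>" using \<open>\<epsilon> > 0\<close> by (simp add: field_simps)
    also have "\<dots> = ln B" using T(1) by (simp add: B_def ln_mult)
    finally have "t \<le> B" using t TB T(1) by simp
    then show False using t by simp
  qed
  then show thesis by (rule that)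
qed

text \<open>
  If \<open>p\<close> were the only omitted point, then \<open>w \<mapsto> p + exp (R * w)\<close> would map the disc into \<open>G\<close> for every \<open>R > 0\<close>, and Ahlfors' lemma would force
  \<open>lam (p + 1) = 0\<close>.
\<close>
lemma omits_point:
  assumes G: "open G" and SK: "SK_metric G lam" and pos: "\<And>z. z \<in> G \<Longrightarrow> lam z > 0"
  shows "\<exists>b. b \<noteq> p \<and> b \<notin> G"
proof (rule ccontr)
  assume "\<nexists>b. b \<noteq> p \<and> b \<notin> G"
  then have sub: "- {p} \<subseteq> G" by auto
  have zG: "p + 1 \<in> G" using sub by auto
  have "lam (p + 1) * R \<le> 2" if R: "R > 0" for R :: real
  proof -
    define h where "h w = p + exp (of_real R * w)" for w
    have dh: "(h has_field_derivative of_real R * exp (of_real R * w)) (at w)" for w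
      unfolding h_def[abs_def] by (auto intro!: derivative_eq_intros)
    have hol: "h holomorphic_on ball 0 1" unfolding h_def[abs_def] by (intro holomorphic_intros)
    have im: "h ` ball 0 1 \<subseteq> G" using sub by (auto simp: h_def)
    have "lam (h 0) * norm (deriv h 0) \<le> 2" by (rule ahlfors_lemma[OF G SK hol im])
    moreover have "deriv h 0 = of_real R" using DERIV_imp_deriv[OF dh[of 0]] by simp
    ultimately show ?thesis using R by (simp add: h_def)
  qed
  from this[of "4 / lam (p + 1)"] pos[OF zG] show False by simp
qed

text \<open>
  The lower bounds near cusps, applied to \<open>\<infinity>\<close> and to each point outside \<open>G\<close>, show that a set of bounded distance is
  bounded and that its closure lies in \<open>G\<close>. A sequence that leaves every compact set leaves this closure.
\<close>
theorem hyperbolic_imp_complete: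
  assumes G: "open G" "G \<noteq> {}" and pos: "\<And>z. z \<in> G \<Longrightarrow> lam z > 0"
    and hyp: "is_hyperbolic_metric G lam"
  shows "complete_conformal_metric G lam"
proof -
  have SK: "SK_metric G lam" and sup: "\<And>z. z \<in> G \<Longrightarrow> ereal (lam z) = (SUP \<mu> \<in> {\<mu>. SK_metric G \<mu>}. ereal (\<mu> z))"
    using hyp unfolding is_hyperbolic_metric_def by auto
  have max: "\<mu> z \<le> lam z" if "SK_metric G \<mu>" "z \<in> G" for \<mu> z
  proof -
    have "ereal (\<mu> z) \<le> ereal (lam z)" unfolding sup[OF that(2)] using that(1) by (intro SUP_upper) simp
    then show ?thesis by simp
  qed
  have other: "\<exists>b. b \<noteq> p \<and> b \<notin> G" for p by (rule omits_point[OF G(1) SK pos])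
  obtain z0 where z0: "z0 \<in> G" using G(2) by blast
  have cusp: "\<exists>\<sigma> B. \<forall>z\<in>G. metric_dist G lam z z0 \<le> ennreal M \<longrightarrow> \<kappa> * (ln (norm (z - a)) - \<sigma>) \<le> B"
    if a: "a \<notin> G" and \<kappa>: "\<kappa> = 1 \<or> \<kappa> = (-1::real)" for a \<kappa> M
  proof -
    obtain b where b: "b \<noteq> a" "b \<notin> G" using other by blast
    obtain \<epsilon> \<sigma> \<mu> where e: "\<epsilon> > 0"
      and SK\<mu>: "\<And>G. \<lbrakk>open G; G \<noteq> {}; a \<notin> G; b \<notin> G\<rbrakk> \<Longrightarrow> SK_metric G \<mu>"
      and \<mu>: "\<And>z. \<lbrakk>z \<noteq> a; z \<noteq> b; \<kappa> * (ln (norm (z - a)) - \<sigma>) \<ge> 1\<rbrakk> \<Longrightarrow>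
        \<epsilon> / (norm (z - a) * (\<kappa> * (ln (norm (z - a)) - \<sigma>))) \<le> \<mu> z"
      by (rule cusp_SK_metric[OF b(1)[symmetric] \<kappa>], intro that)
    have lam: "\<epsilon> / (norm (z - a) * (\<kappa> * (ln (norm (z - a)) - \<sigma>))) \<le> lam z"
      if "z \<in> G" "\<kappa> * (ln (norm (z - a)) - \<sigma>) \<ge> 1" for z
    proof -
      have "z \<noteq> a" "z \<noteq> b" using that(1) a b by auto
      then show ?thesis using \<mu>[OF _ _ that(2)] max[OF SK\<mu>[OF G a b(2)] that(1)] by (meson order_trans)
    qed
    obtain B where "\<And>z. \<lbrakk>z \<in> G; metric_dist G lam z z0 \<le> ennreal M\<rbrakk> \<Longrightarrow> \<kappa> * (ln (norm (z - a)) - \<sigma>) \<le> B"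
      by (rule bounded_distance_near_cusp[OF a \<kappa> e lam], assumption, assumption, intro that)
    then show ?thesis by blast
  qed
  have compact_ball: "\<exists>K. compact K \<and> K \<subseteq> G \<and> (\<forall>z\<in>G. metric_dist G lam z z0 \<le> ennreal M \<longrightarrow> z \<in> K)" for M
  proof -
    define A where "A = {z \<in> G. metric_dist G lam z z0 \<le> ennreal M}"
    obtain a where a: "a \<notin> G" using other by blast
    have "bounded A"
    proof -
      obtain \<sigma> B where B: "\<forall>z\<in>G. metric_dist G lam z z0 \<le> ennreal M \<longrightarrow> 1 * (ln (norm (z - a)) - \<sigma>) \<le> B"
        using cusp[OF a, of 1 M] by blast
      have "dist a z \<le> exp (B + \<sigma>)" if "z \<in> A" for z
      proof -
        have "z \<noteq> a" using that a by (auto simp: A_def)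
        have "ln (norm (z - a)) \<le> B + \<sigma>" using B that by (auto simp: A_def)
        then have "exp (ln (norm (z - a))) \<le> exp (B + \<sigma>)" by simp
        then show ?thesis using \<open>z \<noteq> a\<close> by (simp add: dist_norm norm_minus_commute)
      qed
      then show ?thesis unfolding bounded_def by blast
    qed
    moreover have "closure A \<subseteq> G"
    proof
      fix p assume p: "p \<in> closure A"
      show "p \<in> G"
      proof (rule ccontr)
        assume pG: "p \<notin> G"
        obtain \<sigma> B where B: "\<forall>z\<in>G. metric_dist G lam z z0 \<le> ennreal M \<longrightarrow> - 1 * (ln (norm (z - p)) - \<sigma>) \<le> B"
          using cusp[OF pG, of "- 1" M] by blast
        obtain z where z: "z \<in> A" "dist z p < exp (\<sigma> - B)"
          using p unfolding closure_approachable by (meson exp_gt_zero)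
        have "z \<noteq> p" using z(1) pG by (auto simp: A_def)
        have "\<sigma> - B \<le> ln (norm (z - p))" using B z(1) by (force simp: A_def)
        then have "exp (\<sigma> - B) \<le> exp (ln (norm (z - p)))" by simp
        then show False using z(2) \<open>z \<noteq> p\<close> by (simp add: dist_norm)
      qed
    qed
    ultimately show ?thesis
      using closure_subset[of A] by (intro exI[of _ "closure A"]) (auto simp: compact_closure A_def)
  qed
  show ?thesis
    unfolding complete_conformal_metric_def
  proof (intro bexI[OF _ z0] allI impI)
    fix zs :: "nat \<Rightarrow> complex"
    assume zs: "(\<forall>n. zs n \<in> G) \<and> (\<forall>K. compact K \<and> K \<subseteq> G \<longrightarrow> (\<forall>\<^sub>F n in sequentially. zs n \<notin> K))"
    show "(\<lambda>n. metric_dist G lam (zs n) z0) \<longlonglongrightarrow> top"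
    proof (rule order_tendstoI)
      fix y :: ennreal assume "y < top"
      then obtain M where M: "y = ennreal M" using less_top_ennreal by blast
      obtain K where K: "compact K" "K \<subseteq> G" "\<forall>z\<in>G. metric_dist G lam z z0 \<le> ennreal M \<longrightarrow> z \<in> K"
        using compact_ball[of M] by blast
      have "\<forall>\<^sub>F n in sequentially. zs n \<notin> K" using zs K by blast
      then show "\<forall>\<^sub>F n in sequentially. y < metric_dist G lam (zs n) z0"
      proof eventually_elim
        case (elim n)
        have "zs n \<in> G" using zs by blast
        with elim K(3) show ?case unfolding M by (meson not_le_imp_less)
      qed
    qed (simp add: top.not_eq_extremum)
  qed
qed

section \<open>The equivalence\<close>

theorem theorem5p9:
  fixes G :: "complex set" and lam :: "complex \<Rightarrow> real"
  assumes domain: "open G" "connected G" "G \<noteq> {}"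
    and regular: "regular_conformal_metric G lam"
    and curv: "\<forall>z\<in>G. curvature lam z = -1"
  defines "a \<equiv> complete_conformal_metric G lam"
    and "b \<equiv> (\<forall>f. developing_map G lam f \<longrightarrow>
           (\<forall>w0 g \<gamma>. inverse_branch f w0 g \<and> valid_path \<gamma> \<and> path_image \<gamma> \<subseteq> ball 0 1 \<and>
              pathstart \<gamma> = w0 \<longrightarrow> continuable_along G \<gamma> g))"
    and "c \<equiv> is_hyperbolic_metric G lam"
  shows "(a \<longleftrightarrow> b) \<and> (b \<longleftrightarrow> c)"
proof -
  have ab: "a \<Longrightarrow> b"
    unfolding a_def b_def
    using complete_imp_inverse_branches_continuable[OF domain(1,2) regular curv] by blast
  have bc: "b \<Longrightarrow> c"
    unfolding b_def c_def by (rule continuable_imp_hyperbolic[OF domain(1,3) regular curv])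
  have ca: "c \<Longrightarrow> a"
    unfolding c_def a_def
    by (rule hyperbolic_imp_complete[OF domain(1,3)]) (use regular in \<open>auto simp: regular_conformal_metric_def\<close>)
  show ?thesis using ab bc ca by blast
qed

end
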